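(* Let $m\in\mathbb{N}$ and $x^{(m)}=(x^{(m)}_1,\dots,x^{(m)}_m)\in\mathrm{Conf}_m^0(\mathbb{R})$. The rising GUE eigenvalue process started at $x^{(m)}$ (viewed as the point process $\{(n,x_i^{(n)}): n>m,\ 1\le i\le n\}$ on $\mathbb{N}_{>m}\times\mathbb{R}$) is determinantal with respect to the product of counting measure on $\mathbb{N}$ and Lebesgue measure on $\mathbb{R}$. For $n_1,n_2\in\mathbb{N}_{>m}$ and $x_1,x_2\in\mathbb{R}$ its kernel is $$K^{\mathrm{GUE}}_{x^{(m)}}(n_1,x_1;n_2,x_2)=\frac{(n_1-m)!}{(n_2-m-1)!}\,\frac{-1}{(2\pi i)^2}\int_{\Gamma}dz\oint_{c(x_1)}dw\,\frac{(z-x_2)^{n_2-m-1}}{(w-x_1)^{n_1-m+1}}\,\frac{e^{z^2/2-w^2/2}}{w-z}\prod_{r=1}^m\frac{w-x_r^{(m)}}{z-x_r^{(m)}}.$$ Here $\Gamma=b+i\mathbb{R}$, oriented in the positive imaginary direction, where $b\in\mathbb{R}$ satisfies: $x_2<b$; $b<x_j^{(m)}$ for all $j\in\{1,\dots,m\}$ with $x_j^{(m)}>x_2$; and $b<x_1$ if $x_2<x_1$. The value of the integral is independent of any such choice of $b$. The contour $c(x_1)$ is a small positively oriented closed contour around $x_1$, containing none of the $x_j^{(m)}$ unless $x_j^{(m)}=x_1$, and not intersecting $\Gamma$.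
   Context: $\mathrm{Conf}_n^0(\mathbb{R})$ is the set of $n$-tuples $x^{(n)}=(x_1^{(n)},\dots,x_n^{(n)})$ of reals with $x_1^{(n)}>x_2^{(n)}>\dots>x_n^{(n)}$. Write $x^{(n)}\prec x^{(n+1)}$ (interlacing) if $x_i^{(n+1)}\ge x_i^{(n)}\ge x_{i+1}^{(n+1)}$ for $1\le i\le n$. The GUE transition density (with respect to Lebesgue measure on $\mathrm{Conf}_{n+1}^0(\mathbb{R})$) from $x^{(n)}\in\mathrm{Conf}_n^0(\mathbb{R})$ to $x^{(n+1)}$ is $$p_{n,n+1}(x^{(n)};x^{(n+1)})=\frac{1}{\sqrt{2\pi}}\mathbf 1_{x^{(n)}\prec x^{(n+1)}}\frac{\prod_{k<j}(x_k^{(n+1)}-x_j^{(n+1)})}{\prod_{k<j}(x_k^{(n)}-x_j^{(n)})}\exp\Big(-\sum_{k=1}^{n+1}\tfrac{(x_k^{(n+1)})^2}{2}+\sum_{k=1}^{n}\tfrac{(x_k^{(n)})^2}{2}\Big).$$ The rising GUE eigenvalue process started at $x^{(m)}$ is the Markov process $(x^{(r)})_{r\ge m+1}$ on $\prod_{r\ge m+1}\mathrm{Conf}_r^0(\mathbb{R})$ with transition densities $p_{r,r+1}$, $r\ge m$, and initial condition $x^{(m)}$. A point process on $\mathcal X$ with reference measure $\mu$ is determinantal with kernel $K:\mathcal X\times\mathcal X\to\mathbb{C}$ if for all $n\ge1$ its $n$-point correlation function with respect to $\mu^{\otimes n}$ is $\rho_n(p_1,\dots,p_n)=\det[K(p_i,p_j)]_{i,j=1}^n$.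 *)

theory Defs
  imports
    "HOL-Probability.Probability"
    "HOL-Complex_Analysis.Complex_Analysis"
    "Jordan_Normal_Form.Determinant"
begin

section \<open>Determinantal point processes\<close>

text \<open>
  A simple point process on \<open>space \<mu>\<close> is given by its random set of points \<open>\<Xi> \<omega>\<close>, which is
  locally finite and has measurable counts.
\<close>

definition simple_point_process ::
    "'w measure \<Rightarrow> 'p::topological_space measure \<Rightarrow> ('w \<Rightarrow> 'p set) \<Rightarrow> bool" where
  "simple_point_process M \<mu> \<Xi> \<longleftrightarrow>
     prob_space M \<and>
     (\<forall>\<omega>\<in>space M. \<Xi> \<omega> \<subseteq> space \<mu>) \<and>
     (\<forall>\<omega>\<in>space M. \<forall>C. compact C \<longrightarrow> finite (\<Xi> \<omega> \<inter> C)) \<and>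
     (\<forall>A\<in>sets \<mu>. (\<lambda>\<omega>. emeasure (count_space UNIV) (\<Xi> \<omega> \<inter> A)) \<in> borel_measurable M)"

text \<open>
  \<open>\<rho>\<close> is an \<open>n\<close>-point correlation function with respect to \<open>\<mu>\<^sup>\<otimes>\<^sup>n\<close> if it is a density of the
  \<open>n\<close>-th factorial moment measure, which maps \<open>A\<close> to the expected number of \<open>n\<close>-tuples of
  pairwise distinct points of the process that lie in \<open>A\<close>.
\<close>

definition correlation_function ::
    "'w measure \<Rightarrow> 'p measure \<Rightarrow> ('w \<Rightarrow> 'p set) \<Rightarrow> nat \<Rightarrow> ((nat \<Rightarrow> 'p) \<Rightarrow> real) \<Rightarrow> bool" where
  "correlation_function M \<mu> \<Xi> n \<rho> \<longleftrightarrow>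
     \<rho> \<in> borel_measurable (PiM {..<n} (\<lambda>_. \<mu>)) \<and>
     (\<forall>p\<in>space (PiM {..<n} (\<lambda>_. \<mu>)). 0 \<le> \<rho> p) \<and>
     (\<forall>A\<in>sets (PiM {..<n} (\<lambda>_. \<mu>)).
        (\<integral>\<^sup>+\<omega>. emeasure (count_space UNIV) {p\<in>A. inj_on p {..<n} \<and> p ` {..<n} \<subseteq> \<Xi> \<omega>} \<partial>M)
        = (\<integral>\<^sup>+p\<in>A. ennreal (\<rho> p) \<partial>PiM {..<n} (\<lambda>_. \<mu>)))"

text \<open>
  Correlation functions are densities, so the determinantal identity is an identity almost
  everywhere. The constant \<open>Determinant.det\<close> is the determinant of matrices with dimensions
  given by terms.
\<close>

definition determinantal ::
    "'w measure \<Rightarrow> 'p::topological_space measure \<Rightarrow> ('w \<Rightarrow> 'p set) \<Rightarrow> ('p \<Rightarrow> 'p \<Rightarrow> complex) \<Rightarrow> bool"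
  where
  "determinantal M \<mu> \<Xi> K \<longleftrightarrow>
     simple_point_process M \<mu> \<Xi> \<and>
     (\<forall>n\<ge>1. \<exists>\<rho>. correlation_function M \<mu> \<Xi> n \<rho> \<and>
        (AE p in PiM {..<n} (\<lambda>_. \<mu>).
           complex_of_real (\<rho> p) = Determinant.det (Matrix.mat n n (\<lambda>(i, j). K (p i) (p j)))))"

section \<open>The rising GUE eigenvalue process\<close>

text \<open>
  Real \<open>n\<close>-tuples are the elements of \<open>{1..n} \<rightarrow>\<^sub>E UNIV\<close>, the space of the product measure
  \<open>PiM {1..n} (\<lambda>_. lborel)\<close>; for \<open>n = 0\<close> this is a single point of mass one.
\<close>

definition Conf0 :: "nat \<Rightarrow> (nat \<Rightarrow> real) set" where
  "Conf0 n = {x \<in> {1..n} \<rightarrow>\<^sub>E UNIV. \<forall>i\<in>{1..n}. \<forall>j\<in>{1..n}. i < j \<longrightarrow> x i > x j}"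

definition conf_lborel :: "nat \<Rightarrow> (nat \<Rightarrow> real) measure" where
  "conf_lborel n = restrict_space (PiM {1..n} (\<lambda>_. lborel)) (Conf0 n)"

definition interlacing :: "nat \<Rightarrow> (nat \<Rightarrow> real) \<Rightarrow> (nat \<Rightarrow> real) \<Rightarrow> bool" where
  "interlacing n x y \<longleftrightarrow> (\<forall>i\<in>{1..n}. y i \<ge> x i \<and> x i \<ge> y (i + 1))"

definition vandermonde :: "nat \<Rightarrow> (nat \<Rightarrow> real) \<Rightarrow> real" where
  "vandermonde n x = (\<Prod>j\<in>{1..n}. \<Prod>k\<in>{1..<j}. x k - x j)"

definition gue_density :: "nat \<Rightarrow> (nat \<Rightarrow> real) \<Rightarrow> (nat \<Rightarrow> real) \<Rightarrow> real" where
  "gue_density n x y =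
     1 / sqrt (2 * pi) * of_bool (interlacing n x y) * (vandermonde (n + 1) y / vandermonde n x) *
     exp (- (\<Sum>k=1..n+1. (y k)\<^sup>2 / 2) + (\<Sum>k=1..n. (x k)\<^sup>2 / 2))"

text \<open>The sigma-algebra generated by \<open>X m, \<dots>, X r\<close>.\<close>

definition conf_history ::
    "'w measure \<Rightarrow> (nat \<Rightarrow> 'w \<Rightarrow> nat \<Rightarrow> real) \<Rightarrow> nat \<Rightarrow> nat \<Rightarrow> 'w measure" where
  "conf_history M X m r =
     sigma (space M) (\<Union>s\<in>{m..r}. {X s -` A \<inter> space M | A. A \<in> sets (conf_lborel s)})"

text \<open>
  The process starts in \<open>X m = x\<close>, and the conditional law of \<open>X (r + 1)\<close> given \<open>X m, \<dots>, X r\<close>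
  has density \<open>gue_density r (X r)\<close>.
\<close>

definition rising_gue_process ::
    "nat \<Rightarrow> (nat \<Rightarrow> real) \<Rightarrow> 'w measure \<Rightarrow> (nat \<Rightarrow> 'w \<Rightarrow> nat \<Rightarrow> real) \<Rightarrow> bool" where
  "rising_gue_process m x M X \<longleftrightarrow>
     prob_space M \<and>
     (\<forall>r\<ge>m. X r \<in> M \<rightarrow>\<^sub>M conf_lborel r) \<and>
     (\<forall>\<omega>\<in>space M. X m \<omega> = x) \<and>
     (\<forall>r\<ge>m. \<forall>A\<in>sets (conf_lborel (r + 1)).
        AE \<omega> in M.
          nn_cond_exp M (conf_history M X m r) (\<lambda>\<omega>'. indicator A (X (r + 1) \<omega>')) \<omega>
          = (\<integral>\<^sup>+y\<in>A. ennreal (gue_density r (X r \<omega>) y) \<partial>conf_lborel (r + 1)))"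

definition level_points :: "nat \<Rightarrow> (nat \<Rightarrow> 'w \<Rightarrow> nat \<Rightarrow> real) \<Rightarrow> 'w \<Rightarrow> (nat \<times> real) set" where
  "level_points m X \<omega> = {(n, X n \<omega> i) | n i. n > m \<and> 1 \<le> i \<and> i \<le> n}"

definition level_measure :: "nat \<Rightarrow> (nat \<times> real) measure" where
  "level_measure m = count_space {m<..} \<Otimes>\<^sub>M lborel"

section \<open>The correlation kernel\<close>

definition admissible_line :: "nat \<Rightarrow> (nat \<Rightarrow> real) \<Rightarrow> real \<Rightarrow> real \<Rightarrow> real \<Rightarrow> bool" where
  "admissible_line m x x1 x2 b \<longleftrightarrow>
     x2 < b \<and> (\<forall>j\<in>{1..m}. x j > x2 \<longrightarrow> b < x j) \<and> (x2 < x1 \<longrightarrow> b < x1)"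

definition admissible_loop ::
    "nat \<Rightarrow> (nat \<Rightarrow> real) \<Rightarrow> real \<Rightarrow> real \<Rightarrow> (real \<Rightarrow> complex) \<Rightarrow> bool" where
  "admissible_loop m x x1 b \<gamma> \<longleftrightarrow>
     valid_path \<gamma> \<and> simple_path \<gamma> \<and> pathfinish \<gamma> = pathstart \<gamma> \<and>
     complex_of_real x1 \<in> inside (path_image \<gamma>) \<and> winding_number \<gamma> (complex_of_real x1) = 1 \<and>
     (\<forall>j\<in>{1..m}. x j \<noteq> x1 \<longrightarrow> complex_of_real (x j) \<notin> path_image \<gamma> \<union> inside (path_image \<gamma>)) \<and>
     path_image \<gamma> \<inter> {z. Re z = b} = {}"

text \<open>The integral of \<open>f\<close> over \<open>b + \<i>\<real>\<close>, oriented upwards.\<close>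

definition vertical_line_integral :: "real \<Rightarrow> (complex \<Rightarrow> complex) \<Rightarrow> complex" where
  "vertical_line_integral b f = (LBINT t. f (Complex b t) * \<i>)"

definition gue_kernel ::
    "nat \<Rightarrow> (nat \<Rightarrow> real) \<Rightarrow> real \<Rightarrow> (real \<Rightarrow> complex) \<Rightarrow> nat \<times> real \<Rightarrow> nat \<times> real \<Rightarrow> complex" where
  "gue_kernel m x b \<gamma> = (\<lambda>(n1, x1) (n2, x2).
     fact (n1 - m) / fact (n2 - m - 1) * (- 1 / (2 * complex_of_real pi * \<i>)\<^sup>2) *
     vertical_line_integral b (\<lambda>z. contour_integral \<gamma> (\<lambda>w.
       (z - complex_of_real x2) ^ (n2 - m - 1) / (w - complex_of_real x1) ^ (n1 - m + 1) *
       (exp (z\<^sup>2 / 2 - w\<^sup>2 / 2) / (w - z)) *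
       (\<Prod>r=1..m. (w - complex_of_real (x r)) / (z - complex_of_real (x r))))))"

end

theory Submission
  imports Defs
begin

text \<open>
  For a process that starts at level \<open>m\<close> in \<open>x\<close>, the kernel between the levels \<open>m + k\<close> and \<open>m + l + 1\<close>
  is the \<open>k\<close>-th derivative, in its first variable, of the function that vanishes at all \<open>x r\<close> and
  differs from the Gaussian integral \<open>gauss_prim l\<close> by a Gaussian times a polynomial of degree less
  than \<open>m\<close>. This has three consequences. If the second argument is a point of level \<open>m + 1\<close>, then the
  kernel is constant in it between consecutive \<open>x r\<close>; if the first argument is such a point, then the
  integral over such a cell is zero or one. Hence integrating a point of level \<open>m + 1\<close> over its cell
  deletes its row and its column from a determinant. The determinant over a full level \<open>m + 1\<close> is the
  transition density. The Schur complement with respect to a full level \<open>m + 1\<close> at \<open>y\<close> is the kernel of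
  the process that starts in \<open>y\<close>. By the Markov property and induction over the starting level, the
  correlation functions are determinants, without any formula for the joint density. The contour
  integral reduces to this real kernel by a residue in \<open>w\<close> and integrations by parts in \<open>z\<close>.
\<close>

subsection \<open>Determinants over finite index sets\<close>

text \<open>No interlacing integral is evaluated. The transition density has mass one almost surely
  because the conditional probabilities of the given process do, and the determinant of a full level
  has integral one because integrating out every point leaves the empty determinant; comparing the
  two fixes the constant. The integrals to be exchanged are those of nonnegative functions, so
  determinants of a non-symmetric kernel have to be shown nonnegative. Marginals of a nonnegative
  block are nonnegative: this settles the sign of the unknown constant and then, by induction from
  the highest level down, the sign of all determinants. Cells are half-open on the side that matches
  the jump \<open>of_bool (v < w)\<close> of the kernel. They partition the line, constancy on a
  cell has no exceptional points, and the closed interlacing condition differs from membership in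
  the cells only on a null set. Rows and columns belong to points of several levels that are removed
  one at a time, hence determinants over arbitrary finite index sets.\<close>

definition det_on :: "'i set \<Rightarrow> ('i \<Rightarrow> 'i \<Rightarrow> 'a::comm_ring_1) \<Rightarrow> 'a" where
  "det_on I K = (\<Sum>\<pi> | \<pi> permutes I. of_int (sign \<pi>) * (\<Prod>i\<in>I. K i (\<pi> i)))"

lemma det_on_cong:
  assumes "I = I'" "\<And>i j. i \<in> I' \<Longrightarrow> j \<in> I' \<Longrightarrow> K i j = K' i j"
  shows "det_on I K = det_on I' K'"
  unfolding det_on_def assms(1)
  by (intro sum.cong refl arg_cong2[where f="(*)"] prod.cong assms(2)) (auto simp: permutes_in_image)

lemma det_on_empty [simp]: "det_on {} K = 1"
  by (simp add: det_on_def permutes_empty)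

lemma det_on_singleton [simp]: "det_on {i} K = K i i"
  by (simp add: det_on_def permutes_sing)

lemma det_on_reindex:
  assumes "finite I" "inj_on f I"
  shows "det_on (f ` I) K = det_on I (\<lambda>i j. K (f i) (f j))"
proof -
  define g where "g = inv_into I f"
  have bij: "bij_betw f I (f ` I)" using assms by (simp add: bij_betw_def)
  have g: "inj_on g (f ` I)" "g ` f ` I = I"
    using assms(2) by (auto simp: g_def inj_on_inv_into image_def)
  have gf: "g (f i) = i" if "i \<in> I" for i using that assms(2) by (simp add: g_def)
  show ?thesis unfolding det_on_def
  proof (rule sum.reindex_bij_witness[where i = "map_permutation I f" and j = "map_permutation (f ` I) g"], goal_cases)
    case (1 p)
    then show ?case
      by (intro map_permutation_compose_inv[of g "f ` I" I p f]) (use g gf in \<open>auto simp: bij_betw_def\<close>)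
  next
    case (2 p)
    then show ?case using map_permutation_permutes[of g "f ` I" I p] g by (auto simp: bij_betw_def)
  next
    case (3 p)
    then show ?case
      by (intro map_permutation_compose_inv[of f I "f ` I" p g]) (use bij gf in auto)
  next
    case (4 p)
    then show ?case using map_permutation_permutes[of f I "f ` I" p] bij by auto
  next
    case (5 p)
    then have p: "p permutes f ` I" by simp
    let ?q = "map_permutation (f ` I) g p"
    have s: "sign ?q = sign p" using sign_map_permutation[of g "f ` I" p] g p assms by auto
    have "f (?q i) = p (f i)" if "i \<in> I" for i
    proof -
      have "?q (g (f i)) = g (p (f i))" using map_permutation_apply[of g "f ` I" "f i" p] g(1) that by auto
      moreover have "p (f i) \<in> f ` I" using p that by (simp add: permutes_in_image)
      ultimately show ?thesis using gf that by auto
    qed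
    then show ?case using s assms by (simp add: prod.reindex)
  qed
qed

lemma det_on_eq_det:
  "det_on {..<n} K = Determinant.det (Matrix.mat n n (\<lambda>(i, j). K i j))"
proof -
  have "Determinant.det (Matrix.mat n n (\<lambda>(i, j). K i j)) =
    (\<Sum>p | p permutes {0..<n}. of_int (sign p) * (\<Prod>i=0..<n. Matrix.mat n n (\<lambda>(i, j). K i j) $$ (i, p i)))"
    by (subst det_def'[of _ n]) auto
  also have "\<dots> = det_on {..<n} K" unfolding det_on_def lessThan_atLeast0
    by (intro sum.cong refl arg_cong2[where f="(*)"] prod.cong) (auto simp: permutes_in_image)
  finally show ?thesis ..
qed

text \<open>Matrix theorems enter through an enumeration of the index set. Any enumeration will do,
  because conjugating permutations by it preserves their signs.\<close>

lemma det_on_enum: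
  assumes "bij_betw e {..<n} I"
  shows "det_on I K = Determinant.det (Matrix.mat n n (\<lambda>(i, j). K (e i) (e j)))"
  using det_on_reindex[of "{..<n}" e K] assms by (simp add: bij_betw_def det_on_eq_det)

lemma det_on_transpose:
  assumes "finite I"
  shows "det_on I (\<lambda>i j. K j i) = det_on I K"
proof -
  obtain e where e: "bij_betw e {..<card I} I"
    using ex_bij_betw_nat_finite[OF assms] by (auto simp: lessThan_atLeast0)
  have t: "Matrix.mat (card I) (card I) (\<lambda>(i, j). K (e j) (e i)) =
     transpose_mat (Matrix.mat (card I) (card I) (\<lambda>(i, j). K (e i) (e j)))"
    by (rule eq_matI) auto
  show ?thesis unfolding det_on_enum[OF e] t by (rule det_transpose[of _ "card I"]) simp
qed

lemma det_on_identical_columns: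
  assumes "finite I" "a \<in> I" "b \<in> I" "a \<noteq> b" "\<And>i. i \<in> I \<Longrightarrow> K i a = K i b"
  shows "det_on I K = 0"
proof -
  obtain e where e: "bij_betw e {..<card I} I"
    using ex_bij_betw_nat_finite[OF assms(1)] by (auto simp: lessThan_atLeast0)
  obtain i j where ij: "i < card I" "j < card I" "e i = a" "e j = b"
    using e assms(2,3) unfolding bij_betw_def by (metis imageE lessThan_iff)
  have eI: "e k \<in> I" if "k < card I" for k using e that by (auto simp: bij_betw_def)
  show ?thesis unfolding det_on_enum[OF e]
    by (rule det_identical_columns[of _ "card I" i j])
       (use ij assms(4,5) eI in \<open>auto intro!: eq_vecI\<close>)
qed

lemma det_on_mult:
  assumes "finite I"
  shows "det_on I (\<lambda>i j. \<Sum>k\<in>I. A i k * B k j) = det_on I A * det_on I B"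
proof -
  obtain e where e: "bij_betw e {..<card I} I"
    using ex_bij_betw_nat_finite[OF assms(1)] by (auto simp: lessThan_atLeast0)
  let ?M = "\<lambda>K. Matrix.mat (card I) (card I) (\<lambda>(i, j). K (e i) (e j))"
  have "?M (\<lambda>i j. \<Sum>k\<in>I. A i k * B k j) = ?M A * ?M B"
    by (rule eq_matI) (auto simp: scalar_prod_def sum.reindex_bij_betw[OF e, symmetric] lessThan_atLeast0)
  then show ?thesis unfolding det_on_enum[OF e] by (simp add: det_mult[of _ "card I"])
qed

lemma det_on_scale_rows:
  "det_on I (\<lambda>i j. c i * K i j) = (\<Prod>i\<in>I. c i) * det_on I K"
  unfolding det_on_def by (simp add: prod.distrib sum_distrib_left mult_ac)

lemma det_on_insert:
  assumes "finite I" "i0 \<notin> I"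
  shows "det_on (insert i0 I) K =
    (\<Sum>\<pi> | \<pi> permutes insert i0 I. of_int (sign \<pi>) * (K i0 (\<pi> i0) * (\<Prod>i\<in>I. K i (\<pi> i))))"
  unfolding det_on_def using assms by simp

text \<open>Permutations that fix \<open>i0\<close> are those of the smaller set, with the same
  sign. This evaluates a determinant whose row \<open>i0\<close> has been integrated to a unit
  vector.\<close>

lemma sum_fixed_permutes:
  assumes "finite I" "i0 \<notin> I"
  shows "(\<Sum>\<pi> | \<pi> permutes insert i0 I. of_int (sign \<pi>) * (of_bool (\<pi> i0 = i0) * (\<Prod>i\<in>I. K i (\<pi> i))))
    = det_on I K"
proof -
  have eq: "{\<pi>. \<pi> permutes insert i0 I} \<inter> {\<pi>. \<pi> i0 = i0} = {\<pi>. \<pi> permutes I}"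
  proof (rule Set.set_eqI, rule iffI)
    fix p assume "p \<in> {\<pi>. \<pi> permutes insert i0 I} \<inter> {\<pi>. \<pi> i0 = i0}"
    then show "p \<in> {\<pi>. \<pi> permutes I}"
      using permutes_superset[of p "insert i0 I" I] by auto
  next
    fix p assume "p \<in> {\<pi>. \<pi> permutes I}"
    then show "p \<in> {\<pi>. \<pi> permutes insert i0 I} \<inter> {\<pi>. \<pi> i0 = i0}"
      using assms by (auto simp: permutes_not_in intro: permutes_subset)
  qed
  have "(\<Sum>\<pi> | \<pi> permutes insert i0 I. of_int (sign \<pi>) * (of_bool (\<pi> i0 = i0) * (\<Prod>i\<in>I. K i (\<pi> i))))
    = (\<Sum>\<pi> | \<pi> permutes insert i0 I. if \<pi> i0 = i0 then of_int (sign \<pi>) * (\<Prod>i\<in>I. K i (\<pi> i)) else 0)"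
    by (intro sum.cong) auto
  also have "\<dots> = (\<Sum>\<pi> \<in> {\<pi>. \<pi> permutes insert i0 I} \<inter> {\<pi>. \<pi> i0 = i0}. of_int (sign \<pi>) * (\<Prod>i\<in>I. K i (\<pi> i)))"
    using assms by (subst sum.inter_restrict) (simp_all add: finite_permutations)
  finally show ?thesis unfolding eq det_on_def .
qed

text \<open>Schur complement: subtracting the combinations \<open>a\<close> of the \<open>A\<close>-rows from the \<open>B\<close>-rows makes
  the matrix block triangular.\<close>
lemma det_on_Schur:
  fixes K :: "'i \<Rightarrow> 'i \<Rightarrow> 'a::idom"
  assumes fin: "finite A" "finite B" and dis: "A \<inter> B = {}"
    and row: "\<And>i j. i \<in> B \<Longrightarrow> j \<in> A \<Longrightarrow> K i j = (\<Sum>k\<in>A. a i k * K k j)"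
  shows "det_on (A \<union> B) K = det_on A K * det_on B (\<lambda>i j. K i j - (\<Sum>k\<in>A. a i k * K k j))"
proof -
  define n1 n2 where "n1 = card A" and "n2 = card B"
  obtain e1 where e1: "bij_betw e1 {..<n1} A"
    using ex_bij_betw_nat_finite[OF fin(1)] by (auto simp: lessThan_atLeast0 n1_def)
  obtain e2 where e2: "bij_betw e2 {..<n2} B"
    using ex_bij_betw_nat_finite[OF fin(2)] by (auto simp: lessThan_atLeast0 n2_def)
  define e where "e = (\<lambda>k. if k < n1 then e1 k else e2 (k - n1))"
  have 1: "bij_betw e {..<n1} A"
    using e1 by (rule bij_betw_cong[THEN iffD1, rotated]) (auto simp: e_def)
  have "bij_betw (\<lambda>k. e2 (k - n1)) {n1..<n1+n2} B"
    by (rule bij_betw_trans[of "\<lambda>k. k - n1" _ "{..<n2}" e2, unfolded o_def])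
       (auto intro!: bij_betw_byWitness[where f'="\<lambda>k. k + n1"] e2)
  then have 2: "bij_betw e {n1..<n1+n2} B"
    by (rule bij_betw_cong[THEN iffD1, rotated]) (auto simp: e_def)
  have "{..<n1} \<union> {n1..<n1+n2} = {..<n1+n2}" by auto
  with bij_betw_combine[OF 1 2 dis] have 3: "bij_betw e {..<n1+n2} (A \<union> B)" by simp
  have eA: "e1 i \<in> A" if "i < n1" for i using e1 that by (auto simp: bij_betw_def)
  have eB: "e2 i \<in> B" if "i < n2" for i using e2 that by (auto simp: bij_betw_def)
  define MA where "MA = Matrix.mat n1 n1 (\<lambda>(i, j). K (e1 i) (e1 j))"
  define MB where "MB = Matrix.mat n1 n2 (\<lambda>(i, j). K (e1 i) (e2 j))"
  define MS where "MS = Matrix.mat n2 n2 (\<lambda>(i, j). K (e2 i) (e2 j) - (\<Sum>k\<in>A. a (e2 i) k * K k (e2 j)))"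
  define Ma where "Ma = Matrix.mat n2 n1 (\<lambda>(i, j). a (e2 i) (e1 j))"
  define L where "L = four_block_mat (1\<^sub>m n1) (0\<^sub>m n1 n2) Ma (1\<^sub>m n2)"
  define U where "U = four_block_mat MA MB (0\<^sub>m n2 n1) MS"
  \<comment> \<open>Block elimination: \<open>row\<close> says that \<open>Ma * MA\<close> is the
    lower left block, so \<open>L\<close>, with ones on its diagonal, carries the block triangular
    \<open>U\<close> back to the given matrix.\<close>
  have M: "Matrix.mat (n1+n2) (n1+n2) (\<lambda>(i, j). K (e i) (e j)) = L * U"
  proof -
    have "L * U = four_block_mat MA MB (Ma * MA) (Ma * MB + MS)"
      unfolding L_def U_def
      by (subst mult_four_block_mat[of _ n1 n1 _ n2 _ n2 _ _ n1 _ n2]) 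
         (auto simp: MA_def MB_def MS_def Ma_def left_add_zero_mat[of _ n1 n1] left_add_zero_mat[of _ n1 n2]
            right_add_zero_mat[of _ n1 n1] right_add_zero_mat[of _ n1 n2] right_add_zero_mat[of _ n2 n1])
    also have "\<dots> = Matrix.mat (n1+n2) (n1+n2) (\<lambda>(i, j). K (e i) (e j))"
      by (rule eq_matI)
         (auto simp: MA_def MB_def MS_def Ma_def e_def scalar_prod_def eA eB row
            sum.reindex_bij_betw[OF e1, symmetric] lessThan_atLeast0)
    finally show ?thesis ..
  qed
  have dL: "Determinant.det L = 1" unfolding L_def
    by (subst det_four_block_mat_upper_right_zero[of _ n1 _ n2]) (auto simp: Ma_def)
  have dU: "Determinant.det U = Determinant.det MA * Determinant.det MS" unfolding U_def
    by (subst det_four_block_mat_lower_left_zero[of _ n1 _ n2]) (auto simp: MA_def MB_def MS_def)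
  have cL: "L \<in> carrier_mat (n1+n2) (n1+n2)" and cU: "U \<in> carrier_mat (n1+n2) (n1+n2)"
    by (auto simp: L_def U_def Ma_def MA_def MB_def MS_def)
  show ?thesis
    unfolding det_on_enum[OF 3] M det_mult[OF cL cU] dL dU
    unfolding det_on_enum[OF e1] det_on_enum[OF e2] MA_def MS_def by simp
qed

text \<open>The monic polynomial \<open>Q\<close> with roots \<open>y 1, ..., y n\<close> writes the
  row of \<open>n\<close>-th powers as a combination of the lower rows at these points. The Schur
  complement is then the single number \<open>poly Q (y (Suc n))\<close>.\<close>

lemma det_on_powers:
  "det_on {1..n} (\<lambda>d i. y i ^ (d - 1)) = (\<Prod>j\<in>{1..n}. \<Prod>k\<in>{1..<j}. y j - (y k :: 'a::idom))"
proof (induction n)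
  case (Suc n)
  define Q where "Q = (\<Prod>j\<in>{1..n}. [:- y j, 1:])"
  have dQ: "degree Q = n" "coeff Q n = 1"
  proof -
    show d: "degree Q = n" unfolding Q_def by (subst degree_prod_eq_sum_degree) auto
    have "lead_coeff Q = 1" unfolding Q_def by (simp add: lead_coeff_prod)
    then show "coeff Q n = 1" using d by simp
  qed
  have ev: "poly Q z = z ^ n + (\<Sum>k\<in>{1..n}. coeff Q (k - 1) * z ^ (k - 1))" for z
  proof -
    have "poly Q z = (\<Sum>k<n. coeff Q k * z ^ k) + z ^ n"
      unfolding poly_altdef dQ(1) by (simp add: lessThan_Suc_atMost[symmetric] dQ)
    also have "(\<Sum>k<n. coeff Q k * z ^ k) = (\<Sum>k\<in>{1..n}. coeff Q (k - 1) * z ^ (k - 1))"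
      by (rule sum.reindex_bij_witness[where i="\<lambda>k. k - 1" and j=Suc]) auto
    finally show ?thesis by simp
  qed
  have 0: "poly Q (y j) = 0" if "j \<in> {1..n}" for j
    using that by (auto simp: Q_def poly_prod)
  have "det_on ({1..n} \<union> {Suc n}) (\<lambda>d i. y i ^ (d - 1)) =
    det_on {1..n} (\<lambda>d i. y i ^ (d - 1)) *
    det_on {Suc n} (\<lambda>d i. y i ^ (d - 1) - (\<Sum>k\<in>{1..n}. - coeff Q (k - 1) * y i ^ (k - 1)))"
  proof (rule det_on_Schur)
    fix d j assume "d \<in> {Suc n}" "j \<in> {1..n}"
    then show "y j ^ (d - 1) = (\<Sum>k\<in>{1..n}. - coeff Q (k - 1) * y j ^ (k - 1))"
      using 0[of j] ev[of "y j"] by (simp add: sum_negf eq_neg_iff_add_eq_0)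
  qed auto
  also have "{1..n} \<union> {Suc n} = {1..Suc n}" by auto
  also have "det_on {Suc n} (\<lambda>d i. y i ^ (d - 1) - (\<Sum>k\<in>{1..n}. - coeff Q (k - 1) * y i ^ (k - 1)))
    = (\<Prod>k\<in>{1..<Suc n}. y (Suc n) - y k)"
    using ev[of "y (Suc n)"] by (simp add: sum_negf Q_def poly_prod atLeastLessThanSuc_atLeastAtMost)
  finally show ?case using Suc by simp
qed simp

text \<open>The matrix is the product of the matrix of powers and the matrix of coefficients.
  \<open>C\<close> is the determinant of the latter, with one sign for each pair, as
  \<open>vandermonde\<close> subtracts in the opposite order.\<close>

lemma det_on_polys_vandermonde:
  assumes "\<And>j. j \<in> {1..n} \<Longrightarrow> degree (P j) < n"
  shows "\<exists>C::real. \<forall>y. det_on {1..n} (\<lambda>i j. poly (P j) (y i)) = C * vandermonde n y"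
proof (intro exI allI)
  fix y :: "nat \<Rightarrow> real"
  have ev: "poly (P j) z = (\<Sum>k\<in>{1..n}. z ^ (k - 1) * coeff (P j) (k - 1))" if "j \<in> {1..n}" for j z
  proof -
    have "poly (P j) z = (\<Sum>k<n. coeff (P j) k * z ^ k)"
      using assms[OF that] by (subst poly_altdef, intro sum.mono_neutral_left) (auto simp: coeff_eq_0)
    also have "\<dots> = (\<Sum>k\<in>{1..n}. z ^ (k - 1) * coeff (P j) (k - 1))"
      by (rule sum.reindex_bij_witness[where i="\<lambda>k. k - 1" and j=Suc]) auto
    finally show ?thesis .
  qed
  have "det_on {1..n} (\<lambda>i j. poly (P j) (y i)) =
    det_on {1..n} (\<lambda>i j. \<Sum>k\<in>{1..n}. y i ^ (k - 1) * coeff (P j) (k - 1))"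
    by (intro det_on_cong refl ev)
  also have "\<dots> = det_on {1..n} (\<lambda>i k. y i ^ (k - 1)) * det_on {1..n} (\<lambda>k j. coeff (P j) (k - 1))"
    by (rule det_on_mult) simp
  also have "det_on {1..n} (\<lambda>i k. y i ^ (k - 1)) = (\<Prod>j\<in>{1..n}. \<Prod>k\<in>{1..<j}. y j - y k)"
    using det_on_transpose[of "{1..n}" "\<lambda>d i. y i ^ (d - 1)"] det_on_powers[of n y] by simp
  also have "\<dots> = (\<Prod>j\<in>{1..n}. \<Prod>k\<in>{1..<j}. (-1) * (y k - y j))" by simp
  also have "\<dots> = (\<Prod>j\<in>{1..n}. \<Prod>k\<in>{1..<j}. -1) * vandermonde n y"
    unfolding vandermonde_def by (simp only: prod.distrib)
  finally show "det_on {1..n} (\<lambda>i j. poly (P j) (y i)) =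
     ((\<Prod>j\<in>{1..n}. \<Prod>k\<in>{1..<j}. -1) * det_on {1..n} (\<lambda>k j. coeff (P j) (k - 1))) * vandermonde n y"
    by simp
qed


subsection \<open>Integrals of derivatives and rapid decay\<close>

context
  fixes f f' :: "real \<Rightarrow> real" and S :: "real set"
  assumes S: "finite S" and cont: "continuous_on UNIV f"
    and deriv: "\<And>w. w \<notin> S \<Longrightarrow> (f has_real_derivative f' w) (at w)"
    and int: "integrable lborel f'"
begin

lemma set_int_deriv: "A \<in> sets borel \<Longrightarrow> set_integrable lborel A f'"
  unfolding set_integrable_def using int by (intro integrable_mult_indicator) auto

text \<open>The finite exceptional set \<open>S\<close> admits the corner of the primitives of the
  kernel at the point where its two positions coincide.\<close>

lemma integral_deriv_Icc:
  assumes "a \<le> b"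
  shows "(LINT w:{a..b}|lborel. f' w) = f b - f a"
proof -
  have "(f' has_integral (f b - f a)) {a..b}"
    by (rule fundamental_theorem_of_calculus_strong[OF S assms])
       (auto intro!: has_real_derivative_iff_has_vector_derivative[THEN iffD1] deriv continuous_on_subset[OF cont])
  then show ?thesis using set_borel_integral_eq_integral(2)[OF set_int_deriv[of "{a..b}"]]
    by (simp add: integral_unique)
qed

lemma integral_deriv_Ici:
  assumes "(f \<longlongrightarrow> B) at_top"
  shows "(LINT w:{a..}|lborel. f' w) = B - f a"
proof (rule tendsto_unique[OF _ tendsto_set_lebesgue_integral_at_top])
  have "((\<lambda>b. f b - f a) \<longlongrightarrow> B - f a) at_top" by (intro tendsto_intros assms)
  then show "((\<lambda>b. LINT w:{a..b}|lborel. f' w) \<longlongrightarrow> B - f a) at_top"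
    by (rule Lim_transform_eventually)
       (auto intro!: eventually_mono[OF eventually_ge_at_top[of a]] simp: integral_deriv_Icc)
qed (auto intro: set_int_deriv)

lemma integral_deriv_Iic:
  assumes "(f \<longlongrightarrow> A) at_bot"
  shows "(LINT w:{..b}|lborel. f' w) = f b - A"
proof (rule tendsto_unique[OF _ tendsto_set_lebesgue_integral_at_bot])
  have "((\<lambda>a. f b - f a) \<longlongrightarrow> f b - A) at_bot" by (intro tendsto_intros assms)
  then show "((\<lambda>a. LINT w:{a..b}|lborel. f' w) \<longlongrightarrow> f b - A) at_bot"
    by (rule Lim_transform_eventually)
       (auto intro!: eventually_mono[OF eventually_le_at_bot[of b]] simp: integral_deriv_Icc)
qed (auto intro: set_int_deriv)

lemma integral_deriv_Iio:
  assumes "(f \<longlongrightarrow> A) at_bot"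
  shows "(LINT w:{..<b}|lborel. f' w) = f b - A"
proof -
  have "(LINT w:{..<b}|lborel. f' w) = (LINT w:{..b}|lborel. f' w)"
    unfolding set_lebesgue_integral_def
    using int AE_lborel_singleton[of b]
    by (intro integral_cong_AE) (auto split: split_indicator elim!: eventually_mono)
  then show ?thesis using integral_deriv_Iic[OF assms] by simp
qed

lemma integral_deriv_Ico:
  assumes "a \<le> b"
  shows "(LINT w:{a..<b}|lborel. f' w) = f b - f a"
proof -
  have "(LINT w:{a..<b}|lborel. f' w) = (LINT w:{a..b}|lborel. f' w)"
    unfolding set_lebesgue_integral_def
    using int AE_lborel_singleton[of b]
    by (intro integral_cong_AE) (auto split: split_indicator elim!: eventually_mono)
  then show ?thesis using integral_deriv_Icc[OF assms] by simp
qed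

lemma integral_deriv_UNIV:
  assumes "(f \<longlongrightarrow> A) at_bot" "(f \<longlongrightarrow> B) at_top"
  shows "(LINT w:UNIV|lborel. f' w) = B - A"
proof -
  have U: "UNIV = {..<0} \<union> {0::real..}" and D: "{..<0} \<inter> {0::real..} = {}" by auto
  have "(LINT w:UNIV|lborel. f' w) = (LINT w:{..<0}|lborel. f' w) + (LINT w:{0..}|lborel. f' w)"
    unfolding U by (intro set_integral_Un D set_int_deriv) auto
  then show ?thesis using integral_deriv_Iio[OF assms(1)] integral_deriv_Ici[OF assms(2)] by simp
qed

end

text \<open>All powers are bounded at once, so that the class is closed under multiplication by
  \<open>w\<close>, as the recursion of \<open>gauss_prim\<close> demands. The powers 0 and 2
  already give integrability and the limits at both ends.\<close>

definition rapid_decay :: "(real \<Rightarrow> real) \<Rightarrow> bool" where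
  "rapid_decay f \<longleftrightarrow> (\<forall>n. \<exists>C. \<forall>w. \<bar>w\<bar> ^ n * \<bar>f w\<bar> \<le> C)"

lemma rapid_decay_add:
  assumes "rapid_decay f" "rapid_decay g"
  shows "rapid_decay (\<lambda>w. f w + g w)"
  unfolding rapid_decay_def
proof
  fix n
  obtain C D where "\<And>w. \<bar>w\<bar> ^ n * \<bar>f w\<bar> \<le> C" "\<And>w. \<bar>w\<bar> ^ n * \<bar>g w\<bar> \<le> D"
    using assms unfolding rapid_decay_def by meson
  moreover have "\<bar>w\<bar> ^ n * \<bar>f w + g w\<bar> \<le> \<bar>w\<bar> ^ n * \<bar>f w\<bar> + \<bar>w\<bar> ^ n * \<bar>g w\<bar>" for w
    by (metis abs_triangle_ineq distrib_left mult_left_mono zero_le_power abs_ge_zero)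
  ultimately show "\<exists>C. \<forall>w. \<bar>w\<bar> ^ n * \<bar>f w + g w\<bar> \<le> C"
    by (meson add_mono order_trans)
qed

lemma rapid_decay_cmult:
  assumes "rapid_decay f"
  shows "rapid_decay (\<lambda>w. c * f w)"
  unfolding rapid_decay_def
proof
  fix n
  obtain C where C: "\<And>w. \<bar>w\<bar> ^ n * \<bar>f w\<bar> \<le> C" using assms unfolding rapid_decay_def by meson
  have "\<bar>w\<bar> ^ n * \<bar>c * f w\<bar> \<le> \<bar>c\<bar> * C" for w
    using mult_left_mono[OF C[of w], of "\<bar>c\<bar>"] by (simp add: abs_mult mult_ac)
  then show "\<exists>C. \<forall>w. \<bar>w\<bar> ^ n * \<bar>c * f w\<bar> \<le> C" by blast
qed

lemma rapid_decay_ident_mult: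
  assumes "rapid_decay f"
  shows "rapid_decay (\<lambda>w. w * f w)"
  unfolding rapid_decay_def
proof
  fix n
  obtain C where C: "\<And>w. \<bar>w\<bar> ^ (Suc n) * \<bar>f w\<bar> \<le> C" using assms unfolding rapid_decay_def by meson
  then show "\<exists>C. \<forall>w. \<bar>w\<bar> ^ n * \<bar>w * f w\<bar> \<le> C"
    by (intro exI[of _ C]) (auto simp: abs_mult mult_ac)
qed

lemma rapid_decay_zero: "rapid_decay (\<lambda>w. 0)"
  unfolding rapid_decay_def by auto

lemma rapid_decay_diff: "rapid_decay f \<Longrightarrow> rapid_decay g \<Longrightarrow> rapid_decay (\<lambda>w. f w - g w)"
  using rapid_decay_add[of f "\<lambda>w. (-1) * g w"] rapid_decay_cmult[of g "-1"] by simp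

lemma rapid_decay_sum: "(\<And>i. i \<in> I \<Longrightarrow> rapid_decay (f i)) \<Longrightarrow> rapid_decay (\<lambda>w. \<Sum>i\<in>I. f i w)"
  by (induction I rule: infinite_finite_induct) (auto intro: rapid_decay_add rapid_decay_zero)

lemma rapid_decay_bound:
  assumes "rapid_decay f"
  obtains C where "\<And>w. \<bar>f w\<bar> \<le> C * inverse (1 + w\<^sup>2)"
proof -
  obtain C D where C: "\<And>w. \<bar>w\<bar> ^ 0 * \<bar>f w\<bar> \<le> C" and D: "\<And>w. \<bar>w\<bar> ^ 2 * \<bar>f w\<bar> \<le> D"
    using assms unfolding rapid_decay_def by meson
  have "\<bar>f w\<bar> \<le> (C + D) * inverse (1 + w\<^sup>2)" for w
  proof -
    have "\<bar>f w\<bar> * (1 + w\<^sup>2) \<le> C + D" using C[of w] D[of w] by (simp add: algebra_simps)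
    then show ?thesis
      by (simp add: field_simps pos_le_divide_eq add_pos_nonneg)
  qed
  then show ?thesis by (rule that)
qed

lemma rapid_decay_integrable:
  assumes "rapid_decay f" "f \<in> borel_measurable borel"
  shows "integrable lborel f"
proof -
  obtain C where C: "\<And>w. \<bar>f w\<bar> \<le> C * inverse (1 + w\<^sup>2)"
    using rapid_decay_bound[OF assms(1)] by blast
  have "integrable lborel (\<lambda>w::real. inverse (1 + w\<^sup>2))"
    using integrable_inverse_1_plus_square
    by (simp add: interval_lebesgue_integrable_def set_integrable_def einterval_def)
  then have "integrable lborel (\<lambda>w::real. C * inverse (1 + w\<^sup>2))" by simp
  then show ?thesis
  proof (rule Bochner_Integration.integrable_bound)
    show "AE w in lborel. norm (f w) \<le> norm (C * inverse (1 + w\<^sup>2))"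
      using order_trans[OF C abs_ge_self] by auto
  qed (use assms(2) in simp)
qed

lemma rapid_decay_tendsto:
  assumes "rapid_decay f"
  shows "(f \<longlongrightarrow> 0) at_top" "(f \<longlongrightarrow> 0) at_bot"
proof -
  obtain C where C: "\<And>w. \<bar>f w\<bar> \<le> C * inverse (1 + w\<^sup>2)"
    using rapid_decay_bound[OF assms(1)] by blast
  have 1: "((\<lambda>w::real. C * inverse (1 + w\<^sup>2)) \<longlongrightarrow> 0) at_top"
    and 2: "((\<lambda>w::real. C * inverse (1 + w\<^sup>2)) \<longlongrightarrow> 0) at_bot" by real_asymp+
  show "(f \<longlongrightarrow> 0) at_top" by (rule Lim_null_comparison[OF _ 1]) (use C in auto)
  show "(f \<longlongrightarrow> 0) at_bot" by (rule Lim_null_comparison[OF _ 2]) (use C in auto)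
qed

subsection \<open>Gaussian times polynomial\<close>

definition gauss :: "real \<Rightarrow> real" where "gauss w = exp (- w\<^sup>2 / 2)"

text \<open>\<open>gauss_step\<close> is the action of \<open>d/dw\<close> on the polynomial factor of \<open>gauss w * poly P w\<close>.\<close>
definition gauss_step :: "real poly \<Rightarrow> real poly" where "gauss_step P = pderiv P - [:0, 1:] * P"

definition gauss_poly :: "nat \<Rightarrow> real poly \<Rightarrow> real \<Rightarrow> real" where
  "gauss_poly k P w = gauss w * poly ((gauss_step ^^ k) P) w"

lemma gauss_pos: "gauss w > 0" by (simp add: gauss_def)

lemma gauss_exp: "exp (w\<^sup>2 / 2) * gauss w = 1"
  by (simp add: gauss_def flip: exp_add)

lemma gauss_deriv [derivative_intros]:
  "(f has_field_derivative f') (at w within A) \<Longrightarrow>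
   ((\<lambda>w. gauss (f w)) has_field_derivative (- f w * gauss (f w) * f')) (at w within A)"
  unfolding gauss_def by (rule derivative_eq_intros refl | simp)+

lemma continuous_on_gauss [continuous_intros]: "continuous_on A gauss"
  unfolding gauss_def by (intro continuous_intros) auto

lemma gauss_measurable [measurable]: "gauss \<in> borel_measurable borel"
  unfolding gauss_def by measurable

lemma gauss_step_linear:
  "gauss_step (P + Q) = gauss_step P + gauss_step Q"
  "gauss_step (P - Q) = gauss_step P - gauss_step Q"
  "gauss_step (Polynomial.smult c P) = Polynomial.smult c (gauss_step P)"
  by (simp_all add: gauss_step_def pderiv_add pderiv_diff pderiv_smult algebra_simps smult_diff_right)

lemma gauss_step_funpow_linear:
  "(gauss_step ^^ k) (P + Q) = (gauss_step ^^ k) P + (gauss_step ^^ k) Q"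
  "(gauss_step ^^ k) (P - Q) = (gauss_step ^^ k) P - (gauss_step ^^ k) Q"
  "(gauss_step ^^ k) (Polynomial.smult c P) = Polynomial.smult c ((gauss_step ^^ k) P)"
  by (induction k) (simp_all add: gauss_step_linear)

lemma gauss_poly_add: "gauss_poly k (P + Q) w = gauss_poly k P w + gauss_poly k Q w"
  and gauss_poly_diff: "gauss_poly k (P - Q) w = gauss_poly k P w - gauss_poly k Q w"
  and gauss_poly_smult: "gauss_poly k (Polynomial.smult c P) w = c * gauss_poly k P w"
  by (simp_all add: gauss_poly_def gauss_step_funpow_linear algebra_simps)

lemma gauss_poly_sum: "gauss_poly k (\<Sum>i\<in>I. P i) w = (\<Sum>i\<in>I. gauss_poly k (P i) w)"
  by (induction I rule: infinite_finite_induct) (use gauss_poly_smult[of k 0 0 w] in \<open>simp_all add: gauss_poly_add\<close>)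

lemma gauss_poly_Suc: "gauss_poly (Suc k) P w = gauss_poly k (gauss_step P) w"
  by (simp add: gauss_poly_def funpow_Suc_right del: funpow.simps)

lemma gauss_poly_0: "gauss_poly 0 P w = gauss w * poly P w"
  by (simp add: gauss_poly_def)

lemma gauss_poly_deriv: "(gauss_poly k P has_real_derivative gauss_poly (Suc k) P w) (at w within A)"
  unfolding gauss_poly_def by (rule derivative_eq_intros refl | simp add: gauss_step_def algebra_simps)+

lemma continuous_on_gauss_poly [continuous_intros]: "continuous_on A (gauss_poly k P)"
  by (rule DERIV_continuous_on[of _ _ "gauss_poly (Suc k) P"]) (rule gauss_poly_deriv)

lemma degree_gauss_step: "degree (gauss_step P) \<le> Suc (degree P)"
  unfolding gauss_step_def
  by (intro degree_diff_le) (auto simp: degree_pderiv intro: order_trans[OF degree_mult_le])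

lemma power_le_fact_exp:
  fixes x :: real assumes "x \<ge> 0" shows "x ^ n \<le> fact n * exp x"
proof -
  have "(\<Sum>i\<in>{n}. x ^ i /\<^sub>R fact i) \<le> (\<Sum>i. x ^ i /\<^sub>R fact i)"
    using assms by (intro sum_le_suminf summable_exp_generic) auto
  then show ?thesis by (simp add: exp_def field_simps)
qed

text \<open>A power of \<open>w^2 / 2\<close> is at most a factorial times
  \<open>exp (w^2 / 2)\<close>, which \<open>gauss w\<close> cancels. Passing from \<open>w\<close>
  to \<open>w^2\<close> costs the summand 1 where \<open>\<bar>w\<bar> \<le> 1\<close>.\<close>

lemma rapid_decay_gauss: "rapid_decay gauss"
  unfolding rapid_decay_def
proof
  fix n
  have "\<bar>w\<bar> ^ n * \<bar>gauss w\<bar> \<le> 1 + 2 ^ n * fact n" for w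
  proof -
    have "\<bar>w\<bar> ^ n \<le> 1 + (w\<^sup>2) ^ n"
    proof (cases "\<bar>w\<bar> \<le> 1")
      case True
      then show ?thesis using power_le_one[of "\<bar>w\<bar>" n] by (simp add: add_increasing2)
    next
      case False
      then have "\<bar>w\<bar> ^ n \<le> \<bar>w\<bar> ^ (2 * n)" by (intro power_increasing) auto
      then show ?thesis by (simp add: power_mult)
    qed
    then have "\<bar>w\<bar> ^ n * gauss w \<le> (1 + 2 ^ n * (w\<^sup>2 / 2) ^ n) * gauss w"
      using gauss_pos[of w] by (intro mult_right_mono) (auto simp: power_divide)
    also have "\<dots> \<le> (1 + 2 ^ n * (fact n * exp (w\<^sup>2 / 2))) * gauss w"
      using gauss_pos[of w] by (intro mult_right_mono add_mono mult_left_mono power_le_fact_exp) auto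
    also have "\<dots> = gauss w + 2 ^ n * fact n"
      using gauss_exp[of w] by (simp add: algebra_simps)
    also have "\<dots> \<le> 1 + 2 ^ n * fact n" by (simp add: gauss_def)
    finally show ?thesis using gauss_pos[of w] by simp
  qed
  then show "\<exists>C. \<forall>w. \<bar>w\<bar> ^ n * \<bar>gauss w\<bar> \<le> C" by blast
qed

lemma rapid_decay_gauss_poly: "rapid_decay (gauss_poly k P)"
proof -
  have "rapid_decay (\<lambda>w. gauss w * poly Q w)" for Q
  proof (induction Q)
    case (pCons a Q)
    have "rapid_decay (\<lambda>w. a * gauss w + w * (gauss w * poly Q w))"
      by (intro rapid_decay_add rapid_decay_cmult rapid_decay_ident_mult rapid_decay_gauss pCons)
    then show ?case by (simp add: algebra_simps)
  qed (simp add: rapid_decay_zero)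
  then show ?thesis by (simp add: gauss_poly_def[abs_def])
qed

subsection \<open>The primitives of the Gaussian\<close>

definition normal_cdf :: "real \<Rightarrow> real" where
  "normal_cdf w = (LINT s:{..w}|lborel. std_normal_density s)"

lemma std_normal_density_gauss: "std_normal_density w = gauss w / sqrt (2 * pi)"
  by (simp add: std_normal_density_def gauss_def)

lemma set_integrable_std_normal: "A \<in> sets borel \<Longrightarrow> set_integrable lborel A std_normal_density"
  unfolding set_integrable_def by (intro integrable_mult_indicator) auto

lemma normal_cdf_deriv: "(normal_cdf has_real_derivative gauss w / sqrt (2 * pi)) (at w)"
proof -
  define a b where "a = w - 1" and "b = w + 1"
  have ab: "a < w" "w < b" by (auto simp: a_def b_def)
  have cont: "continuous_on {a..b} std_normal_density"
    unfolding std_normal_density_def by (intro continuous_intros) auto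
  have "((\<lambda>u. integral {a..u} std_normal_density) has_vector_derivative std_normal_density w) (at w within {a..b})"
    by (rule integral_has_vector_derivative[OF cont]) (use ab in auto)
  then have "((\<lambda>u. integral {a..u} std_normal_density) has_real_derivative std_normal_density w) (at w)"
    using ab at_within_Icc_at[of a w b] by (simp add: has_real_derivative_iff_has_vector_derivative)
  then have "((\<lambda>u. normal_cdf a + integral {a..u} std_normal_density) has_real_derivative std_normal_density w) (at w)"
    by (auto intro!: derivative_eq_intros)
  then have "(normal_cdf has_real_derivative std_normal_density w) (at w)"
  proof (rule has_field_derivative_transform_within_open[of _ _ _ "{a<..<b}"])
    fix u assume u: "u \<in> {a<..<b}"
    have "normal_cdf u = (LINT s:{..a} \<union> {a<..u}|lborel. std_normal_density s)"
      using u by (simp add: normal_cdf_def ivl_disj_un)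
    also have "\<dots> = normal_cdf a + (LINT s:{a<..u}|lborel. std_normal_density s)"
      unfolding normal_cdf_def
      by (intro set_integral_Un set_integrable_std_normal) auto
    also have "(LINT s:{a<..u}|lborel. std_normal_density s) = (LINT s:{a..u}|lborel. std_normal_density s)"
      unfolding set_lebesgue_integral_def
      using AE_lborel_singleton[of a]
      by (intro integral_cong_AE) (auto split: split_indicator elim!: eventually_mono)
    also have "\<dots> = integral {a..u} std_normal_density"
      by (intro set_borel_integral_eq_integral set_integrable_std_normal) auto
    finally show "normal_cdf a + integral {a..u} std_normal_density = normal_cdf u" by simp
  qed (use ab in auto)
  then show ?thesis by (simp add: std_normal_density_gauss)
qed

lemma continuous_on_normal_cdf [continuous_intros]: "continuous_on A normal_cdf"
  by (rule DERIV_continuous_on[OF has_field_derivative_at_within[OF normal_cdf_deriv]])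

lemma normal_cdf_measurable [measurable]: "normal_cdf \<in> borel_measurable borel"
  by (rule borel_measurable_continuous_onI) (rule continuous_on_normal_cdf)

lemma normal_cdf_compl: "1 - normal_cdf w = (LINT s:{w<..}|lborel. std_normal_density s)"
proof -
  have "{..w} \<union> {w<..} = UNIV" by auto
  then have "1 = (LINT s:{..w} \<union> {w<..}|lborel. std_normal_density s)"
    using integral_normal_density[of 1 0] by (simp add: set_lebesgue_integral_def)
  also have "\<dots> = normal_cdf w + (LINT s:{w<..}|lborel. std_normal_density s)"
    unfolding normal_cdf_def
    by (intro set_integral_Un set_integrable_std_normal) auto
  finally show ?thesis by simp
qed

lemma normal_cdf_bounds: "0 \<le> normal_cdf w" "normal_cdf w \<le> 1"
proof -
  show "0 \<le> normal_cdf w" unfolding normal_cdf_def set_lebesgue_integral_def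
    by (intro Bochner_Integration.integral_nonneg) auto
  have "0 \<le> 1 - normal_cdf w" unfolding normal_cdf_compl set_lebesgue_integral_def
    by (intro Bochner_Integration.integral_nonneg) auto
  then show "normal_cdf w \<le> 1" by simp
qed

text \<open>Markov's inequality for the absolute moment of order \<open>n\<close>.\<close>

lemma tail_moment:
  assumes "A \<in> sets borel" "\<And>s. s \<in> A \<Longrightarrow> \<bar>w\<bar> \<le> \<bar>s\<bar>"
  shows "\<bar>w\<bar> ^ n * (LINT s:A|lborel. std_normal_density s) \<le> (\<integral>s. std_normal_density s * \<bar>s\<bar> ^ n \<partial>lborel)"
proof -
  have "\<bar>w\<bar> ^ n * (LINT s:A|lborel. std_normal_density s) = (\<integral>s. \<bar>w\<bar> ^ n * (indicator A s *\<^sub>R std_normal_density s) \<partial>lborel)"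
    by (simp add: set_lebesgue_integral_def)
  also have "\<dots> \<le> (\<integral>s. std_normal_density s * \<bar>s\<bar> ^ n \<partial>lborel)"
    using set_integrable_std_normal[OF assms(1)] assms(2)
    by (intro integral_mono integrable_std_normal_moment_abs integrable_mult_right)
       (auto simp: set_integrable_def indicator_def mult.commute intro!: mult_left_mono power_mono)
  finally show ?thesis .
qed

lemma rapid_decay_cdf_jump: "rapid_decay (\<lambda>w. normal_cdf w - of_bool (v < w))"
  unfolding rapid_decay_def
proof
  fix n
  let ?M = "\<integral>s. std_normal_density s * \<bar>s\<bar> ^ n \<partial>lborel"
  have M0: "0 \<le> ?M" by (intro Bochner_Integration.integral_nonneg) auto
  have "\<bar>w\<bar> ^ n * \<bar>normal_cdf w - of_bool (v < w)\<bar> \<le> ?M + \<bar>v\<bar> ^ n" for w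
  proof (cases "v < w")
    case True
    have e: "\<bar>normal_cdf w - of_bool (v < w)\<bar> = 1 - normal_cdf w" using True normal_cdf_bounds[of w] by simp
    show ?thesis unfolding e
    proof (cases "0 \<le> w")
      case w: True
      have "\<bar>w\<bar> ^ n * (1 - normal_cdf w) \<le> ?M" unfolding normal_cdf_compl
        by (rule tail_moment) (use w in auto)
      then show "\<bar>w\<bar> ^ n * (1 - normal_cdf w) \<le> ?M + \<bar>v\<bar> ^ n" by (simp add: add_increasing2)
    next
      case False
      have "\<bar>w\<bar> ^ n * (1 - normal_cdf w) \<le> \<bar>v\<bar> ^ n * 1"
        using True False normal_cdf_bounds[of w] by (intro mult_mono power_mono) auto
      then show "\<bar>w\<bar> ^ n * (1 - normal_cdf w) \<le> ?M + \<bar>v\<bar> ^ n" using M0 by linarith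
    qed
  next
    case F: False
    have e: "\<bar>normal_cdf w - of_bool (v < w)\<bar> = normal_cdf w" using F normal_cdf_bounds[of w] by simp
    show ?thesis unfolding e
    proof (cases "w \<le> 0")
      case w: True
      have "\<bar>w\<bar> ^ n * (normal_cdf w) \<le> ?M" unfolding normal_cdf_def
        by (rule tail_moment) (use w in auto)
      then show "\<bar>w\<bar> ^ n * normal_cdf w \<le> ?M + \<bar>v\<bar> ^ n" by (simp add: add_increasing2)
    next
      case False
      have "\<bar>w\<bar> ^ n * (normal_cdf w) \<le> \<bar>v\<bar> ^ n * 1"
        using F False normal_cdf_bounds[of w] by (intro mult_mono power_mono) auto
      then show "\<bar>w\<bar> ^ n * normal_cdf w \<le> ?M + \<bar>v\<bar> ^ n" using M0 by linarith
    qed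
  qed
  then show "\<exists>C. \<forall>w. \<bar>w\<bar> ^ n * \<bar>normal_cdf w - of_bool (v < w)\<bar> \<le> C" by blast
qed

text \<open>Equals \<open>(- 1) ^ l / (l! * sqrt (2 * pi))\<close> times the Hermite polynomial
  \<open>He l\<close> at \<open>v\<close>. It arises as the moment
  \<open>\<integral> (z - v)^l / l! * exp (z^2 / 2) dz\<close> over a vertical line, divided by
  \<open>2 \<pi> i\<close>; the recursion is integration by parts.\<close>

fun hermite_coeff :: "nat \<Rightarrow> real \<Rightarrow> real" where
  "hermite_coeff 0 v = 1 / sqrt (2 * pi)"
| "hermite_coeff (Suc 0) v = - v * hermite_coeff 0 v"
| "hermite_coeff (Suc (Suc l)) v = - (v * hermite_coeff (Suc l) v + hermite_coeff l v) / real (Suc (Suc l))"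

text \<open>\<open>2 \<pi> i * gauss_prim l w v\<close> is \<open>\<integral> (z - v)^l / l! * exp ((z\<^sup>2 - w\<^sup>2) / 2) / (z - w) dz\<close> over a
  vertical line to the right of \<open>v\<close> that passes \<open>w\<close> on the left if \<open>v < w\<close> and on the right otherwise.\<close>
fun gauss_prim :: "nat \<Rightarrow> real \<Rightarrow> real \<Rightarrow> real" where
  "gauss_prim 0 w v = normal_cdf w - of_bool (v < w)"
| "gauss_prim (Suc l) w v = ((w - v) * gauss_prim l w v + gauss w * hermite_coeff l v) / real (Suc l)"

text \<open>The \<open>k\<close>-th derivative in \<open>w\<close>, continued to \<open>w = v\<close> from the left.\<close>
fun gauss_prim_deriv :: "nat \<Rightarrow> nat \<Rightarrow> real \<Rightarrow> real \<Rightarrow> real" where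
  "gauss_prim_deriv 0 l w v = gauss_prim l w v"
| "gauss_prim_deriv (Suc k) 0 w v = hermite_coeff 0 v * gauss_poly k 1 w"
| "gauss_prim_deriv (Suc k) (Suc l) w v = gauss_prim_deriv k l w v + hermite_coeff (Suc l) v * gauss_poly k 1 w"

lemma hermite_coeff_Suc_Suc':
  "real (Suc (Suc l)) * hermite_coeff (Suc (Suc l)) v = - (v * hermite_coeff (Suc l) v + hermite_coeff l v)"
  by simp

text \<open>The product rule is applied to the recursion of \<open>gauss_prim\<close>. One use of
  that recursion and one of the recursion of \<open>hermite_coeff\<close> collapse the terms to
  \<open>gauss_prim\<close> of index one lower plus a multiple of the Gaussian.\<close>

lemma gauss_prim_has_deriv:
  assumes "w \<noteq> v"
  shows "((\<lambda>w. gauss_prim l w v) has_real_derivative gauss_prim_deriv 1 l w v) (at w)"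
proof (induction l)
  case 0
  have "((\<lambda>w. of_bool (v < w)) has_real_derivative 0) (at w)"
  proof (rule has_field_derivative_transform_within_open[of "\<lambda>_. of_bool (v < w)" _ _ "if v < w then {v<..} else {..<v}"])
  qed (use assms in \<open>auto split: if_splits\<close>)
  from DERIV_diff[OF normal_cdf_deriv this] show ?case
    by (simp add: gauss_poly_0)
next
  case (Suc l)
  have e: "(gauss_prim_deriv 1 (Suc l) w v) * real (Suc l)
    = 1 * gauss_prim l w v + (w - v) * gauss_prim_deriv 1 l w v + (- w * gauss w * 1) * hermite_coeff l v"
  proof (cases l)
    case (Suc k)
    have r: "(w - v) * gauss_prim k w v = real (Suc k) * gauss_prim (Suc k) w v - gauss w * hermite_coeff k v"
      by (simp add: field_simps)
    have h: "real (Suc (Suc k)) * hermite_coeff (Suc (Suc k)) v * gauss w = - (v * hermite_coeff (Suc k) v + hermite_coeff k v) * gauss w"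
      by (simp only: hermite_coeff_Suc_Suc')
    show ?thesis unfolding Suc using r h
      by (simp add: gauss_poly_0 algebra_simps del: gauss_prim.simps hermite_coeff.simps)
  qed (simp add: gauss_poly_0 algebra_simps flip: add_divide_distrib diff_divide_distrib)
  have "((\<lambda>w. ((w - v) * gauss_prim l w v + gauss w * hermite_coeff l v) / real (Suc l)) has_real_derivative
    (1 * gauss_prim l w v + (w - v) * gauss_prim_deriv 1 l w v + (- w * gauss w * 1) * hermite_coeff l v) / real (Suc l)) (at w)"
    by (rule derivative_eq_intros Suc.IH refl | simp)+
  then show ?case unfolding e[symmetric] by simp
qed

text \<open>Isolates the only possible discontinuity: a truncated power, which is a jump for
  \<open>l = 0\<close> and continuous for \<open>l > 0\<close>.\<close>

lemma gauss_prim_closed: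
  "\<exists>S. continuous_on UNIV S \<and> (\<forall>w. gauss_prim l w v = S w - of_bool (v < w) * (w - v) ^ l / fact l)"
proof (induction l)
  case 0
  show ?case by (intro exI[of _ normal_cdf]) (auto intro: continuous_intros)
next
  case (Suc l)
  then obtain S where S: "continuous_on UNIV S" "\<And>w. gauss_prim l w v = S w - of_bool (v < w) * (w - v) ^ l / fact l"
    by blast
  show ?case
    by (rule exI[of _ "\<lambda>w. ((w - v) * S w + gauss w * hermite_coeff l v) / real (Suc l)"])
       (auto intro!: continuous_intros S(1) simp: S(2) field_simps simp del: of_nat_Suc)
qed

lemma continuous_on_gauss_prim: "continuous_on UNIV (\<lambda>w. gauss_prim (Suc l) w v)"
proof -
  obtain S where S: "continuous_on UNIV S" "\<And>w. gauss_prim (Suc l) w v = S w - of_bool (v < w) * (w - v) ^ Suc l / fact (Suc l)"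
    using gauss_prim_closed[of "Suc l" v] by blast
  have "gauss_prim (Suc l) w v = S w - (max 0 (w - v)) ^ Suc l / fact (Suc l)" for w
    unfolding S(2) by (auto simp: max_def)
  then show ?thesis by (auto intro!: continuous_intros S(1) simp del: gauss_prim.simps)
qed

lemma rapid_decay_gauss_prim: "rapid_decay (\<lambda>w. gauss_prim l w v)"
proof (induction l)
  case 0
  then show ?case using rapid_decay_cdf_jump by simp
next
  case (Suc l)
  have "rapid_decay (\<lambda>w. (1 / real (Suc l)) * (w * gauss_prim l w v - v * gauss_prim l w v + hermite_coeff l v * gauss w))"
    by (intro rapid_decay_cmult rapid_decay_add rapid_decay_diff rapid_decay_ident_mult Suc rapid_decay_gauss)
  then show ?case by (simp add: algebra_simps add_divide_distrib diff_divide_distrib)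
qed

lemma rapid_decay_gauss_prim_deriv: "rapid_decay (\<lambda>w. gauss_prim_deriv k l w v)"
  by (induction k l _ v rule: gauss_prim_deriv.induct)
     (simp_all del: gauss_prim.simps hermite_coeff.simps
        add: rapid_decay_gauss_prim rapid_decay_cmult rapid_decay_gauss_poly rapid_decay_add)


subsection \<open>The kernel in real form\<close>

definition lagrange_basis :: "nat \<Rightarrow> (nat \<Rightarrow> real) \<Rightarrow> nat \<Rightarrow> real poly" where
  "lagrange_basis m x r = (\<Prod>s\<in>{1..m} - {r}. Polynomial.smult (1 / (x r - x s)) [:- x s, 1:])"

lemma poly_lagrange_basis:
  assumes "inj_on x {1..m}" "r \<in> {1..m}" "s \<in> {1..m}"
  shows "poly (lagrange_basis m x r) (x s) = of_bool (r = s)"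
proof (cases "r = s")
  case True
  have fac: "poly (Polynomial.smult (1 / d) [:- a, 1:]) z = (z - a) / d" for a d z :: real
    by (simp add: diff_divide_distrib)
  have "poly (lagrange_basis m x r) (x s) = (\<Prod>t\<in>{1..m} - {r}. (x r - x t) / (x r - x t))"
    unfolding lagrange_basis_def poly_prod fac True ..
  also have "\<dots> = 1" using inj_on_eq_iff[OF assms(1,2)] by (intro prod.neutral) simp
  finally show ?thesis using True by simp
next
  case False
  then show ?thesis using assms
    by (auto simp: lagrange_basis_def poly_prod intro!: prod_zero bexI[of _ s])
qed

lemma degree_lagrange_basis:
  assumes "r \<in> {1..m}" shows "degree (lagrange_basis m x r) < m"
proof -
  have "degree (lagrange_basis m x r) \<le> sum (degree \<circ> (\<lambda>s. Polynomial.smult (1 / (x r - x s)) [:- x s, 1:])) ({1..m} - {r})"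
    unfolding lagrange_basis_def by (rule degree_prod_sum_le) simp
  also have "\<dots> \<le> (\<Sum>s\<in>{1..m} - {r}. 1)"
    by (intro sum_mono) (auto intro!: order_trans[OF degree_smult_le])
  also have "\<dots> < m" using assms by simp
  finally show ?thesis .
qed

text \<open>The difference has degree below \<open>n\<close> and the \<open>n\<close> distinct roots
  \<open>y j\<close>.\<close>

lemma lagrange_interpolation:
  assumes inj: "inj_on y {1..n}" and deg: "degree P < n"
  shows "P = (\<Sum>j\<in>{1..n}. Polynomial.smult (poly P (y j)) (lagrange_basis n y j))"
proof (rule ccontr)
  let ?Q = "\<Sum>j\<in>{1..n}. Polynomial.smult (poly P (y j)) (lagrange_basis n y j)"
  assume "P \<noteq> ?Q"
  then have ne: "P - ?Q \<noteq> 0" by simp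
  have dQ: "degree ?Q < n"
    using deg by (intro degree_sum_less) (auto intro!: le_less_trans[OF degree_smult_le] degree_lagrange_basis)
  have "y ` {1..n} \<subseteq> {z. poly (P - ?Q) z = 0}"
  proof clarify
    fix i assume i: "i \<in> {1..n}"
    have "poly ?Q (y i) = (\<Sum>j\<in>{1..n}. poly P (y j) * of_bool (j = i))"
      using poly_lagrange_basis[OF inj _ i] by (simp add: poly_sum)
    also have "\<dots> = poly P (y i)" using i sum.delta'[of "{1..n}" i "\<lambda>j. poly P (y j)"]
      by (simp add: if_distrib cong: if_cong)
    finally show "poly (P - ?Q) (y i) = 0" by simp
  qed
  then have "card (y ` {1..n}) \<le> card {z. poly (P - ?Q) z = 0}"
    by (intro card_mono poly_roots_finite ne)
  also have "\<dots> \<le> degree (P - ?Q)" by (rule card_poly_roots_bound[OF ne])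
  also have "\<dots> < n" using deg dQ by (rule degree_diff_less)
  finally show False using card_image[OF inj] by simp
qed

text \<open>The weight of the node \<open>x r\<close> when a Gaussian times a polynomial of low
  degree, differentiated \<open>k\<close> times, is recovered from its values at the nodes;
  \<open>exp ((x r)^2 / 2)\<close> undoes the Gaussian there.\<close>

definition lagrange_coeff :: "nat \<Rightarrow> (nat \<Rightarrow> real) \<Rightarrow> nat \<Rightarrow> real \<Rightarrow> nat \<Rightarrow> real" where
  "lagrange_coeff m x k w r = exp ((x r)\<^sup>2 / 2) * gauss_poly k (lagrange_basis m x r) w"

lemma gauss_poly_interpolation:
  assumes "inj_on y {1..n}" "degree P < n"
  shows "gauss_poly k P w = (\<Sum>j\<in>{1..n}. lagrange_coeff n y k w j * gauss_poly 0 P (y j))"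
proof -
  have "gauss_poly k P w = gauss_poly k (\<Sum>j\<in>{1..n}. Polynomial.smult (poly P (y j)) (lagrange_basis n y j)) w"
    using lagrange_interpolation[OF assms] by simp
  also have "\<dots> = (\<Sum>j\<in>{1..n}. poly P (y j) * gauss_poly k (lagrange_basis n y j) w)"
    by (simp add: gauss_poly_sum gauss_poly_smult)
  also have "\<dots> = (\<Sum>j\<in>{1..n}. lagrange_coeff n y k w j * gauss_poly 0 P (y j))"
    using gauss_exp by (intro sum.cong refl) (simp add: lagrange_coeff_def gauss_poly_0 algebra_simps)
  finally show ?thesis .
qed

text \<open>The kernel between levels \<open>m + k\<close> and \<open>m + l + 1\<close>. For \<open>k = 0\<close> it is the function that
  differs from \<open>gauss_prim l\<close> by a Gaussian times a polynomial and vanishes at all \<open>x r\<close>.\<close>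
definition rising_kernel :: "nat \<Rightarrow> (nat \<Rightarrow> real) \<Rightarrow> nat \<Rightarrow> nat \<Rightarrow> real \<Rightarrow> real \<Rightarrow> real" where
  "rising_kernel m x k l w v =
     gauss_prim_deriv k l w v - (\<Sum>r\<in>{1..m}. lagrange_coeff m x k w r * gauss_prim l (x r) v)"

text \<open>The constant comes from differentiating \<open>gauss_prim l\<close>, the sum from
  differentiating the part that makes the kernel vanish at the \<open>x r\<close>.\<close>

definition kernel_poly :: "nat \<Rightarrow> (nat \<Rightarrow> real) \<Rightarrow> nat \<Rightarrow> real \<Rightarrow> real poly" where
  "kernel_poly m x l v = Polynomial.smult (hermite_coeff l v) 1 -
     (\<Sum>r\<in>{1..m}. Polynomial.smult (exp ((x r)\<^sup>2 / 2) * gauss_prim l (x r) v) (gauss_step (lagrange_basis m x r)))"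

text \<open>The Lagrange polynomials have degree below \<open>m\<close> and
  \<open>gauss_step\<close> adds at most one. Hence the \<open>m + 1\<close> entries of the next
  level suffice as interpolation nodes.\<close>

lemma degree_kernel_poly: "degree (kernel_poly m x l v) < m + 1"
proof -
  have "degree (gauss_step (lagrange_basis m x r)) \<le> m" if "r \<in> {1..m}" for r
    using degree_gauss_step[of "lagrange_basis m x r"] degree_lagrange_basis[OF that, of x] by simp
  then have "degree (kernel_poly m x l v) \<le> m" unfolding kernel_poly_def
    by (intro degree_diff_le degree_sum_le) (auto intro!: order_trans[OF degree_smult_le])
  then show ?thesis by simp
qed

text \<open>One derivative gathers all Gaussian terms into a single Gaussian times polynomial. For
  \<open>l = 0\<close> nothing else remains, which is what makes the block of level
  \<open>m + 1\<close> computable.\<close>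

lemma rising_kernel_Suc:
  "rising_kernel m x (Suc k) l w v =
     (case l of 0 \<Rightarrow> 0 | Suc l' \<Rightarrow> gauss_prim_deriv k l' w v) + gauss_poly k (kernel_poly m x l v) w"
proof -
  have "gauss_poly k (kernel_poly m x l v) w = hermite_coeff l v * gauss_poly k 1 w -
    (\<Sum>r\<in>{1..m}. lagrange_coeff m x (Suc k) w r * gauss_prim l (x r) v)"
    unfolding kernel_poly_def gauss_poly_diff gauss_poly_sum gauss_poly_smult lagrange_coeff_def gauss_poly_Suc
    by (intro arg_cong2[where f=minus] refl sum.cong) (simp only: mult_ac)
  then show ?thesis unfolding rising_kernel_def by (cases l) (simp_all del: gauss_prim.simps hermite_coeff.simps)
qed

text \<open>The next two identities say that conditioning on the level \<open>m + 1\<close>, that is, taking the Schur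
  complement of its block, turns the kernel started at \<open>x\<close> into the kernel started at \<open>y\<close>.\<close>
lemma rising_kernel_row:
  assumes "inj_on y {1..m+1}"
  shows "rising_kernel m x (Suc k) 0 w v =
     (\<Sum>j\<in>{1..m+1}. lagrange_coeff (m + 1) y k w j * rising_kernel m x (Suc 0) 0 (y j) v)"
proof -
  have "gauss_poly k (kernel_poly m x 0 v) w =
    (\<Sum>j\<in>{1..m+1}. lagrange_coeff (m + 1) y k w j * gauss_poly 0 (kernel_poly m x 0 v) (y j))"
    by (rule gauss_poly_interpolation[OF assms degree_kernel_poly])
  then show ?thesis unfolding rising_kernel_Suc by simp
qed

lemma rising_kernel_Schur:
  assumes "inj_on y {1..m+1}"
  shows "rising_kernel m x (Suc k) (Suc l) w v -
     (\<Sum>j\<in>{1..m+1}. lagrange_coeff (m + 1) y k w j * rising_kernel m x (Suc 0) (Suc l) (y j) v)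
     = rising_kernel (m + 1) y k l w v"
proof -
  let ?Q = "kernel_poly m x (Suc l) v"
  have "gauss_poly k ?Q w = (\<Sum>j\<in>{1..m+1}. lagrange_coeff (m + 1) y k w j * gauss_poly 0 ?Q (y j))"
    by (rule gauss_poly_interpolation[OF assms degree_kernel_poly])
  \<comment> \<open>The two contributions of \<open>?Q\<close> cancel. The values at
    \<open>y j\<close> contain \<open>gauss_prim l (y j) v\<close> besides \<open>?Q\<close>, so
    what is left is \<open>gauss_prim_deriv k l\<close> minus its interpolation at
    \<open>y\<close>.\<close>
  then show ?thesis unfolding rising_kernel_Suc
    by (simp add: rising_kernel_def sum.distrib distrib_left del: gauss_prim.simps hermite_coeff.simps)
qed

subsection \<open>Cells\<close>

text \<open>The half-open intervals cut out by \<open>x 1 > \<dots> > x m\<close>, numbered from the right; the points of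
  the next level that interlace with \<open>x\<close> lie one in each cell, up to a null set.\<close>
definition cell :: "nat \<Rightarrow> (nat \<Rightarrow> real) \<Rightarrow> nat \<Rightarrow> real set" where
  "cell m x i = {v. (i \<le> m \<longrightarrow> x i \<le> v) \<and> (2 \<le> i \<longrightarrow> v < x (i - 1))}"

lemma Conf0_less: "x \<in> Conf0 m \<Longrightarrow> 1 \<le> i \<Longrightarrow> i < j \<Longrightarrow> j \<le> m \<Longrightarrow> x j < x i"
  unfolding Conf0_def by auto

lemma Conf0_le: "x \<in> Conf0 m \<Longrightarrow> 1 \<le> i \<Longrightarrow> i \<le> j \<Longrightarrow> j \<le> m \<Longrightarrow> x j \<le> x i"
  using Conf0_less[of x m i j] by (cases "i = j") auto

lemma Conf0_inj_on: "x \<in> Conf0 m \<Longrightarrow> inj_on x {1..m}"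
  by (rule inj_onI) (metis Conf0_less atLeastAtMost_iff less_irrefl linorder_neqE_nat)

text \<open>The cell \<open>i\<close> has \<open>x 1, ..., x (i - 1)\<close> strictly on its right
  and the other entries not to the right of any of its points. So all jumps
  \<open>of_bool (v < x r)\<close> are determined by the cell of \<open>v\<close>.\<close>

lemma cell_iff:
  assumes "x \<in> Conf0 m" "v \<in> cell m x i" "r \<in> {1..m}" "i \<in> {1..m+1}"
  shows "v < x r \<longleftrightarrow> r < i"
proof
  assume "v < x r"
  show "r < i"
  proof (rule ccontr)
    assume "\<not> r < i"
    then show False
      using assms \<open>v < x r\<close> Conf0_le[of x m i r] unfolding cell_def by auto
  qed
next
  assume "r < i"
  then have "r \<le> i - 1" "i - 1 \<le> m" "2 \<le> i" using assms(3,4) by auto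
  then have "x (i - 1) \<le> x r" "v < x (i - 1)"
    using assms Conf0_le[of x m r "i - 1"] unfolding cell_def by auto
  then show "v < x r" by simp
qed

lemma cell_unique:
  assumes "x \<in> Conf0 m" "v \<in> cell m x i" "v \<in> cell m x j" "i \<in> {1..m+1}" "j \<in> {1..m+1}"
  shows "i = j"
  using cell_iff[OF assms(1,2), of "min i j"] cell_iff[OF assms(1,3), of "min i j"] assms(4,5)
  by (cases i j rule: linorder_cases) auto

lemma cell_exists:
  assumes "x \<in> Conf0 m"
  obtains i where "i \<in> {1..m+1}" "v \<in> cell m x i"
proof -
  define P where "P = (\<lambda>i. 1 \<le> i \<and> (i \<le> m \<longrightarrow> x i \<le> v))"
  define i where "i = (LEAST i. P i)"
  have "P (m + 1)" by (simp add: P_def)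
  then have i: "P i" "i \<le> m + 1" unfolding i_def by (auto intro: LeastI Least_le)
  have "\<not> P (i - 1)" if "2 \<le> i" using not_less_Least[of "i - 1" P] that by (simp add: i_def)
  then have "v \<in> cell m x i" using i by (auto simp: P_def cell_def)
  then show ?thesis using i that[of i] by (simp add: P_def)
qed

lemma cell_borel [measurable]: "cell m x i \<in> sets borel"
  unfolding cell_def by measurable

text \<open>For \<open>l = 0\<close> and at least one derivative, \<open>v\<close> enters only
  through the jumps \<open>of_bool (v < x r)\<close>, since \<open>hermite_coeff 0\<close> is
  constant.\<close>

lemma rising_kernel_cell:
  assumes "x \<in> Conf0 m" "i \<in> {1..m+1}" "v \<in> cell m x i" "v' \<in> cell m x i"
  shows "rising_kernel m x (Suc k) 0 w v = rising_kernel m x (Suc k) 0 w v'"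
  using cell_iff[OF assms(1,3) _ assms(2)] cell_iff[OF assms(1,4) _ assms(2)]
  by (simp add: rising_kernel_def)

lemma gauss_prim_measurable_w: "(\<lambda>w. gauss_prim l w v) \<in> borel_measurable borel"
  by (induction l) simp_all

lemma continuous_on_lagrange_coeff [continuous_intros]: "continuous_on A (\<lambda>w. lagrange_coeff m x k w r)"
  unfolding lagrange_coeff_def by (intro continuous_intros)

lemma rising_kernel_rapid: "rapid_decay (\<lambda>w. rising_kernel m x k l w v)"
proof -
  have "rapid_decay (\<lambda>w. lagrange_coeff m x k w r * gauss_prim l (x r) v)" for r
    using rapid_decay_cmult[OF rapid_decay_gauss_poly[of k "lagrange_basis m x r"], of "exp ((x r)\<^sup>2 / 2) * gauss_prim l (x r) v"]
    by (simp add: lagrange_coeff_def mult_ac)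
  then show ?thesis unfolding rising_kernel_def
    by (intro rapid_decay_diff rapid_decay_gauss_prim_deriv rapid_decay_sum)
qed

lemma rising_kernel_integrable: "integrable lborel (\<lambda>w. rising_kernel m x (Suc 0) l w v)"
proof (rule rapid_decay_integrable[OF rising_kernel_rapid])
  have [measurable]: "gauss_poly k P \<in> borel_measurable borel" for k P
    by (intro borel_measurable_continuous_onI continuous_on_gauss_poly)
  note [measurable] = gauss_prim_measurable_w
  show "(\<lambda>w. rising_kernel m x (Suc 0) l w v) \<in> borel_measurable borel"
    unfolding rising_kernel_Suc by (cases l) (simp_all del: gauss_prim.simps)
qed

text \<open>The primitive \<open>G\<close> is the kernel without derivatives, except that for
  \<open>l = 0\<close> the jump in \<open>w\<close> is left out to make it continuous. At each
  \<open>x s\<close> it equals 0 for \<open>l > 0\<close> and \<open>of_bool (v < x s)\<close> for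
  \<open>l = 0\<close>; its limits are 0 on the left and \<open>of_bool (l = 0)\<close> on the
  right. Its increment over a cell is therefore the indicator of \<open>v\<close>.\<close>

lemma integral_rising_kernel_cell:
  assumes x: "x \<in> Conf0 m" and i: "i \<in> {1..m+1}"
  shows "(LINT w:cell m x i|lborel. rising_kernel m x (Suc 0) l w v) = of_bool (l = 0 \<and> v \<in> cell m x i)"
proof -
  define G where "G = (\<lambda>w. (if l = 0 then normal_cdf w else gauss_prim l w v)
     - (\<Sum>r\<in>{1..m}. lagrange_coeff m x 0 w r * gauss_prim l (x r) v))"
  have lc: "lagrange_coeff m x 0 (x s) r = of_bool (r = s)" if "r \<in> {1..m}" "s \<in> {1..m}" for r s
    using poly_lagrange_basis[OF Conf0_inj_on[OF x] that] gauss_exp[of "x r"]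
    by (auto simp: lagrange_coeff_def gauss_poly_0)
  have Gx: "G (x s) = of_bool (l = 0 \<and> v < x s)" if "s \<in> {1..m}" for s
  proof -
    have "(\<Sum>r\<in>{1..m}. lagrange_coeff m x 0 (x s) r * gauss_prim l (x r) v) = (\<Sum>r\<in>{1..m}. if r = s then gauss_prim l (x s) v else 0)"
      by (intro sum.cong refl) (simp add: lc[OF _ that])
    also have "\<dots> = gauss_prim l (x s) v" using that by simp
    finally show ?thesis by (simp add: G_def)
  qed
  have cont: "continuous_on UNIV G"
  proof (cases l)
    case 0
    then show ?thesis unfolding G_def by (auto intro!: continuous_intros)
  next
    case (Suc n)
    then show ?thesis unfolding G_def using continuous_on_gauss_prim[of n v]
      by (auto intro!: continuous_intros simp del: gauss_prim.simps)
  qed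
  have lcd: "((\<lambda>w. lagrange_coeff m x 0 w r) has_real_derivative lagrange_coeff m x (Suc 0) w r) (at w)" for w r
    unfolding lagrange_coeff_def by (intro DERIV_cmult gauss_poly_deriv)
  have der: "(G has_real_derivative rising_kernel m x (Suc 0) l w v) (at w)" if "w \<notin> {v}" for w
  proof -
    have "((\<lambda>w. if l = 0 then normal_cdf w else gauss_prim l w v) has_real_derivative gauss_prim_deriv (Suc 0) l w v) (at w)"
      using gauss_prim_has_deriv[of w v l] normal_cdf_deriv[of w] that
      by (cases l) (simp_all add: gauss_poly_0 del: gauss_prim.simps)
    then show ?thesis unfolding G_def rising_kernel_def
      by (intro DERIV_diff DERIV_sum DERIV_cmult_right lcd)
  qed
  have dec: "rapid_decay (\<lambda>w. G w - of_bool (l = 0 \<and> v < w))"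
  proof -
    have "(\<lambda>w. G w - of_bool (l = 0 \<and> v < w)) = (\<lambda>w. rising_kernel m x 0 l w v)"
      by (auto simp: G_def rising_kernel_def simp del: gauss_prim.simps(2))
    then show ?thesis using rising_kernel_rapid by metis
  qed
  have top: "(G \<longlongrightarrow> of_bool (l = 0)) at_top"
  proof -
    have "((\<lambda>w. (G w - of_bool (l = 0 \<and> v < w)) + of_bool (l = 0)) \<longlongrightarrow> 0 + of_bool (l = 0)) at_top"
      by (intro tendsto_add rapid_decay_tendsto dec tendsto_const)
    then have "(G \<longlongrightarrow> 0 + of_bool (l = 0)) at_top"
      by (rule Lim_transform_eventually) (auto intro!: eventually_mono[OF eventually_gt_at_top[of v]])
    then show ?thesis by simp
  qed
  have bot: "(G \<longlongrightarrow> 0) at_bot"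
    by (rule Lim_transform_eventually[OF rapid_decay_tendsto(2)[OF dec]])
       (auto intro!: eventually_mono[OF eventually_le_at_bot[of v]])
  have fin: "finite {v}" by simp
  note FTC = fin cont der rising_kernel_integrable
  consider "i = 1" "m = 0" | "i = 1" "m > 0" | "i = m + 1" "m > 0" | "2 \<le> i" "i \<le> m" using i by force
  then show ?thesis
  proof cases
    case 1
    then have "cell m x i = UNIV" by (auto simp: cell_def)
    then show ?thesis using integral_deriv_UNIV[OF FTC bot top] by simp
  next
    case 2
    then have "cell m x i = {x 1..}" by (auto simp: cell_def)
    then show ?thesis using integral_deriv_Ici[OF FTC top, of "x 1"] Gx[of 1] 2 by auto
  next
    case 3
    then have "cell m x i = {..<x m}" by (auto simp: cell_def)
    then show ?thesis using integral_deriv_Iio[OF FTC bot, of "x m"] Gx[of m] 3 by auto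
  next
    case 4
    then have c: "cell m x i = {x i..<x (i - 1)}" by (auto simp: cell_def)
    have lt: "x i \<le> x (i - 1)" using Conf0_le[OF x, of "i - 1" i] 4 by auto
    have ii: "i \<in> {1..m}" "i - 1 \<in> {1..m}" using 4 by auto
    show ?thesis using integral_deriv_Ico[OF FTC lt] Gx[OF ii(1)] Gx[OF ii(2)] lt unfolding c by auto
  qed
qed


subsection \<open>Measurability of the kernel\<close>

text \<open>The uniform degree bound makes evaluation at a measurable point a sum of fixed
  length.\<close>

definition poly_measurable :: "'a measure \<Rightarrow> ('a \<Rightarrow> real poly) \<Rightarrow> bool" where
  "poly_measurable N f \<longleftrightarrow>
     (\<forall>n. (\<lambda>\<omega>. poly.coeff (f \<omega>) n) \<in> borel_measurable N) \<and> (\<exists>d. \<forall>\<omega>. degree (f \<omega>) \<le> d)"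

lemma poly_measurableD [measurable_dest]:
  "poly_measurable N f \<Longrightarrow> (\<lambda>\<omega>. poly.coeff (f \<omega>) n) \<in> borel_measurable N"
  unfolding poly_measurable_def by auto

lemma poly_measurable_const: "poly_measurable N (\<lambda>_. P)"
  unfolding poly_measurable_def by auto

lemma poly_measurable_linear:
  assumes [measurable]: "a \<in> borel_measurable N"
  shows "poly_measurable N (\<lambda>\<omega>. [:a \<omega>, b:])"
  unfolding poly_measurable_def
proof
  have "(\<lambda>\<omega>. poly.coeff [:a \<omega>, b:] n) \<in> borel_measurable N" for n
    by (cases n) (auto simp: coeff_pCons split: nat.split)
  then show "\<forall>n. (\<lambda>\<omega>. poly.coeff [:a \<omega>, b:] n) \<in> borel_measurable N" by simp
qed (auto intro!: exI[of _ 1])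

lemma poly_measurable_smult:
  assumes [measurable]: "a \<in> borel_measurable N" and "poly_measurable N f"
  shows "poly_measurable N (\<lambda>\<omega>. Polynomial.smult (a \<omega>) (f \<omega>))"
proof -
  note [measurable] = poly_measurableD[OF assms(2)]
  obtain d where "\<And>\<omega>. degree (f \<omega>) \<le> d" using assms(2) unfolding poly_measurable_def by auto
  then show ?thesis unfolding poly_measurable_def
    by (auto intro!: exI[of _ d] order_trans[OF degree_smult_le])
qed

lemma poly_measurable_mult:
  assumes "poly_measurable N f" "poly_measurable N g"
  shows "poly_measurable N (\<lambda>\<omega>. f \<omega> * g \<omega>)"
proof -
  obtain d e where "\<And>\<omega>. degree (f \<omega>) \<le> d" "\<And>\<omega>. degree (g \<omega>) \<le> e"
    using assms unfolding poly_measurable_def by auto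
  then have "\<And>\<omega>. degree (f \<omega> * g \<omega>) \<le> d + e"
    by (meson add_mono degree_mult_le order_trans)
  moreover note [measurable] = poly_measurableD[OF assms(1)] poly_measurableD[OF assms(2)]
  ultimately show ?thesis unfolding poly_measurable_def coeff_mult by (auto intro!: exI[of _ "d + e"])
qed

lemma poly_measurable_prod:
  "(\<And>i. i \<in> I \<Longrightarrow> poly_measurable N (f i)) \<Longrightarrow> poly_measurable N (\<lambda>\<omega>. \<Prod>i\<in>I. f i \<omega>)"
  by (induction I rule: infinite_finite_induct) (auto intro: poly_measurable_const poly_measurable_mult)

lemma poly_measurable_gauss_step:
  assumes "poly_measurable N f"
  shows "poly_measurable N (\<lambda>\<omega>. gauss_step (f \<omega>))"
proof -
  obtain d where d: "\<And>\<omega>. degree (f \<omega>) \<le> d" using assms unfolding poly_measurable_def by auto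
  have "degree (gauss_step (f \<omega>)) \<le> Suc d" for \<omega> using degree_gauss_step[of "f \<omega>"] d[of \<omega>] by simp
  moreover note [measurable] = poly_measurableD[OF assms]
  have "(\<lambda>\<omega>. poly.coeff (gauss_step (f \<omega>)) n) \<in> borel_measurable N" for n
    unfolding gauss_step_def by (cases n) (simp_all add: coeff_pderiv)
  ultimately show ?thesis unfolding poly_measurable_def by auto
qed

lemma poly_measurable_poly:
  assumes "poly_measurable N f" and [measurable]: "w \<in> borel_measurable N"
  shows "(\<lambda>\<omega>. poly (f \<omega>) (w \<omega>)) \<in> borel_measurable N"
proof -
  obtain d where d: "\<And>\<omega>. degree (f \<omega>) \<le> d" using assms unfolding poly_measurable_def by auto
  have [measurable]: "(\<lambda>\<omega>. poly.coeff (f \<omega>) n) \<in> borel_measurable N" for n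
    using assms unfolding poly_measurable_def by auto
  have "poly (f \<omega>) (w \<omega>) = (\<Sum>i\<le>d. poly.coeff (f \<omega>) i * w \<omega> ^ i)" for \<omega>
    unfolding poly_altdef using d[of \<omega>]
    by (intro sum.mono_neutral_left) (auto simp: coeff_eq_0)
  then show ?thesis by simp
qed

lemma gauss_poly_measurable:
  assumes "poly_measurable N f" and [measurable]: "w \<in> borel_measurable N"
  shows "(\<lambda>\<omega>. gauss_poly k (f \<omega>) (w \<omega>)) \<in> borel_measurable N"
proof -
  have "poly_measurable N (\<lambda>\<omega>. (gauss_step ^^ k) (f \<omega>))"
    by (induction k) (auto intro: poly_measurable_gauss_step assms)
  from poly_measurable_poly[OF this, of w] show ?thesis by (simp add: gauss_poly_def)
qed

lemma hermite_coeff_measurable [measurable]: "hermite_coeff l \<in> borel_measurable borel"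
proof -
  have "(\<lambda>v. hermite_coeff l v) \<in> borel_measurable borel \<and> (\<lambda>v. hermite_coeff (Suc l) v) \<in> borel_measurable borel"
  proof (induction l)
    case (Suc l)
    then have [measurable]: "hermite_coeff l \<in> borel_measurable borel"
      "hermite_coeff (Suc l) \<in> borel_measurable borel" by auto
    then show ?case by (simp add: Suc)
  qed simp
  then show ?thesis by simp
qed

lemma gauss_prim_measurable:
  assumes [measurable]: "w \<in> borel_measurable N" "v \<in> borel_measurable N"
  shows "(\<lambda>\<omega>. gauss_prim l (w \<omega>) (v \<omega>)) \<in> borel_measurable N"
proof (induction l)
  case 0
  then show ?case by (simp add: of_bool_def)
next
  case (Suc l)
  note [measurable] = Suc
  show ?case unfolding gauss_prim.simps by measurable
qed

lemma gauss_prim_deriv_measurable: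
  assumes [measurable]: "w \<in> borel_measurable N" "v \<in> borel_measurable N"
  shows "(\<lambda>\<omega>. gauss_prim_deriv k l (w \<omega>) (v \<omega>)) \<in> borel_measurable N"
proof (induction k arbitrary: l)
  case 0
  then show ?case using gauss_prim_measurable[OF assms] by simp
next
  case (Suc k)
  note [measurable] = gauss_poly_measurable[OF poly_measurable_const assms(1)] Suc
  show ?case by (cases l) (simp_all del: hermite_coeff.simps gauss_prim.simps)
qed

lemma rising_kernel_measurable:
  assumes [measurable]: "w \<in> borel_measurable N" "v \<in> borel_measurable N"
    and x: "\<And>r. r \<in> {1..m} \<Longrightarrow> (\<lambda>\<omega>. x \<omega> r) \<in> borel_measurable N"
  shows "(\<lambda>\<omega>. rising_kernel m (x \<omega>) k l (w \<omega>) (v \<omega>)) \<in> borel_measurable N"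
proof -
  have "poly_measurable N (\<lambda>\<omega>. lagrange_basis m (x \<omega>) r)" if "r \<in> {1..m}" for r
    unfolding lagrange_basis_def using x that
    by (intro poly_measurable_prod poly_measurable_smult poly_measurable_linear) auto
  then have "(\<lambda>\<omega>. lagrange_coeff m (x \<omega>) k (w \<omega>) r * gauss_prim l (x \<omega> r) (v \<omega>)) \<in> borel_measurable N"
    if "r \<in> {1..m}" for r
    unfolding lagrange_coeff_def using x[OF that] that
    by (intro borel_measurable_times gauss_poly_measurable gauss_prim_measurable) auto
  then show ?thesis unfolding rising_kernel_def
    by (intro borel_measurable_diff borel_measurable_sum gauss_prim_deriv_measurable) auto
qed

lemma rising_kernel_cong:
  assumes "\<And>r. r \<in> {1..m} \<Longrightarrow> x r = x' r"
  shows "rising_kernel m x = rising_kernel m x'"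
proof -
  have "lagrange_coeff m x k w r = lagrange_coeff m x' k w r" if "r \<in> {1..m}" for k w r
    using assms that by (simp add: lagrange_coeff_def lagrange_basis_def)
  then show ?thesis using assms by (intro ext) (simp add: rising_kernel_def)
qed

text \<open>The truncated subtractions are exact for levels above \<open>m\<close>. The number of
  derivatives is then positive, which removes the jump in the first position when the second level
  is \<open>m + 1\<close>.\<close>

definition level_kernel :: "nat \<Rightarrow> (nat \<Rightarrow> real) \<Rightarrow> nat \<times> real \<Rightarrow> nat \<times> real \<Rightarrow> real" where
  "level_kernel m x p q = rising_kernel m x (fst p - m) (fst q - m - 1) (snd p) (snd q)"

lemma level_kernel_cong:
  "(\<And>r. r \<in> {1..m} \<Longrightarrow> x r = x' r) \<Longrightarrow> level_kernel m x = level_kernel m x'"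
  using rising_kernel_cong[of m x x'] by (simp add: level_kernel_def fun_eq_iff)

text \<open>Levels and positions are separate arguments, because the levels stay fixed while the
  positions are integrated.\<close>

definition level_det :: "nat \<Rightarrow> (nat \<Rightarrow> real) \<Rightarrow> 'i set \<Rightarrow> ('i \<Rightarrow> nat) \<Rightarrow> ('i \<Rightarrow> real) \<Rightarrow> real" where
  "level_det m x I lev pos = det_on I (\<lambda>i j. level_kernel m x (lev i, pos i) (lev j, pos j))"

lemma level_det_cong:
  assumes "\<And>r. r \<in> {1..m} \<Longrightarrow> x r = x' r" "\<And>i. i \<in> I \<Longrightarrow> lev i = lev' i" "\<And>i. i \<in> I \<Longrightarrow> pos i = pos' i"
  shows "level_det m x I lev pos = level_det m x' I lev' pos'"
  unfolding level_det_def using assms level_kernel_cong[OF assms(1)] by (intro det_on_cong) auto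

lemma level_det_reindex:
  assumes "finite I" "inj_on f I"
  shows "level_det m x (f ` I) lev pos = level_det m x I (lev \<circ> f) (pos \<circ> f)"
  unfolding level_det_def det_on_reindex[OF assms] by simp

lemma level_det_measurable:
  assumes "\<And>i. i \<in> I \<Longrightarrow> (\<lambda>\<omega>. pos \<omega> i) \<in> borel_measurable N"
    and "\<And>r. r \<in> {1..m} \<Longrightarrow> (\<lambda>\<omega>. x \<omega> r) \<in> borel_measurable N"
  shows "(\<lambda>\<omega>. level_det m (x \<omega>) I lev (pos \<omega>)) \<in> borel_measurable N"
  unfolding level_det_def det_on_def level_kernel_def
  using assms
  by (intro borel_measurable_sum borel_measurable_times borel_measurable_prod)
     (auto intro!: rising_kernel_measurable simp: permutes_in_image)

subsection \<open>The block of the first level\<close>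

definition in_cells :: "nat \<Rightarrow> (nat \<Rightarrow> real) \<Rightarrow> nat set \<Rightarrow> (nat \<Rightarrow> real) \<Rightarrow> bool" where
  "in_cells m x S y \<longleftrightarrow> (\<forall>i\<in>S. y i \<in> cell m x i)"

lemma in_cells_interlacing: "in_cells m x {1..m+1} y \<Longrightarrow> interlacing m x y"
proof -
  assume y: "in_cells m x {1..m+1} y"
  have "x i \<le> y i \<and> y (i + 1) \<le> x i" if "i \<in> {1..m}" for i
    using y[unfolded in_cells_def, THEN bspec, of i] y[unfolded in_cells_def, THEN bspec, of "i + 1"] that
    by (simp add: cell_def)
  then show ?thesis by (simp add: interlacing_def)
qed

lemma in_cells_decreasing:
  assumes "x \<in> Conf0 m" "in_cells m x {1..m+1} y" "1 \<le> i" "i < j" "j \<le> m + 1"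
  shows "y j < y i"
proof -
  have "y j < x i" using cell_iff[OF assms(1), of "y j" j i] assms by (auto simp: in_cells_def)
  also have "x i \<le> y i" using assms by (auto simp: in_cells_def cell_def)
  finally show ?thesis .
qed

lemma in_cells_Conf0:
  assumes "x \<in> Conf0 m" "in_cells m x {1..m+1} y"
  shows "restrict y {1..m+1} \<in> Conf0 (m + 1)"
  using in_cells_decreasing[OF assms] by (auto simp: Conf0_def)

lemma vandermonde_pos:
  assumes "\<And>i j. 1 \<le> i \<Longrightarrow> i < j \<Longrightarrow> j \<le> n \<Longrightarrow> y j < y i"
  shows "vandermonde n y > 0"
  unfolding vandermonde_def using assms by (intro prod_pos) auto

text \<open>On the product of the cells the columns are constant, so that up to the factors \<open>gauss (y i)\<close>
  the block is made of values of fixed polynomials of degree at most \<open>m\<close>.\<close>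
lemma first_block_vandermonde:
  assumes x: "x \<in> Conf0 m"
  shows "\<exists>C. \<forall>y. in_cells m x {1..m+1} y \<longrightarrow>
    level_det m x {1..m+1} (\<lambda>_. m + 1) y = C * (vandermonde (m + 1) y * (\<Prod>i\<in>{1..m+1}. gauss (y i)))"
proof (cases "\<exists>y0. in_cells m x {1..m+1} y0")
  case True
  then obtain y0 where y0: "in_cells m x {1..m+1} y0" by blast
  obtain C where C: "\<And>y. det_on {1..m+1} (\<lambda>i j. poly (kernel_poly m x 0 (y0 j)) (y i)) = C * vandermonde (m + 1) y"
    using det_on_polys_vandermonde[of "m + 1" "\<lambda>j. kernel_poly m x 0 (y0 j)"] degree_kernel_poly by blast
  have "level_det m x {1..m+1} (\<lambda>_. m + 1) y = C * (vandermonde (m + 1) y * (\<Prod>i\<in>{1..m+1}. gauss (y i)))"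
    if y: "in_cells m x {1..m+1} y" for y
  proof -
    have "level_det m x {1..m+1} (\<lambda>_. m + 1) y = det_on {1..m+1} (\<lambda>i j. rising_kernel m x (Suc 0) 0 (y i) (y j))"
      by (simp add: level_det_def level_kernel_def)
    also have "\<dots> = det_on {1..m+1} (\<lambda>i j. gauss (y i) * poly (kernel_poly m x 0 (y0 j)) (y i))"
    proof (intro det_on_cong refl)
      fix i j assume ij: "i \<in> {1..m+1}" "j \<in> {1..m+1}"
      have "rising_kernel m x (Suc 0) 0 (y i) (y j) = rising_kernel m x (Suc 0) 0 (y i) (y0 j)"
        using ij y y0 by (intro rising_kernel_cell[OF x, of j]) (auto simp: in_cells_def)
      then show "rising_kernel m x (Suc 0) 0 (y i) (y j) = gauss (y i) * poly (kernel_poly m x 0 (y0 j)) (y i)"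
        by (simp add: rising_kernel_Suc gauss_poly_0)
    qed
    also have "\<dots> = C * (vandermonde (m + 1) y * (\<Prod>i\<in>{1..m+1}. gauss (y i)))"
      unfolding det_on_scale_rows C by (simp only: mult_ac)
    finally show ?thesis .
  qed
  then show ?thesis by blast
qed auto

text \<open>Indices \<open>Inl\<close> are the entries of the full level, indices \<open>Inr\<close>
  the points further up. By \<open>rising_kernel_row\<close> the rows of the latter, in the columns
  of the level, are combinations of the rows of the level with weights
  \<open>lagrange_coeff\<close>; \<open>rising_kernel_Schur\<close> identifies the
  complement.\<close>

lemma level_det_first_block:
  fixes lev :: "'a \<Rightarrow> nat" and pos :: "'a \<Rightarrow> real"
  assumes y: "inj_on y {1..m+1}" and B: "finite B" "\<And>i. i \<in> B \<Longrightarrow> lev i > m + 1"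
  shows "level_det m x (Inl ` {1..m+1} \<union> Inr ` B) (case_sum (\<lambda>_. m + 1) lev) (case_sum y pos)
    = level_det m x {1..m+1} (\<lambda>_. m + 1) y * level_det (m + 1) y B lev pos"
proof -
  let ?A = "Inl ` {1..m+1} :: (nat + 'a) set" and ?B = "Inr ` B :: (nat + 'a) set"
  let ?K = "\<lambda>a b. level_kernel m x (case_sum (\<lambda>_. m + 1) lev a, case_sum y pos a) (case_sum (\<lambda>_. m + 1) lev b, case_sum y pos b)"
  define a :: "nat + 'a \<Rightarrow> nat + 'a \<Rightarrow> real" where
    "a = case_sum (\<lambda>_ _. 0) (\<lambda>i. case_sum (lagrange_coeff (m + 1) y (lev i - (m + 1)) (pos i)) (\<lambda>_. 0))"
  \<comment> \<open>Levels above \<open>m + 1\<close> make both kernel indices successors, as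
    \<open>rising_kernel_Schur\<close> requires.\<close>
  have lev: "lev i - m = Suc (lev i - (m + 1))" "lev i - m - 1 = Suc (lev i - (m + 1) - 1)" if "i \<in> B" for i
    using B(2)[OF that] by auto
  have "level_det m x (?A \<union> ?B) (case_sum (\<lambda>_. m + 1) lev) (case_sum y pos)
    = det_on ?A ?K * det_on ?B (\<lambda>i j. ?K i j - (\<Sum>k\<in>?A. a i k * ?K k j))"
    unfolding level_det_def
  proof (rule det_on_Schur)
    fix i j assume "i \<in> ?B" "j \<in> ?A"
    then obtain i' j' where ij: "i = Inr i'" "i' \<in> B" "j = Inl j'" by auto
    show "?K i j = (\<Sum>k\<in>?A. a i k * ?K k j)"
      using rising_kernel_row[OF y, of x "lev i' - (m + 1)" "pos i'" "y j'"] ij lev(1)[OF ij(2)]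
      by (simp add: a_def sum.reindex level_kernel_def)
  qed (use B in auto)
  also have "det_on ?A ?K = level_det m x {1..m+1} (\<lambda>_. m + 1) y"
    by (subst det_on_reindex) (auto simp: level_det_def)
  also have "det_on ?B (\<lambda>i j. ?K i j - (\<Sum>k\<in>?A. a i k * ?K k j)) = level_det (m + 1) y B lev pos"
  proof (subst det_on_reindex)
    show "det_on B (\<lambda>i j. ?K (Inr i) (Inr j) - (\<Sum>k\<in>?A. a (Inr i) k * ?K k (Inr j))) = level_det (m + 1) y B lev pos"
      unfolding level_det_def
    proof (intro det_on_cong refl)
      fix i j assume ij: "i \<in> B" "j \<in> B"
      show "?K (Inr i) (Inr j) - (\<Sum>k\<in>?A. a (Inr i) k * ?K k (Inr j)) = level_kernel (m + 1) y (lev i, pos i) (lev j, pos j)"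
        using rising_kernel_Schur[OF y, of x "lev i - (m + 1)" "lev j - (m + 1) - 1" "pos i" "pos j"]
          lev(1)[OF ij(1)] lev(2)[OF ij(2)]
        by (simp add: a_def sum.reindex level_kernel_def)
    qed
  qed (use B in auto)
  finally show ?thesis .
qed

lemma level_kernel_cell:
  assumes "x \<in> Conf0 m" "i \<in> {1..m+1}" "v \<in> cell m x i" "v' \<in> cell m x i" "fst p > m"
  shows "level_kernel m x p (m + 1, v) = level_kernel m x p (m + 1, v')"
proof -
  have "fst p - m = Suc (fst p - m - 1)" using assms(5) by simp
  then show ?thesis using rising_kernel_cell[OF assms(1-4), of "fst p - m - 1" "snd p"]
    by (simp add: level_kernel_def)
qed

text \<open>Integrating one point of level \<open>m + 1\<close> over a cell that contains none of the others: its column is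
  constant on the cell, and its row integrates to a unit vector.\<close>
lemma integrate_row:
  fixes lev :: "'i \<Rightarrow> nat"
  assumes x: "x \<in> Conf0 m" and c: "c \<in> {1..m+1}" and U: "finite U" "i0 \<notin> U"
    and lev: "\<And>i. i \<in> U \<Longrightarrow> lev i > m" "lev i0 = m + 1"
    and off: "\<And>i. i \<in> U \<Longrightarrow> lev i = m + 1 \<Longrightarrow> pos i \<notin> cell m x c"
  shows "set_integrable lborel (cell m x c) (\<lambda>w. level_det m x (insert i0 U) lev (pos(i0 := w)))"
    and "(LINT w:cell m x c|lborel. level_det m x (insert i0 U) lev (pos(i0 := w))) = level_det m x U lev pos"
proof -
  \<comment> \<open>Column \<open>i0\<close> is frozen at one point of the cell, which changes
    nothing by constancy. Afterwards \<open>w\<close> occurs in row \<open>i0\<close> only.\<close>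
  define w0 where "w0 = (SOME w. w \<in> cell m x c)"
  have w0: "w0 \<in> cell m x c" if "w \<in> cell m x c" for w using that unfolding w0_def by (rule someI)
  define q where "q = (\<lambda>i. (lev i, (pos(i0 := w0)) i))"
  define P where "P = (\<lambda>\<pi>. \<Prod>i\<in>U. level_kernel m x (q i) (q (\<pi> i)))"
  define R where "R = (\<lambda>\<pi> w. level_kernel m x (m + 1, w) (q (\<pi> i0)))"
  have det: "level_det m x (insert i0 U) lev (pos(i0 := w)) =
     (\<Sum>\<pi> | \<pi> permutes insert i0 U. of_int (sign \<pi>) * (R \<pi> w * P \<pi>))" if w: "w \<in> cell m x c" for w
    unfolding level_det_def det_on_insert[OF U] P_def R_def
  proof (intro sum.cong refl arg_cong2[where f="(*)"] prod.cong)
    have col: "level_kernel m x p (m + 1, w) = level_kernel m x p (m + 1, w0)" if "fst p > m" for p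
      by (rule level_kernel_cell[OF x c w w0[OF w] that])
    fix \<pi> assume "\<pi> \<in> {\<pi>. \<pi> permutes insert i0 U}"
    show "level_kernel m x (lev i0, (pos(i0 := w)) i0) (lev (\<pi> i0), (pos(i0 := w)) (\<pi> i0)) =
       level_kernel m x (m + 1, w) (q (\<pi> i0))"
      using col[of "(m + 1, w)"] by (auto simp: q_def lev)
    fix i assume "i \<in> U"
    then show "level_kernel m x (lev i, (pos(i0 := w)) i) (lev (\<pi> i), (pos(i0 := w)) (\<pi> i)) =
       level_kernel m x (q i) (q (\<pi> i))"
      using col[of "(lev i, pos i)"] U(2) by (auto simp: q_def lev)
  qed
  have R: "set_integrable lborel (cell m x c) (R \<pi>)" 
    and RI: "(LINT w:cell m x c|lborel. R \<pi> w) = of_bool (\<pi> i0 = i0)" if \<pi>: "\<pi> permutes insert i0 U" for \<pi>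
  proof -
    have R_eq: "R \<pi> w = rising_kernel m x (Suc 0) (lev (\<pi> i0) - m - 1) w (snd (q (\<pi> i0)))" for w
      by (simp add: R_def level_kernel_def q_def)
    show "set_integrable lborel (cell m x c) (R \<pi>)"
      unfolding set_integrable_def R_eq[abs_def]
      by (intro integrable_mult_indicator rising_kernel_integrable) simp
    have I: "(LINT w:cell m x c|lborel. R \<pi> w) = of_bool (lev (\<pi> i0) - m - 1 = 0 \<and> snd (q (\<pi> i0)) \<in> cell m x c)"
      unfolding R_eq by (rule integral_rising_kernel_cell[OF x c])
    show "(LINT w:cell m x c|lborel. R \<pi> w) = of_bool (\<pi> i0 = i0)"
    proof (cases "\<pi> i0 = i0")
      case True
      \<comment> \<open>A cell contains its left endpoint \<open>x c\<close>. The leftmost one has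
        none, but contains \<open>x m - 1\<close>, or 0 if \<open>m = 0\<close>.\<close>
      have "cell m x c \<noteq> {}"
      proof
        assume "cell m x c = {}"
        moreover have "(LINT w:cell m x c|lborel. rising_kernel m x (Suc 0) 0 w (x c)) = of_bool (x c \<in> cell m x c)"
          and "c \<le> m \<Longrightarrow> x c \<in> cell m x c"
          and "c = m + 1 \<Longrightarrow> (if m = 0 then 0 else x m - 1) \<in> cell m x c"
          using integral_rising_kernel_cell[OF x c, of 0 "x c"] Conf0_less[OF x, of "c - 1" c] c by (auto simp: cell_def)
        ultimately show False using c by (cases "c = m + 1") auto
      qed
      then have "w0 \<in> cell m x c" using w0 by blast
      then show ?thesis using True I by (simp add: q_def lev)
    next
      case False
      \<comment> \<open>The entry in the column of another point integrates to zero: either that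
        point is above level \<open>m + 1\<close>, so that the index \<open>l\<close> is positive,
        or it is on this level and outside the cell.\<close>
      then have "\<pi> i0 \<in> U" using \<pi> by (metis insertE insertI1 permutes_in_image)
      then have "lev (\<pi> i0) > m" "lev (\<pi> i0) = m + 1 \<Longrightarrow> snd (q (\<pi> i0)) \<notin> cell m x c"
        using lev off False by (auto simp: q_def)
      then show ?thesis using I False by (cases "lev (\<pi> i0) = m + 1") auto
    qed
  qed
  have RS: "integrable lborel (\<lambda>w. indicat_real (cell m x c) w *\<^sub>R (of_int (sign \<pi>) * (R \<pi> w * P \<pi>)))"
    if "\<pi> permutes insert i0 U" for \<pi>
    using integrable_mult_right[OF R[OF that, unfolded set_integrable_def], of "of_int (sign \<pi>) * P \<pi>"]
    by (simp add: mult_ac)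
  have int: "set_integrable lborel (cell m x c) (\<lambda>w. \<Sum>\<pi> | \<pi> permutes insert i0 U. of_int (sign \<pi>) * (R \<pi> w * P \<pi>))"
    unfolding set_integrable_def scaleR_sum_right
    using RS by (intro Bochner_Integration.integrable_sum) simp
  then show "set_integrable lborel (cell m x c) (\<lambda>w. level_det m x (insert i0 U) lev (pos(i0 := w)))"
    by (rule set_integrable_cong[THEN iffD1, rotated -1]) (auto simp: det)
  have "(LINT w:cell m x c|lborel. level_det m x (insert i0 U) lev (pos(i0 := w))) =
    (LINT w:cell m x c|lborel. \<Sum>\<pi> | \<pi> permutes insert i0 U. of_int (sign \<pi>) * (R \<pi> w * P \<pi>))"
    by (intro set_lebesgue_integral_cong) (auto simp: det)
  also have "\<dots> = (\<Sum>\<pi> | \<pi> permutes insert i0 U. of_int (sign \<pi>) * (of_bool (\<pi> i0 = i0) * P \<pi>))"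
    unfolding set_lebesgue_integral_def scaleR_sum_right
  proof (subst Bochner_Integration.integral_sum)
    show "(\<Sum>\<pi> | \<pi> permutes insert i0 U. LBINT w. indicat_real (cell m x c) w *\<^sub>R (of_int (sign \<pi>) * (R \<pi> w * P \<pi>))) =
       (\<Sum>\<pi> | \<pi> permutes insert i0 U. of_int (sign \<pi>) * (of_bool (\<pi> i0 = i0) * P \<pi>))"
    proof (intro sum.cong refl)
      fix \<pi> assume "\<pi> \<in> {\<pi>. \<pi> permutes insert i0 U}"
      then have "(LBINT w. indicat_real (cell m x c) w * R \<pi> w) = of_bool (\<pi> i0 = i0)"
        using RI[of \<pi>] by (simp add: set_lebesgue_integral_def)
      moreover have "(\<lambda>w. indicat_real (cell m x c) w *\<^sub>R (of_int (sign \<pi>) * (R \<pi> w * P \<pi>))) =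
         (\<lambda>w. (of_int (sign \<pi>) * P \<pi>) * (indicat_real (cell m x c) w * R \<pi> w))" by auto
      ultimately show "(LBINT w. indicat_real (cell m x c) w *\<^sub>R (of_int (sign \<pi>) * (R \<pi> w * P \<pi>))) =
         of_int (sign \<pi>) * (of_bool (\<pi> i0 = i0) * P \<pi>)" by simp
    qed
  qed (use RS in auto)
  also have "\<dots> = level_det m x U lev pos"
    unfolding P_def sum_fixed_permutes[OF U, of "\<lambda>i j. level_kernel m x (q i) (q j)"] level_det_def using U(2)
    by (intro det_on_cong) (auto simp: q_def)
  finally show "(LINT w:cell m x c|lborel. level_det m x (insert i0 U) lev (pos(i0 := w))) = level_det m x U lev pos" .
qed


subsection \<open>Integrating out points of the first level\<close>

interpretation lborel_product: product_sigma_finite "\<lambda>_::nat. lborel :: real measure"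
  by standard

text \<open>\<open>R\<close> is the set of the points of level \<open>m + 1\<close> that have been integrated out.\<close>
definition block_det ::
    "nat \<Rightarrow> (nat \<Rightarrow> real) \<Rightarrow> nat set \<Rightarrow> (nat \<Rightarrow> nat) \<Rightarrow> (nat \<Rightarrow> real) \<Rightarrow> nat set \<Rightarrow> (nat \<Rightarrow> real) \<Rightarrow> real" where
  "block_det m x B lev pos R y =
     level_det m x (Inl ` ({1..m+1} - R) \<union> Inr ` B) (case_sum (\<lambda>_. m + 1) lev) (case_sum y pos)"

lemma block_det_cong:
  assumes "\<And>i. i \<in> {1..m+1} - R \<Longrightarrow> y i = y' i"
  shows "block_det m x B lev pos R y = block_det m x B lev pos R y'"
  unfolding block_det_def using assms by (intro level_det_cong) auto

lemma block_det_measurable: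
  assumes "\<And>i. i \<in> {1..m+1} - R \<Longrightarrow> (\<lambda>\<omega>. y \<omega> i) \<in> borel_measurable N"
    "\<And>i. i \<in> B \<Longrightarrow> (\<lambda>\<omega>. pos \<omega> i) \<in> borel_measurable N"
  shows "(\<lambda>\<omega>. block_det m x B lev (pos \<omega>) R (y \<omega>)) \<in> borel_measurable N"
  unfolding block_det_def using assms by (intro level_det_measurable) auto

lemma in_cells_measurable:
  assumes "finite S" and [measurable]: "\<And>i. i \<in> S \<Longrightarrow> (\<lambda>\<omega>. y \<omega> i) \<in> borel_measurable N"
  shows "Measurable.pred N (\<lambda>\<omega>. in_cells m x S (y \<omega>))"
  unfolding in_cells_def
  by (rule pred_intros_finite[OF assms(1)]) measurable

context
  fixes m :: nat and x :: "nat \<Rightarrow> real" and B :: "nat set" and lev :: "nat \<Rightarrow> nat" and pos :: "nat \<Rightarrow> real"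
  assumes x: "x \<in> Conf0 m" and B: "finite B" "\<And>i. i \<in> B \<Longrightarrow> lev i > m + 1"
begin

lemma block_det_integrate:
  assumes R: "i \<in> {1..m+1} - R" and y: "in_cells m x ({1..m+1} - insert i R) y"
  shows "set_integrable lborel (cell m x i) (\<lambda>w. block_det m x B lev pos R (y(i := w)))"
    and "(LINT w:cell m x i|lborel. block_det m x B lev pos R (y(i := w))) = block_det m x B lev pos (insert i R) y"
proof -
  let ?U = "Inl ` ({1..m+1} - insert i R) \<union> Inr ` B :: (nat + nat) set"
  have U: "insert (Inl i) ?U = Inl ` ({1..m+1} - R) \<union> Inr ` B" using R by auto
  have pos: "(case_sum y pos)(Inl i := w) = case_sum (y(i := w)) pos" for w
    by (auto simp: fun_eq_iff split: sum.split)
  \<comment> \<open>Each remaining point of the level sits in its own cell, and cells are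
    disjoint.\<close>
  have off: "case_sum y pos a \<notin> cell m x i" if a: "a \<in> ?U" "case_sum (\<lambda>_. m + 1) lev a = m + 1" for a
  proof -
    obtain j where j: "a = Inl j" "j \<in> {1..m+1}" "j \<noteq> i" "j \<notin> R"
      using a B(2) by fastforce
    then have "y j \<in> cell m x j" using y by (auto simp: in_cells_def)
    then show ?thesis using cell_unique[OF x, of "y j" j i] j R by auto
  qed
  have lev: "case_sum (\<lambda>_. m + 1) lev a > m" if "a \<in> ?U" for a using that B(2) by fastforce
  have i: "i \<in> {1..m+1}" using R by simp
  have fin: "finite ?U" "Inl i \<notin> ?U" using B by auto
  note row = integrate_row[OF x i fin, where lev = "case_sum (\<lambda>_. m + 1) lev" and pos = "case_sum y pos", unfolded U pos]
  show "set_integrable lborel (cell m x i) (\<lambda>w. block_det m x B lev pos R (y(i := w)))"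
    unfolding block_det_def by (rule row(1)) (use lev off in auto)
  show "(LINT w:cell m x i|lborel. block_det m x B lev pos R (y(i := w))) = block_det m x B lev pos (insert i R) y"
    unfolding block_det_def by (rule row(2)) (use lev off in auto)
qed

text \<open>The sign \<open>s\<close> is needed to find out that the constant in \<open>first_block_vandermonde\<close> is positive.\<close>
context
  fixes s :: real
  assumes s: "\<And>y. in_cells m x {1..m+1} y \<Longrightarrow> 0 \<le> s * block_det m x B lev pos {} y"
begin

text \<open>Marginals inherit the sign, since removing a point amounts to integrating over its
  cell.\<close>

lemma signed_block_det_nonneg:
  assumes "R \<subseteq> {1..m+1}" "in_cells m x ({1..m+1} - R) y"
  shows "0 \<le> s * block_det m x B lev pos R y"
proof -
  have "finite R" using assms(1) finite_subset by blast
  then show ?thesis using assms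
  proof (induction R arbitrary: y rule: finite_induct)
    case (insert i R)
    have i: "i \<in> {1..m+1} - R" using insert by auto
    have "0 \<le> s * block_det m x B lev pos R (y(i := w))" if "w \<in> cell m x i" for w
      using insert.prems that by (intro insert.IH) (auto simp: in_cells_def)
    then have "0 \<le> (LINT w:cell m x i|lborel. s * block_det m x B lev pos R (y(i := w)))"
      unfolding set_lebesgue_integral_def
      by (intro Bochner_Integration.integral_nonneg) (auto simp: indicator_def)
    then show ?case using block_det_integrate(2)[OF i insert.prems(2)] by simp
  qed (use s in simp)
qed

text \<open>Iterates \<open>block_det_integrate\<close> by Fubini. The sign of the intermediate
  determinants turns each Bochner integral over a cell into an \<open>ennreal\<close>
  integral.\<close>

lemma signed_block_det_nn_integral:
  assumes "R \<subseteq> {1..m+1}" "in_cells m x ({1..m+1} - R) y"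
  shows "(\<integral>\<^sup>+r. of_bool (in_cells m x R r) * ennreal (s * block_det m x B lev pos {} (override_on y r R)) \<partial>PiM R (\<lambda>_. lborel))
    = ennreal (s * block_det m x B lev pos R y)"
proof -
  have "finite R" using assms(1) finite_subset by blast
  then show ?thesis using assms
  proof (induction R arbitrary: y rule: finite_induct)
    case empty
    then show ?case
      by (subst lborel_product.nn_integral_empty) (auto simp: in_cells_def override_on_def)
  next
    case (insert i R)
    have i: "i \<in> {1..m+1} - R" using insert by auto
    let ?f = "\<lambda>r. of_bool (in_cells m x (insert i R) r) * ennreal (s * block_det m x B lev pos {} (override_on y r (insert i R)))"
    have meas: "?f \<in> borel_measurable (PiM (insert i R) (\<lambda>_. lborel))"
    proof -
      have [measurable]: "Measurable.pred (PiM (insert i R) (\<lambda>_. lborel)) (in_cells m x (insert i R))"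
        using insert.hyps by (intro in_cells_measurable) auto
      have [measurable]: "(\<lambda>r. block_det m x B lev pos {} (override_on y r (insert i R))) \<in> borel_measurable (PiM (insert i R) (\<lambda>_. lborel))"
      proof (rule block_det_measurable)
        fix j show "(\<lambda>r. override_on y r (insert i R) j) \<in> borel_measurable (PiM (insert i R) (\<lambda>_. lborel))"
          by (cases "j \<in> insert i R") (auto simp: override_on_def)
      qed simp
      show ?thesis by (simp add: of_bool_def)
    qed
    have "(\<integral>\<^sup>+r. ?f r \<partial>PiM (insert i R) (\<lambda>_. lborel)) =
      (\<integral>\<^sup>+w. \<integral>\<^sup>+r. ?f (r(i := w)) \<partial>PiM R (\<lambda>_. lborel) \<partial>lborel)"
      by (rule lborel_product.product_nn_integral_insert_rev[OF insert.hyps meas])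
    also have "\<dots> = (\<integral>\<^sup>+w. ennreal (indicator (cell m x i) w *\<^sub>R (s * block_det m x B lev pos R (y(i := w)))) \<partial>lborel)"
    proof (intro nn_integral_cong)
      fix w :: real
      show "(\<integral>\<^sup>+r. ?f (r(i := w)) \<partial>PiM R (\<lambda>_. lborel)) = ennreal (indicator (cell m x i) w *\<^sub>R (s * block_det m x B lev pos R (y(i := w))))"
      proof (cases "w \<in> cell m x i")
        case True
        have "(\<integral>\<^sup>+r. ?f (r(i := w)) \<partial>PiM R (\<lambda>_. lborel)) =
          (\<integral>\<^sup>+r. of_bool (in_cells m x R r) * ennreal (s * block_det m x B lev pos {} (override_on (y(i := w)) r R)) \<partial>PiM R (\<lambda>_. lborel))"
        proof (intro nn_integral_cong arg_cong2[where f="(*)"] arg_cong[where f=ennreal] refl)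
          fix r
          show "of_bool (in_cells m x (insert i R) (r(i := w))) = (of_bool (in_cells m x R r) :: ennreal)"
            using insert.hyps True by (auto simp: in_cells_def of_bool_def)
          show "block_det m x B lev pos {} (override_on y (r(i := w)) (insert i R)) = block_det m x B lev pos {} (override_on (y(i := w)) r R)"
            using insert.hyps by (intro block_det_cong) (auto simp: override_on_def)
        qed
        also have "\<dots> = ennreal (s * block_det m x B lev pos R (y(i := w)))"
          using insert.prems True by (intro insert.IH) (auto simp: in_cells_def)
        finally show ?thesis using True by simp
      next
        case False
        then show ?thesis by (simp add: in_cells_def)
      qed
    qed
    also have "\<dots> = ennreal (LINT w:cell m x i|lborel. s * block_det m x B lev pos R (y(i := w)))"
      unfolding set_lebesgue_integral_def
    proof (rule nn_integral_eq_integral)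
      show "integrable lborel (\<lambda>w. indicat_real (cell m x i) w *\<^sub>R (s * block_det m x B lev pos R (y(i := w))))"
        using integrable_mult_right[OF block_det_integrate(1)[OF i insert.prems(2), unfolded set_integrable_def], of s]
        by (simp add: mult_ac)
      have "0 \<le> s * block_det m x B lev pos R (y(i := w))" if "w \<in> cell m x i" for w
        using insert.prems that by (intro signed_block_det_nonneg) (auto simp: in_cells_def)
      then show "AE w in lborel. 0 \<le> indicat_real (cell m x i) w *\<^sub>R (s * block_det m x B lev pos R (y(i := w)))"
        by (auto simp: indicator_def)
    qed
    also have "\<dots> = ennreal (s * block_det m x B lev pos (insert i R) y)"
      using block_det_integrate(2)[OF i insert.prems(2)] by simp
    finally show ?case .
  qed
qed

end

end

lemma block_det_all: "block_det m x {} lev pos {1..m+1} y = 1"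
  by (simp add: block_det_def level_det_def)

lemma block_det_empty: "block_det m x {} lev pos {} y = level_det m x {1..m+1} (\<lambda>_. m + 1) y"
  unfolding block_det_def using level_det_reindex[of "{1..m+1}" Inl m x "case_sum (\<lambda>_. m + 1) lev" "case_sum y pos"]
  by (simp add: o_def)

lemma in_cells_vandermonde_pos:
  assumes "x \<in> Conf0 m" "in_cells m x {1..m+1} y"
  shows "vandermonde (m + 1) y * (\<Prod>i\<in>{1..m+1}. gauss (y i)) > 0"
  using in_cells_decreasing[OF assms] gauss_pos by (intro mult_pos_pos vandermonde_pos prod_pos) auto

text \<open>On the cells the determinant is \<open>C\<close> times a positive function. Multiplied
  by the sign \<open>s\<close> of \<open>C\<close>, it stays nonnegative when all points are
  integrated out, and the result is \<open>s * 1\<close>; so \<open>s\<close> is not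
  negative.\<close>

lemma first_block_nonneg:
  assumes x: "x \<in> Conf0 m" and y: "in_cells m x {1..m+1} y"
  shows "0 \<le> level_det m x {1..m+1} (\<lambda>_. m + 1) y"
proof -
  obtain C where C: "\<And>y. in_cells m x {1..m+1} y \<Longrightarrow>
    level_det m x {1..m+1} (\<lambda>_. m + 1) y = C * (vandermonde (m + 1) y * (\<Prod>i\<in>{1..m+1}. gauss (y i)))"
    using first_block_vandermonde[OF x] by blast
  define s :: real where "s = (if C \<ge> 0 then 1 else - 1)"
  have "0 \<le> s * block_det m x {} undefined undefined {1..m+1} y"
  proof (rule signed_block_det_nonneg[OF x])
    fix y assume y: "in_cells m x {1..m+1} y"
    show "0 \<le> s * block_det m x {} undefined undefined {} y"
      unfolding block_det_empty C[OF y] using in_cells_vandermonde_pos[OF x y]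
      by (auto simp: s_def intro: mult_nonneg_nonneg mult_nonpos_nonneg)
  qed (auto simp: in_cells_def)
  then have "C \<ge> 0" unfolding block_det_all by (auto simp: s_def split: if_splits)
  then show ?thesis unfolding C[OF y] using in_cells_vandermonde_pos[OF x y] by auto
qed

lemma first_block_nn_integral:
  assumes x: "x \<in> Conf0 m"
  shows "(\<integral>\<^sup>+y. of_bool (in_cells m x {1..m+1} y) * ennreal (level_det m x {1..m+1} (\<lambda>_. m + 1) y)
    \<partial>PiM {1..m+1} (\<lambda>_. lborel)) = 1"
proof -
  have "(\<integral>\<^sup>+r. of_bool (in_cells m x {1..m+1} r) * ennreal (1 * block_det m x {} undefined undefined {} (override_on undefined r {1..m+1})) \<partial>PiM {1..m+1} (\<lambda>_. lborel))
    = ennreal (1 * block_det m x {} undefined undefined {1..m+1} undefined)"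
  proof (rule signed_block_det_nn_integral[OF x])
    fix y assume "in_cells m x {1..m+1} y"
    then show "0 \<le> 1 * block_det m x {} undefined undefined {} y"
      using first_block_nonneg[OF x] unfolding block_det_empty by simp
  qed (auto simp: in_cells_def)
  also have "(\<lambda>r. block_det m x {} undefined undefined {} (override_on undefined r {1..m+1})) =
    (\<lambda>r. level_det m x {1..m+1} (\<lambda>_. m + 1) r)"
    unfolding block_det_empty by (intro ext level_det_cong) (auto simp: override_on_def)
  finally show ?thesis unfolding block_det_all by simp
qed

subsection \<open>Positivity of the determinants\<close>

text \<open>Columns of level \<open>m + 1\<close> depend on the cell only, so two of them
  coincide.\<close>

lemma level_det_same_cell:
  assumes x: "x \<in> Conf0 m" and I: "finite I" "\<And>i. i \<in> I \<Longrightarrow> lev i > m"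
    and ij: "i \<in> I" "j \<in> I" "i \<noteq> j" "lev i = m + 1" "lev j = m + 1"
    and c: "c \<in> {1..m+1}" "pos i \<in> cell m x c" "pos j \<in> cell m x c"
  shows "level_det m x I lev pos = 0"
  unfolding level_det_def
proof (rule det_on_identical_columns[OF I(1) ij(1-3)])
  fix k assume "k \<in> I"
  then show "level_kernel m x (lev k, pos k) (lev i, pos i) = level_kernel m x (lev k, pos k) (lev j, pos j)"
    using level_kernel_cell[OF x c, of "(lev k, pos k)"] ij I(2) by simp
qed

text \<open>Points of level \<open>m + 1\<close> with distinct labels become entries of a full level
  whose other entries have been integrated out. With the cells as labels, this brings arbitrary
  points within reach of \<open>signed_block_det_nonneg\<close>.\<close>

lemma level_det_block_det:
  assumes J: "finite J" "finite B" "J \<inter> B = {}" and \<sigma>: "\<sigma> \<in> J \<rightarrow> {1..m+1}" "inj_on \<sigma> J"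
    and lev: "\<And>j. j \<in> J \<Longrightarrow> lev j = m + 1" and y: "\<And>j. j \<in> J \<Longrightarrow> y (\<sigma> j) = pos j"
  shows "level_det m x (J \<union> B) lev pos = block_det m x B lev pos ({1..m+1} - \<sigma> ` J) y"
proof -
  define f :: "nat \<Rightarrow> nat + nat" where "f = (\<lambda>i. if i \<in> J then Inl (\<sigma> i) else Inr i)"
  have inj: "inj_on f (J \<union> B)"
    using \<sigma>(2) by (auto simp: inj_on_def f_def split: if_splits)
  have "Inl ` ({1..m+1} - ({1..m+1} - \<sigma> ` J)) \<union> Inr ` B = f ` (J \<union> B)"
    using \<sigma>(1) J(3) by (auto simp: f_def image_iff)
  then have "block_det m x B lev pos ({1..m+1} - \<sigma> ` J) y =
    level_det m x (J \<union> B) (case_sum (\<lambda>_. m + 1) lev \<circ> f) (case_sum y pos \<circ> f)"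
    unfolding block_det_def using level_det_reindex[OF _ inj] J by simp
  also have "\<dots> = level_det m x (J \<union> B) lev pos"
    by (intro level_det_cong) (auto simp: f_def lev y)
  finally show ?thesis ..
qed

text \<open>Elements of \<open>Conf0\<close> are extensional, hence \<open>restrict\<close>; the
  determinant sees \<open>y\<close> only at the indices up to \<open>m + 1\<close>.\<close>

lemma block_det_factor:
  assumes x: "x \<in> Conf0 m" and y: "in_cells m x {1..m+1} y"
    and B: "finite B" "\<And>i. i \<in> B \<Longrightarrow> lev i > m + 1"
  shows "block_det m x B lev pos {} y =
    level_det m x {1..m+1} (\<lambda>_. m + 1) y * level_det (m + 1) (restrict y {1..m+1}) B lev pos"
proof -
  have "inj_on (restrict y {1..m+1}) {1..m+1}"
    using Conf0_inj_on[OF in_cells_Conf0[OF x y]] .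
  then have "inj_on y {1..m+1}" by (simp add: inj_on_def)
  moreover have "level_det (m + 1) y B lev pos = level_det (m + 1) (restrict y {1..m+1}) B lev pos"
    by (intro level_det_cong) auto
  ultimately show ?thesis unfolding block_det_def using level_det_first_block[OF _ B] by simp
qed

text \<open>If two points of level \<open>m + 1\<close> share a cell, the determinant is zero.
  Otherwise it is a marginal of a full level, which factors into the first block and a determinant
  started one level higher. The induction is on the distance of the starting level from a bound
  \<open>N\<close> for the levels.\<close>

lemma level_det_nonneg:
  assumes "x \<in> Conf0 m" "finite I" "\<And>i. i \<in> I \<Longrightarrow> lev i > m"
  shows "0 \<le> level_det m x I lev (pos :: nat \<Rightarrow> real)"
proof -
  obtain N where "\<And>i. i \<in> I \<Longrightarrow> lev i \<le> N"
    using assms(2) by (metis finite_imageI finite_nat_set_iff_bounded_le imageI)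
  then show ?thesis using assms
  proof (induction "N - m" arbitrary: m x I)
    case 0
    have "False" if "i \<in> I" for i using "0.prems"(1)[OF that] "0.prems"(4)[OF that] "0.hyps" by simp
    then have "I = {}" by blast
    then show ?case by (simp add: level_det_def)
  next
    case (Suc n)
    note x = Suc.prems(2) and fin = Suc.prems(3) and lev = Suc.prems(4)
    define J B where "J = {i\<in>I. lev i = m + 1}" and "B = I - J"
    have JB: "finite J" "finite B" "J \<inter> B = {}" "J \<union> B = I" using fin by (auto simp: J_def B_def)
    have levB: "lev i > m + 1" if "i \<in> B" for i using lev[of i] that by (auto simp: J_def B_def)
    define \<sigma> where "\<sigma> = (\<lambda>i. SOME c. c \<in> {1..m+1} \<and> pos i \<in> cell m x c)"
    have "\<exists>c. c \<in> {1..m+1} \<and> pos i \<in> cell m x c" for i using cell_exists[OF x] by metis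
    then have \<sigma>: "\<sigma> i \<in> {1..m+1} \<and> pos i \<in> cell m x (\<sigma> i)" for i
      unfolding \<sigma>_def by (rule someI_ex)
    show ?case
    proof (cases "inj_on \<sigma> J")
      case False
      then obtain i j where "i \<in> J" "j \<in> J" "i \<noteq> j" "\<sigma> i = \<sigma> j" by (auto simp: inj_on_def)
      then have "level_det m x I lev pos = 0"
        using \<sigma>[of i] \<sigma>[of j] fin lev
        by (intro level_det_same_cell[OF x fin, of lev i j "\<sigma> i"]) (auto simp: J_def)
      then show ?thesis by simp
    next
      case True
      define y where "y = (\<lambda>c. pos (inv_into J \<sigma> c))"
      have y: "y (\<sigma> j) = pos j" if "j \<in> J" for j using True that by (simp add: y_def)
      have "0 \<le> 1 * block_det m x B lev pos ({1..m+1} - \<sigma> ` J) y"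
      proof (rule signed_block_det_nonneg[OF x JB(2) levB])
        fix y assume y: "in_cells m x {1..m+1} y"
        have "0 \<le> level_det (m + 1) (restrict y {1..m+1}) B lev pos"
        proof (rule Suc.hyps(1))
          show "n = N - (m + 1)" using Suc.hyps(2) by simp
          show "restrict y {1..m+1} \<in> Conf0 (m + 1)" by (rule in_cells_Conf0[OF x y])
          show "finite B" by (rule JB(2))
          fix i assume "i \<in> B"
          then show "lev i \<le> N" "m + 1 < lev i" using Suc.prems(1) levB by (auto simp: B_def)
        qed
        then show "0 \<le> 1 * block_det m x B lev pos {} y"
          using block_det_factor[OF x y JB(2) levB] first_block_nonneg[OF x y] by simp
      next
        have "{1..m+1} - ({1..m+1} - \<sigma> ` J) = \<sigma> ` J" using \<sigma> by auto
        then show "in_cells m x ({1..m+1} - ({1..m+1} - \<sigma> ` J)) y"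
          using \<sigma> y by (auto simp: in_cells_def)
      qed auto
      moreover have "level_det m x (J \<union> B) lev pos = block_det m x B lev pos ({1..m+1} - \<sigma> ` J) y"
      proof (rule level_det_block_det[OF JB(1-3) _ True])
        show "\<sigma> \<in> J \<rightarrow> {1..m+1}" using \<sigma> by blast
      qed (use y in \<open>auto simp: J_def\<close>)
      ultimately show ?thesis unfolding JB(4) by simp
    qed
  qed
qed


subsection \<open>One step of the process\<close>

lemma component_lborel_measurable [measurable (raw)]:
  "i \<in> I \<Longrightarrow> (\<lambda>y. y i) \<in> borel_measurable (PiM I (\<lambda>_. lborel))"
  using measurable_component_singleton[of i I "\<lambda>_. lborel"] by simp

lemma Conf0_sets: "Conf0 n \<in> sets (PiM {1..n} (\<lambda>_. lborel))"
proof -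
  have "Measurable.pred (PiM {1..n} (\<lambda>_. lborel)) (\<lambda>y. \<forall>i\<in>{1..n}. \<forall>j\<in>{1..n}. i < j \<longrightarrow> y i > (y j :: real))"
    by (intro pred_intros_finite pred_intros_logic) auto
  then have "{y\<in>space (PiM {1..n} (\<lambda>_. lborel)). \<forall>i\<in>{1..n}. \<forall>j\<in>{1..n}. i < j \<longrightarrow> y i > (y j :: real)} \<in> sets (PiM {1..n} (\<lambda>_. lborel))"
    by measurable
  also have "{y\<in>space (PiM {1..n} (\<lambda>_. lborel)). \<forall>i\<in>{1..n}. \<forall>j\<in>{1..n}. i < j \<longrightarrow> y i > (y j :: real)} = Conf0 n"
    by (auto simp: Conf0_def space_PiM)
  finally show ?thesis .
qed

lemma space_conf_lborel [simp]: "space (conf_lborel n) = Conf0 n"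
  using sets.sets_into_space[OF Conf0_sets[of n]] by (auto simp: conf_lborel_def space_restrict_space)

lemma nn_integral_conf_lborel:
  "(\<integral>\<^sup>+y. f y \<partial>conf_lborel n) = (\<integral>\<^sup>+y. f y * indicator (Conf0 n) y \<partial>PiM {1..n} (\<lambda>_. lborel))"
  unfolding conf_lborel_def using Conf0_sets[of n] sets.sets_into_space[OF Conf0_sets[of n]]
  by (intro nn_integral_restrict_space) (simp add: Int_absorb2)

lemma conf_component_measurable [measurable (raw)]:
  "i \<in> {1..n} \<Longrightarrow> (\<lambda>y. y i) \<in> borel_measurable (conf_lborel n)"
  unfolding conf_lborel_def by (intro measurable_restrict_space1) measurable

text \<open>The closed inequalities of \<open>interlacing\<close> admit the right endpoints that the
  cells omit; only these have to be excluded.\<close>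

lemma interlacing_in_cells:
  assumes y: "interlacing m x y" and ne: "\<And>i. i \<in> {2..m+1} \<Longrightarrow> y i \<noteq> x (i - 1)"
  shows "in_cells m x {1..m+1} y"
  unfolding in_cells_def cell_def
proof (clarsimp, intro conjI impI)
  fix i assume i: "Suc 0 \<le> i" "i \<le> Suc m"
  show "x i \<le> y i" if "i \<le> m" using y i that by (auto simp: interlacing_def)
  assume "2 \<le> i"
  then have "i - 1 \<in> {1..m}" and Suc: "i - 1 + 1 = i" using i by auto
  then have "y i \<le> x (i - 1)" using y[unfolded interlacing_def, THEN bspec, of "i - 1"] unfolding Suc by simp
  moreover have "y i \<noteq> x (i - 1)" using ne[of i] i \<open>2 \<le> i\<close> by simp
  ultimately show "y i < x (i - Suc 0)" by simp
qed

lemma AE_component_neq: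
  assumes "finite I" "i \<in> I"
  shows "AE y in PiM I (\<lambda>_::nat. lborel). y i \<noteq> (c::real)"
proof (rule AE_I)
  let ?A = "PiE I (\<lambda>j. if j = i then {c} else UNIV)"
  show "{y \<in> space (PiM I (\<lambda>_. lborel)). \<not> y i \<noteq> c} \<subseteq> ?A"
    by (auto simp: space_PiM PiE_def Pi_def)
  have "emeasure (PiM I (\<lambda>_. lborel)) ?A = (\<Prod>j\<in>I. emeasure lborel (if j = i then {c} else UNIV))"
    using assms by (intro lborel_product.emeasure_PiM) auto
  also have "\<dots> = 0" using assms by (auto intro!: prod_zero bexI[of _ i])
  finally show "emeasure (PiM I (\<lambda>_. lborel)) ?A = 0" .
  show "?A \<in> sets (PiM I (\<lambda>_. lborel))" using assms by (intro sets_PiM_I_finite) auto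
qed

lemma AE_in_cells:
  assumes x: "x \<in> Conf0 m"
  shows "AE y in PiM {1..m+1} (\<lambda>_. lborel). y \<in> Conf0 (m + 1) \<and> interlacing m x y \<longleftrightarrow> in_cells m x {1..m+1} y"
proof -
  have "AE y in PiM {1..m+1} (\<lambda>_. lborel). \<forall>i\<in>{2..m+1}. y i \<noteq> x (i - 1)"
    by (intro AE_finite_allI AE_component_neq) auto
  with AE_space show ?thesis
  proof eventually_elim
    case (elim y)
    then have "restrict y {1..m+1} = y" by (auto simp: space_PiM PiE_def extensional_restrict)
    then show ?case
      using in_cells_interlacing[of m x y] in_cells_Conf0[OF x, of y] interlacing_in_cells[of m x y] elim(2) by auto
  qed
qed

text \<open>A condition on the starting point, not a theorem: along the process it is read off from
  the conditional law in \<open>AE_normalized\<close>.\<close>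

definition gue_normalized :: "nat \<Rightarrow> (nat \<Rightarrow> real) \<Rightarrow> bool" where
  "gue_normalized m x \<longleftrightarrow> (\<integral>\<^sup>+y. ennreal (gue_density m x y) \<partial>conf_lborel (m + 1)) = 1"

text \<open>Both sides are multiples of the same function on the product of the cells, and both have
  integral one.\<close>
lemma first_block_gue_density:
  assumes x: "x \<in> Conf0 m" and norm: "gue_normalized m x" and y: "in_cells m x {1..m+1} y"
  shows "level_det m x {1..m+1} (\<lambda>_. m + 1) y = gue_density m x y"
proof -
  define h where "h = (\<lambda>y. vandermonde (m + 1) y * (\<Prod>i\<in>{1..m+1}. gauss (y i)))"
  have h: "h y > 0" if "in_cells m x {1..m+1} y" for y
    using in_cells_vandermonde_pos[OF x that] by (simp add: h_def)
  obtain C where C: "\<And>y. in_cells m x {1..m+1} y \<Longrightarrow> level_det m x {1..m+1} (\<lambda>_. m + 1) y = C * h y"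
    using first_block_vandermonde[OF x] unfolding h_def by blast
  have C0: "C \<ge> 0" using first_block_nonneg[OF x y] h[OF y] unfolding C[OF y] by (simp add: zero_le_mult_iff)
  \<comment> \<open>The factors of the density that depend on \<open>x\<close> alone; on the cells
    interlacing holds, and the other factors form \<open>h\<close>.\<close>
  define C' where "C' = exp (\<Sum>k=1..m. (x k)\<^sup>2 / 2) / (sqrt (2 * pi) * vandermonde m x)"
  have C': "gue_density m x y = C' * h y" if "in_cells m x {1..m+1} y" for y
  proof -
    have "(\<Prod>i\<in>{1..m+1}. gauss (y i)) = exp (- (\<Sum>k=1..m+1. (y k)\<^sup>2 / 2))"
      by (simp add: gauss_def exp_sum sum_negf[symmetric] del: sum.cl_ivl_Suc prod.cl_ivl_Suc)
    then have "C' * h y = C' * (vandermonde (m + 1) y * exp (- (\<Sum>k=1..m+1. (y k)\<^sup>2 / 2)))"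
      unfolding h_def by (rule arg_cong)
    also have "\<dots> = gue_density m x y"
      unfolding gue_density_def exp_add C'_def using in_cells_interlacing[OF that]
      by (simp only: of_bool_eq simp_thms mult_1_right times_divide_eq_left times_divide_eq_right divide_divide_eq_left mult_ac mult_1)
    finally show ?thesis ..
  qed
  have "vandermonde m x > 0" using Conf0_less[OF x] by (intro vandermonde_pos) auto
  then have C'0: "C' > 0" by (simp add: C'_def)
  define Z where "Z = (\<integral>\<^sup>+y. of_bool (in_cells m x {1..m+1} y) * ennreal (h y) \<partial>PiM {1..m+1} (\<lambda>_. lborel))"
  have meas: "(\<lambda>y. of_bool (in_cells m x {1..m+1} y) * ennreal (h y)) \<in> borel_measurable (PiM {1..m+1} (\<lambda>_. lborel))"
  proof -
    have [measurable]: "Measurable.pred (PiM {1..m+1} (\<lambda>_. lborel)) (in_cells m x {1..m+1})"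
      by (intro in_cells_measurable) auto
    have [measurable]: "h \<in> borel_measurable (PiM {1..m+1} (\<lambda>_. lborel))"
      unfolding h_def vandermonde_def
      by (intro borel_measurable_times borel_measurable_prod borel_measurable_diff
          measurable_compose[OF _ gauss_measurable] component_lborel_measurable) auto
    show ?thesis unfolding of_bool_def by measurable
  qed
  have "1 = (\<integral>\<^sup>+y. of_bool (in_cells m x {1..m+1} y) * ennreal (level_det m x {1..m+1} (\<lambda>_. m + 1) y) \<partial>PiM {1..m+1} (\<lambda>_. lborel))"
    using first_block_nn_integral[OF x] ..
  also have "\<dots> = (\<integral>\<^sup>+y. ennreal C * (of_bool (in_cells m x {1..m+1} y) * ennreal (h y)) \<partial>PiM {1..m+1} (\<lambda>_. lborel))"
    using C C0 h by (intro nn_integral_cong) (auto simp: ennreal_mult less_imp_le)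
  also have "\<dots> = ennreal C * Z" unfolding Z_def by (rule nn_integral_cmult[OF meas])
  finally have 1: "ennreal C * Z = 1" ..
  have "1 = (\<integral>\<^sup>+y. ennreal (gue_density m x y) * indicator (Conf0 (m + 1)) y \<partial>PiM {1..m+1} (\<lambda>_. lborel))"
    using norm unfolding gue_normalized_def nn_integral_conf_lborel ..
  also have "\<dots> = (\<integral>\<^sup>+y. ennreal C' * (of_bool (in_cells m x {1..m+1} y) * ennreal (h y)) \<partial>PiM {1..m+1} (\<lambda>_. lborel))"
  proof (rule nn_integral_cong_AE)
    show "AE y in PiM {1..m+1} (\<lambda>_. lborel). ennreal (gue_density m x y) * indicator (Conf0 (m + 1)) y =
      ennreal C' * (of_bool (in_cells m x {1..m+1} y) * ennreal (h y))"
      using AE_in_cells[OF x]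
    proof eventually_elim
      case (elim y)
      show ?case
      proof (cases "in_cells m x {1..m+1} y")
        case True
        then show ?thesis using elim C'[OF True] C'0 h[OF True] by (simp add: ennreal_mult)
      next
        case False
        then have "gue_density m x y = 0 \<or> y \<notin> Conf0 (m + 1)" using elim by (auto simp: gue_density_def)
        then show ?thesis using False by auto
      qed
    qed
  qed
  also have "\<dots> = ennreal C' * Z" unfolding Z_def by (rule nn_integral_cmult[OF meas])
  finally have 2: "ennreal C' * Z = 1" ..
  \<comment> \<open>\<open>C' > 0\<close> and \<open>C' * Z = 1\<close> keep \<open>Z\<close>
    finite, so that the two products can be compared in the reals.\<close>
  have "Z \<noteq> \<infinity>" using 2 C'0 by (auto simp: ennreal_mult_top split: if_splits)
  then obtain z where z: "Z = ennreal z" "z \<ge> 0" by (cases Z) auto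
  have "C * z = 1" "C' * z = 1" using 1 2 z C0 C'0
    by (simp_all add: ennreal_mult[symmetric])
  then have "C = C'" by (metis mult_cancel_right zero_neq_one mult_zero_right)
  then show ?thesis using C[OF y] C'[OF y] by simp
qed

text \<open>Relabelling the coordinates preserves the measure of every box.\<close>

lemma nn_integral_PiM_reindex:
  fixes \<sigma> :: "nat \<Rightarrow> nat"
  assumes J: "finite J" "inj_on \<sigma> J" and h: "h \<in> borel_measurable (PiM J (\<lambda>_. lborel))"
  shows "(\<integral>\<^sup>+u. h (\<lambda>j\<in>J. u (\<sigma> j)) \<partial>PiM (\<sigma> ` J) (\<lambda>_. lborel)) = (\<integral>\<^sup>+z. h z \<partial>PiM J (\<lambda>_::nat. lborel :: real measure))"
proof -
  let ?T = "\<lambda>u::nat \<Rightarrow> real. \<lambda>j\<in>J. u (\<sigma> j)"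
  have T: "?T \<in> PiM (\<sigma> ` J) (\<lambda>_. lborel) \<rightarrow>\<^sub>M PiM J (\<lambda>_. lborel)"
    by (intro measurable_restrict measurable_component_singleton) auto
  have "distr (PiM (\<sigma> ` J) (\<lambda>_. lborel)) (PiM J (\<lambda>_. lborel)) ?T = PiM J (\<lambda>_. lborel)"
  proof (rule lborel_product.PiM_eqI[OF J(1)])
    fix A :: "nat \<Rightarrow> real set" assume A: "\<And>i. i \<in> J \<Longrightarrow> A i \<in> sets lborel"
    have "?T -` PiE J A \<inter> space (PiM (\<sigma> ` J) (\<lambda>_. lborel)) = PiE (\<sigma> ` J) (\<lambda>i. A (inv_into J \<sigma> i))"
      using J(2) by (auto simp: space_PiM PiE_def Pi_def)
    then have "emeasure (distr (PiM (\<sigma> ` J) (\<lambda>_. lborel)) (PiM J (\<lambda>_. lborel)) ?T) (PiE J A) =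
      emeasure (PiM (\<sigma> ` J) (\<lambda>_. lborel)) (PiE (\<sigma> ` J) (\<lambda>i. A (inv_into J \<sigma> i)))"
      using A J(1) by (subst emeasure_distr[OF T]) (auto intro!: sets_PiM_I_finite)
    also have "\<dots> = (\<Prod>i\<in>\<sigma> ` J. emeasure lborel (A (inv_into J \<sigma> i)))"
      using A J by (intro lborel_product.emeasure_PiM) auto
    also have "\<dots> = (\<Prod>j\<in>J. emeasure lborel (A j))"
      using J(2) by (subst prod.reindex) auto
    finally show "emeasure (distr (PiM (\<sigma> ` J) (\<lambda>_. lborel)) (PiM J (\<lambda>_. lborel)) ?T) (PiE J A) =
      (\<Prod>j\<in>J. emeasure lborel (A j))" .
  qed simp
  then show ?thesis using nn_integral_distr[OF T, of h] h by simp
qed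

text \<open>\<open>\<sigma> j\<close> is the index of the entry of the next configuration that plays
  the part of point \<open>j\<close>; injective, because factorial moments count distinct
  points.\<close>

definition inj_choices :: "'i set \<Rightarrow> nat \<Rightarrow> ('i \<Rightarrow> nat) set" where
  "inj_choices J n = {\<sigma> \<in> J \<rightarrow>\<^sub>E {1..n}. inj_on \<sigma> J}"

lemma finite_inj_choices: "finite J \<Longrightarrow> finite (inj_choices J n)"
  unfolding inj_choices_def by (rule finite_subset[of _ "J \<rightarrow>\<^sub>E {1..n}"]) (auto intro: finite_PiE)

context
  fixes m :: nat and x :: "nat \<Rightarrow> real" and J B :: "nat set" and lev :: "nat \<Rightarrow> nat" and pos :: "nat \<Rightarrow> real"
    and g :: "(nat \<Rightarrow> real) \<Rightarrow> ennreal"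
  assumes x: "x \<in> Conf0 m" and norm: "gue_normalized m x"
    and fin: "finite J" "finite B" "J \<inter> B = {}"
    and levJ: "\<And>j. j \<in> J \<Longrightarrow> lev j = m + 1" and levB: "\<And>i. i \<in> B \<Longrightarrow> lev i > m + 1"
    and g: "g \<in> borel_measurable (PiM J (\<lambda>_. lborel))"
begin

text \<open>Almost everywhere, the density times the determinant started at \<open>y\<close> is the
  determinant of the whole level together with \<open>B\<close>. The entries that represent no point
  of \<open>J\<close> are integrated out, and point \<open>j\<close> stays confined to the cell of
  its entry.\<close>

lemma level_step_single:
  assumes \<sigma>: "\<sigma> \<in> inj_choices J (m + 1)"
  shows "(\<integral>\<^sup>+y. g (\<lambda>j\<in>J. y (\<sigma> j)) * ennreal (level_det (m + 1) y B lev pos) * ennreal (gue_density m x y) \<partial>conf_lborel (m + 1))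
    = (\<integral>\<^sup>+z. of_bool (\<forall>j\<in>J. z j \<in> cell m x (\<sigma> j)) * (g z * ennreal (level_det m x (J \<union> B) lev (override_on pos z J))) \<partial>PiM J (\<lambda>_. lborel))"
proof -
  define I R where "I = \<sigma> ` J" and "R = {1..m+1} - I"
  have \<sigma>': "\<sigma> \<in> J \<rightarrow> {1..m+1}" "inj_on \<sigma> J" using \<sigma> by (auto simp: inj_choices_def)
  have IR: "I \<inter> R = {}" "finite I" "finite R" "I \<union> R = {1..m+1}" "R \<subseteq> {1..m+1}" "{1..m+1} - R = I"
    using \<sigma>' fin by (auto simp: I_def R_def)
  define F where "F = (\<lambda>y. of_bool (in_cells m x {1..m+1} y) * (g (\<lambda>j\<in>J. y (\<sigma> j)) * ennreal (block_det m x B lev pos {} y)))"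
  have D: "0 \<le> block_det m x B lev pos {} y" if "in_cells m x {1..m+1} y" for y
  proof -
    have "0 \<le> level_det (m + 1) (restrict y {1..m+1}) B lev pos"
      by (intro level_det_nonneg in_cells_Conf0[OF x that] fin levB)
    then show ?thesis using first_block_nonneg[OF x that] block_det_factor[OF x that fin(2), of lev pos, OF levB] by simp
  qed
  have gm: "(\<lambda>y. g (\<lambda>j\<in>J. y (\<sigma> j))) \<in> borel_measurable (PiM {1..m+1} (\<lambda>_. lborel))"
    using \<sigma>'(1) by (intro measurable_compose[OF _ g] measurable_restrict measurable_component_singleton) auto
  have Fm: "F \<in> borel_measurable (PiM (I \<union> R) (\<lambda>_. lborel))"
  proof -
    have [measurable]: "Measurable.pred (PiM {1..m+1} (\<lambda>_. lborel)) (in_cells m x {1..m+1})"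
      by (intro in_cells_measurable) auto
    have [measurable]: "block_det m x B lev pos {} \<in> borel_measurable (PiM {1..m+1} (\<lambda>_. lborel))"
      by (rule block_det_measurable) auto
    note [measurable] = gm
    show ?thesis unfolding F_def IR(4) of_bool_def by measurable
  qed
  have "(\<integral>\<^sup>+y. g (\<lambda>j\<in>J. y (\<sigma> j)) * ennreal (level_det (m + 1) y B lev pos) * ennreal (gue_density m x y) \<partial>conf_lborel (m + 1))
    = (\<integral>\<^sup>+y. F y \<partial>PiM (I \<union> R) (\<lambda>_. lborel))"
    unfolding nn_integral_conf_lborel IR(4)
  proof (rule nn_integral_cong_AE)
    show "AE y in PiM {1..m+1} (\<lambda>_. lborel). g (\<lambda>j\<in>J. y (\<sigma> j)) * ennreal (level_det (m + 1) y B lev pos) *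
       ennreal (gue_density m x y) * indicator (Conf0 (m + 1)) y = F y"
      using AE_in_cells[OF x] AE_space
    proof eventually_elim
      case (elim y)
      have r: "restrict y {1..m+1} = y" using elim(2) by (auto simp: space_PiM PiE_def extensional_restrict)
      show ?case
      proof (cases "in_cells m x {1..m+1} y")
        case True
        have "block_det m x B lev pos {} y = gue_density m x y * level_det (m + 1) y B lev pos"
          using block_det_factor[OF x True fin(2), of lev pos, OF levB] first_block_gue_density[OF x norm True] r by (simp only:)
        moreover have "0 \<le> gue_density m x y"
          using first_block_nonneg[OF x True] unfolding first_block_gue_density[OF x norm True] .
        moreover have "0 \<le> level_det (m + 1) y B lev pos"
          using elim True by (intro level_det_nonneg fin levB) auto
        moreover have "y \<in> Conf0 (m + 1)" using elim True by simp
        ultimately show ?thesis using True by (simp add: F_def ennreal_mult mult_ac)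
      next
        case False
        then have "gue_density m x y = 0 \<or> y \<notin> Conf0 (m + 1)" using elim by (auto simp: gue_density_def)
        then show ?thesis using False by (auto simp: F_def)
      qed
    qed
  qed
  also have "\<dots> = (\<integral>\<^sup>+u. \<integral>\<^sup>+r. F (merge I R (u, r)) \<partial>PiM R (\<lambda>_. lborel) \<partial>PiM I (\<lambda>_. lborel))"
    by (rule lborel_product.product_nn_integral_fold[OF IR(1-3) Fm])
  also have "\<dots> = (\<integral>\<^sup>+u. of_bool (in_cells m x I u) * (g (\<lambda>j\<in>J. u (\<sigma> j)) * ennreal (block_det m x B lev pos R u)) \<partial>PiM I (\<lambda>_. lborel))"
  proof (intro nn_integral_cong)
    fix u :: "nat \<Rightarrow> real" assume "u \<in> space (PiM I (\<lambda>_. lborel))"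
    have "F (merge I R (u, r)) = of_bool (in_cells m x I u) * g (\<lambda>j\<in>J. u (\<sigma> j)) *
      (of_bool (in_cells m x R r) * ennreal (1 * block_det m x B lev pos {} (override_on u r R)))" for r
    proof -
      have "in_cells m x {1..m+1} (merge I R (u, r)) \<longleftrightarrow> in_cells m x I u \<and> in_cells m x R r"
        using IR(1) unfolding IR(4)[symmetric] by (auto simp: in_cells_def merge_def)
      moreover have "(\<lambda>j\<in>J. merge I R (u, r) (\<sigma> j)) = (\<lambda>j\<in>J. u (\<sigma> j))" by (auto simp: I_def merge_def)
      moreover have "block_det m x B lev pos {} (merge I R (u, r)) = block_det m x B lev pos {} (override_on u r R)"
        using IR(1) unfolding IR(4)[symmetric] by (intro block_det_cong) (auto simp: merge_def override_on_def R_def)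
      ultimately show ?thesis by (simp add: F_def of_bool_def)
    qed
    note F = this
    show "(\<integral>\<^sup>+r. F (merge I R (u, r)) \<partial>PiM R (\<lambda>_. lborel)) = of_bool (in_cells m x I u) * (g (\<lambda>j\<in>J. u (\<sigma> j)) * ennreal (block_det m x B lev pos R u))"
    proof (cases "in_cells m x I u")
      case True
      have meas: "(\<lambda>r. of_bool (in_cells m x R r) * ennreal (1 * block_det m x B lev pos {} (override_on u r R))) \<in> borel_measurable (PiM R (\<lambda>_. lborel))"
      proof -
        have [measurable]: "Measurable.pred (PiM R (\<lambda>_. lborel)) (in_cells m x R)"
          using IR(3) by (intro in_cells_measurable) auto
        have [measurable]: "(\<lambda>r. block_det m x B lev pos {} (override_on u r R)) \<in> borel_measurable (PiM R (\<lambda>_. lborel))"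
        proof (rule block_det_measurable)
          fix j show "(\<lambda>r. override_on u r R j) \<in> borel_measurable (PiM R (\<lambda>_. lborel))"
            by (cases "j \<in> R") (auto simp: override_on_def)
        qed simp
        show ?thesis unfolding of_bool_def by measurable
      qed
      have "(\<integral>\<^sup>+r. of_bool (in_cells m x R r) * ennreal (1 * block_det m x B lev pos {} (override_on u r R)) \<partial>PiM R (\<lambda>_. lborel))
         = ennreal (1 * block_det m x B lev pos R u)"
        by (rule signed_block_det_nn_integral[OF x fin(2) levB]) (use D IR True in auto)
      then show ?thesis unfolding F nn_integral_cmult[OF meas] using True by (simp add: mult.assoc)
    qed (simp add: F)
  qed
  also have "\<dots> = (\<integral>\<^sup>+u. (\<lambda>z. of_bool (\<forall>j\<in>J. z j \<in> cell m x (\<sigma> j)) * (g z * ennreal (level_det m x (J \<union> B) lev (override_on pos z J)))) (\<lambda>j\<in>J. u (\<sigma> j)) \<partial>PiM I (\<lambda>_. lborel))"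
  proof (intro nn_integral_cong)
    fix u :: "nat \<Rightarrow> real"
    have "level_det m x (J \<union> B) lev (override_on pos (\<lambda>j\<in>J. u (\<sigma> j)) J) = block_det m x B lev (override_on pos (\<lambda>j\<in>J. u (\<sigma> j)) J) R u"
      unfolding R_def I_def using levJ by (intro level_det_block_det fin \<sigma>') (auto simp: override_on_def)
    also have "\<dots> = block_det m x B lev pos R u"
      unfolding block_det_def using fin(3) by (intro level_det_cong) (auto simp: override_on_def)
    finally show "of_bool (in_cells m x I u) * (g (\<lambda>j\<in>J. u (\<sigma> j)) * ennreal (block_det m x B lev pos R u)) =
      (\<lambda>z. of_bool (\<forall>j\<in>J. z j \<in> cell m x (\<sigma> j)) * (g z * ennreal (level_det m x (J \<union> B) lev (override_on pos z J)))) (\<lambda>j\<in>J. u (\<sigma> j))"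
      by (simp add: in_cells_def I_def)
  qed
  also have "\<dots> = (\<integral>\<^sup>+z. of_bool (\<forall>j\<in>J. z j \<in> cell m x (\<sigma> j)) * (g z * ennreal (level_det m x (J \<union> B) lev (override_on pos z J))) \<partial>PiM J (\<lambda>_. lborel))"
    unfolding I_def
  proof (rule nn_integral_PiM_reindex[OF fin(1) \<sigma>'(2)])
    have [measurable]: "Measurable.pred (PiM J (\<lambda>_. lborel)) (\<lambda>z. \<forall>j\<in>J. z j \<in> cell m x (\<sigma> j))"
      by (rule pred_intros_finite[OF fin(1)]) measurable
    have [measurable]: "(\<lambda>z. level_det m x (J \<union> B) lev (override_on pos z J)) \<in> borel_measurable (PiM J (\<lambda>_. lborel))"
    proof (rule level_det_measurable)
      fix j show "(\<lambda>z. override_on pos z J j) \<in> borel_measurable (PiM J (\<lambda>_. lborel))"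
        by (cases "j \<in> J") (auto simp: override_on_def)
    qed simp
    note [measurable] = g
    show "(\<lambda>z. of_bool (\<forall>j\<in>J. z j \<in> cell m x (\<sigma> j)) * (g z * ennreal (level_det m x (J \<union> B) lev (override_on pos z J)))) \<in> borel_measurable (PiM J (\<lambda>_. lborel))"
      unfolding of_bool_def by measurable
  qed
  finally show ?thesis .
qed

text \<open>Every tuple \<open>z\<close> lies in exactly one product of cells. If these cells are
  distinct, they form the one assignment that contributes; if not, no assignment contributes, and
  the determinant vanishes as well.\<close>

lemma level_step:
  "(\<Sum>\<sigma>\<in>inj_choices J (m + 1).
      \<integral>\<^sup>+y. g (\<lambda>j\<in>J. y (\<sigma> j)) * ennreal (level_det (m + 1) y B lev pos) * ennreal (gue_density m x y) \<partial>conf_lborel (m + 1))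
    = (\<integral>\<^sup>+z. g z * ennreal (level_det m x (J \<union> B) lev (override_on pos z J)) \<partial>PiM J (\<lambda>_. lborel))"
proof -
  let ?E = "\<lambda>z. g z * ennreal (level_det m x (J \<union> B) lev (override_on pos z J))"
  have Em: "?E \<in> borel_measurable (PiM J (\<lambda>_. lborel))"
  proof -
    have [measurable]: "(\<lambda>z. level_det m x (J \<union> B) lev (override_on pos z J)) \<in> borel_measurable (PiM J (\<lambda>_. lborel))"
    proof (rule level_det_measurable)
      fix j show "(\<lambda>z. override_on pos z J j) \<in> borel_measurable (PiM J (\<lambda>_. lborel))"
        by (cases "j \<in> J") (auto simp: override_on_def)
    qed simp
    note [measurable] = g
    show ?thesis by measurable
  qed
  have "(\<Sum>\<sigma>\<in>inj_choices J (m + 1).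
      \<integral>\<^sup>+y. g (\<lambda>j\<in>J. y (\<sigma> j)) * ennreal (level_det (m + 1) y B lev pos) * ennreal (gue_density m x y) \<partial>conf_lborel (m + 1))
    = (\<Sum>\<sigma>\<in>inj_choices J (m + 1). \<integral>\<^sup>+z. of_bool (\<forall>j\<in>J. z j \<in> cell m x (\<sigma> j)) * ?E z \<partial>PiM J (\<lambda>_. lborel))"
    by (intro sum.cong refl level_step_single)
  also have "\<dots> = (\<integral>\<^sup>+z. (\<Sum>\<sigma>\<in>inj_choices J (m + 1). of_bool (\<forall>j\<in>J. z j \<in> cell m x (\<sigma> j)) * ?E z) \<partial>PiM J (\<lambda>_. lborel))"
  proof (rule nn_integral_sum[symmetric])
    fix \<sigma> :: "nat \<Rightarrow> nat"
    have [measurable]: "Measurable.pred (PiM J (\<lambda>_. lborel)) (\<lambda>z. \<forall>j\<in>J. z j \<in> cell m x (\<sigma> j))"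
      by (rule pred_intros_finite[OF fin(1)]) measurable
    note [measurable] = Em
    show "(\<lambda>z. of_bool (\<forall>j\<in>J. z j \<in> cell m x (\<sigma> j)) * ?E z) \<in> borel_measurable (PiM J (\<lambda>_. lborel))"
      unfolding of_bool_def by measurable
  qed
  also have "\<dots> = (\<integral>\<^sup>+z. ?E z \<partial>PiM J (\<lambda>_. lborel))"
  proof (intro nn_integral_cong)
    fix z :: "nat \<Rightarrow> real"
    define \<tau> where "\<tau> = (\<lambda>j\<in>J. SOME c. c \<in> {1..m+1} \<and> z j \<in> cell m x c)"
    have "\<exists>c. c \<in> {1..m+1} \<and> z j \<in> cell m x c" for j using cell_exists[OF x] by metis
    then have \<tau>: "\<tau> j \<in> {1..m+1} \<and> z j \<in> cell m x (\<tau> j)" if "j \<in> J" for j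
      using someI_ex[of "\<lambda>c. c \<in> {1..m+1} \<and> z j \<in> cell m x c"] that by (simp add: \<tau>_def)
    have iff: "(\<forall>j\<in>J. z j \<in> cell m x (\<sigma> j)) \<longleftrightarrow> \<sigma> = \<tau>" if "\<sigma> \<in> inj_choices J (m + 1)" for \<sigma>
    proof
      assume a: "\<forall>j\<in>J. z j \<in> cell m x (\<sigma> j)"
      show "\<sigma> = \<tau>"
      proof (rule PiE_ext)
        show "\<sigma> \<in> J \<rightarrow>\<^sub>E {1..m+1}" using that by (auto simp: inj_choices_def)
        show "\<tau> \<in> J \<rightarrow>\<^sub>E {1..m+1}" using \<tau> by (auto simp: \<tau>_def)
        fix j assume "j \<in> J"
        then show "\<sigma> j = \<tau> j"
          using cell_unique[OF x, of "z j" "\<sigma> j" "\<tau> j"] a \<tau>[of j] that by (auto simp: inj_choices_def PiE_def Pi_def)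
      qed
    qed (use \<tau> in auto)
    show "(\<Sum>\<sigma>\<in>inj_choices J (m + 1). of_bool (\<forall>j\<in>J. z j \<in> cell m x (\<sigma> j)) * ?E z) = ?E z"
    proof (cases "inj_on \<tau> J")
      case True
      then have "\<tau> \<in> inj_choices J (m + 1)" using \<tau> by (auto simp: inj_choices_def \<tau>_def)
      moreover have "(\<Sum>\<sigma>\<in>inj_choices J (m + 1). of_bool (\<forall>j\<in>J. z j \<in> cell m x (\<sigma> j)) * ?E z) =
        (\<Sum>\<sigma>\<in>inj_choices J (m + 1). if \<sigma> = \<tau> then ?E z else 0)"
        by (intro sum.cong refl) (simp add: iff)
      ultimately show ?thesis using finite_inj_choices[OF fin(1)] by simp
    next
      case False
      then obtain i j where ij: "i \<in> J" "j \<in> J" "i \<noteq> j" "\<tau> i = \<tau> j" by (auto simp: inj_on_def)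
      have "level_det m x (J \<union> B) lev (override_on pos z J) = 0"
      proof (rule level_det_same_cell[OF x, of _ lev i j "\<tau> i"])
        show "lev k > m" if "k \<in> J \<union> B" for k using that levJ[of k] levB[of k] by auto
      qed (use ij \<tau>[of i] \<tau>[of j] fin levJ in \<open>auto simp: override_on_def\<close>)
      then show ?thesis by simp
    qed
  qed
  finally show ?thesis .
qed

end


subsection \<open>The Markov property\<close>

lemma sigma_finite_conf_lborel: "sigma_finite_measure (conf_lborel n)"
  unfolding conf_lborel_def
  by (intro sigma_finite_measure_restrict_space Conf0_sets lborel_product.sigma_finite) simp

lemma gue_density_measurable:
  assumes [measurable]: "\<And>i. i \<in> {1..n} \<Longrightarrow> (\<lambda>\<omega>. x \<omega> i) \<in> borel_measurable N"
    "\<And>i. i \<in> {1..n+1} \<Longrightarrow> (\<lambda>\<omega>. y \<omega> i) \<in> borel_measurable N"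
  shows "(\<lambda>\<omega>. gue_density n (x \<omega>) (y \<omega>)) \<in> borel_measurable N"
proof -
  have [measurable]: "Measurable.pred N (\<lambda>\<omega>. interlacing n (x \<omega>) (y \<omega>))"
    unfolding interlacing_def by (rule pred_intros_finite[OF finite_atLeastAtMost]) measurable
  have [measurable]: "(\<lambda>\<omega>. vandermonde n (x \<omega>)) \<in> borel_measurable N" 
    unfolding vandermonde_def by (intro borel_measurable_prod borel_measurable_diff) auto
  have [measurable]: "(\<lambda>\<omega>. vandermonde (n + 1) (y \<omega>)) \<in> borel_measurable N" 
    unfolding vandermonde_def by (intro borel_measurable_prod borel_measurable_diff) auto
  have [measurable]: "(\<lambda>\<omega>. \<Sum>k=1..n. (x \<omega> k)\<^sup>2 / 2) \<in> borel_measurable N" 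
    by (intro borel_measurable_sum borel_measurable_divide borel_measurable_power) auto
  have [measurable]: "(\<lambda>\<omega>. \<Sum>k=1..n+1. (y \<omega> k)\<^sup>2 / 2) \<in> borel_measurable N" 
    by (intro borel_measurable_sum borel_measurable_divide borel_measurable_power) auto
  show ?thesis unfolding gue_density_def of_bool_def by measurable
qed

locale rising_gue =
  fixes m :: nat and x :: "nat \<Rightarrow> real" and M :: "'w measure" and X :: "nat \<Rightarrow> 'w \<Rightarrow> nat \<Rightarrow> real"
  assumes start: "x \<in> Conf0 m" and process: "rising_gue_process m x M X"
begin

sublocale prob_space M
  using process unfolding rising_gue_process_def by simp

lemma X_measurable: "m \<le> r \<Longrightarrow> X r \<in> M \<rightarrow>\<^sub>M conf_lborel r"
  and X_start: "\<omega> \<in> space M \<Longrightarrow> X m \<omega> = x"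
  using process unfolding rising_gue_process_def by simp_all

lemma X_Conf0: "m \<le> r \<Longrightarrow> \<omega> \<in> space M \<Longrightarrow> X r \<omega> \<in> Conf0 r"
  using measurable_space[OF X_measurable] by simp

abbreviation history :: "nat \<Rightarrow> 'w measure" where
  "history r \<equiv> conf_history M X m r"

lemma history_generator:
  "(\<Union>s\<in>{m..r}. {X s -` A \<inter> space M | A. A \<in> sets (conf_lborel s)}) \<subseteq> Pow (space M)"
  by auto

lemma space_history [simp]: "space (history r) = space M"
  unfolding conf_history_def by (rule space_measure_of[OF history_generator])

lemma sets_history: "sets (history r) =
   sigma_sets (space M) (\<Union>s\<in>{m..r}. {X s -` A \<inter> space M | A. A \<in> sets (conf_lborel s)})"
  unfolding conf_history_def by (rule sets_measure_of[OF history_generator])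

lemma subalgebra_history: "subalgebra M (history r)"
  unfolding subalgebra_def sets_history
  by (auto intro!: sets.sigma_sets_subset measurable_sets[OF X_measurable])

lemma history_mono: "r \<le> s \<Longrightarrow> sets (history r) \<subseteq> sets (history s)"
  unfolding sets_history by (intro sigma_sets_mono') fastforce

lemma X_history_measurable:
  assumes "m \<le> s" "s \<le> r" shows "X s \<in> history r \<rightarrow>\<^sub>M conf_lborel s"
proof (rule measurableI)
  show "X s \<omega> \<in> space (conf_lborel s)" if "\<omega> \<in> space (history r)" for \<omega>
    using that X_Conf0[OF assms(1)] by simp
  fix A assume "A \<in> sets (conf_lborel s)"
  then show "X s -` A \<inter> space (history r) \<in> sets (history r)"
    unfolding sets_history space_history using assms by (intro sigma_sets.Basic UN_I[of s]) auto
qed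

lemma X_component_measurable:
  assumes "m \<le> s" "s \<le> r" "i \<in> {1..s}" shows "(\<lambda>\<omega>. X s \<omega> i) \<in> borel_measurable (history r)"
  by (rule measurable_compose[OF X_history_measurable[OF assms(1,2)] conf_component_measurable[OF assms(3)]])

lemma measurable_from_history: "f \<in> history r \<rightarrow>\<^sub>M N \<Longrightarrow> f \<in> M \<rightarrow>\<^sub>M N"
  by (rule measurable_from_subalg[OF subalgebra_history])

lemma id_history_measurable: "(\<lambda>\<omega>. \<omega>) \<in> M \<rightarrow>\<^sub>M history r"
  using measurable_from_history[of "\<lambda>\<omega>. \<omega>" r "history r"] by simp

lemma finite_measure_subalgebra_history: "finite_measure_subalgebra M (history r)"
  by unfold_locales (rule subalgebra_history)

lemma cond_exp_density:
  assumes "m \<le> r" "A \<in> sets (conf_lborel (r + 1))"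
  shows "AE \<omega> in M. nn_cond_exp M (history r) (\<lambda>\<omega>'. indicator A (X (r + 1) \<omega>')) \<omega>
     = (\<integral>\<^sup>+y\<in>A. ennreal (gue_density r (X r \<omega>) y) \<partial>conf_lborel (r + 1))"
  using process assms unfolding rising_gue_process_def by blast

text \<open>The total mass of the density is the conditional probability of the sure event that
  \<open>X (r + 1)\<close> lies in \<open>Conf0 (r + 1)\<close>.\<close>

lemma AE_normalized:
  assumes "m \<le> r"
  shows "AE \<omega> in M. gue_normalized r (X r \<omega>)"
proof -
  interpret H: finite_measure_subalgebra M "history r" by (rule finite_measure_subalgebra_history)
  let ?A = "Conf0 (r + 1)"
  have A: "?A \<in> sets (conf_lborel (r + 1))" using sets.top[of "conf_lborel (r + 1)"] by simp
  have "(\<lambda>\<omega>'. indicator ?A (X (r + 1) \<omega>') :: ennreal) \<in> borel_measurable (history r)"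
    by (rule measurable_cong[THEN iffD1, of _ "\<lambda>_. 1"]) (use X_Conf0[of "r + 1"] assms in auto)
  from cond_exp_density[OF assms A] H.nn_cond_exp_F_meas[OF this] AE_space show ?thesis
  proof eventually_elim
    case (elim \<omega>)
    have "(\<integral>\<^sup>+y\<in>?A. ennreal (gue_density r (X r \<omega>) y) \<partial>conf_lborel (r + 1)) =
      (\<integral>\<^sup>+y. ennreal (gue_density r (X r \<omega>) y) \<partial>conf_lborel (r + 1))"
      by (intro nn_integral_cong) simp
    then show ?case using elim X_Conf0[of "r + 1" \<omega>] assms by (simp add: gue_normalized_def)
  qed
qed

lemma density_pair_measurable:
  assumes "m \<le> r"
  shows "(\<lambda>(\<omega>, y). ennreal (gue_density r (X r \<omega>) y)) \<in> borel_measurable (history r \<Otimes>\<^sub>M conf_lborel (r + 1))"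
proof -
  have "(\<lambda>p. gue_density r (X r (fst p)) (snd p)) \<in> borel_measurable (history r \<Otimes>\<^sub>M conf_lborel (r + 1))"
  proof (rule gue_density_measurable)
    show "(\<lambda>p. X r (fst p) i) \<in> borel_measurable (history r \<Otimes>\<^sub>M conf_lborel (r + 1))" if "i \<in> {1..r}" for i
      by (rule measurable_compose[OF measurable_fst X_component_measurable]) (use assms that in auto)
    show "(\<lambda>p. snd p i) \<in> borel_measurable (history r \<Otimes>\<^sub>M conf_lborel (r + 1))" if "i \<in> {1..r+1}" for i
      by (rule measurable_compose[OF measurable_snd conf_component_measurable[OF that]])
  qed
  then show ?thesis by (simp add: case_prod_beta)
qed

text \<open>The definition of the process fixes conditional probabilities of single sets, that is,
  the joint law of the past and the next configuration on rectangles. Rectangles are stable under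
  intersection and generate, so the two finite measures agree.\<close>

lemma Markov_property:
  assumes r: "m \<le> r" and H: "H \<in> borel_measurable (history r \<Otimes>\<^sub>M conf_lborel (r + 1))"
  shows "(\<integral>\<^sup>+\<omega>. H (\<omega>, X (r + 1) \<omega>) \<partial>M) =
    (\<integral>\<^sup>+\<omega>. \<integral>\<^sup>+y. H (\<omega>, y) * ennreal (gue_density r (X r \<omega>) y) \<partial>conf_lborel (r + 1) \<partial>M)"
proof -
  let ?F = "history r" and ?C = "conf_lborel (r + 1)"
  \<comment> \<open>\<open>history r\<close> is made by \<open>sigma\<close> and carries the zero
    measure; \<open>?R\<close> puts the probability back on it.\<close>
  let ?R = "restr_to_subalg M ?F"
  let ?d = "\<lambda>(\<omega>, y). ennreal (gue_density r (X r \<omega>) y)"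
  interpret H: finite_measure_subalgebra M ?F by (rule finite_measure_subalgebra_history)
  interpret C: sigma_finite_measure ?C by (rule sigma_finite_conf_lborel)
  have sR: "sets (?R \<Otimes>\<^sub>M ?C) = sets (?F \<Otimes>\<^sub>M ?C)"
    by (intro sets_pair_measure_cong sets_restr_to_subalg subalgebra_history refl)
  have spR: "space ?R = space M" by (rule space_restr_to_subalg)
  have T: "(\<lambda>\<omega>. (\<omega>, X (r + 1) \<omega>)) \<in> M \<rightarrow>\<^sub>M ?F \<Otimes>\<^sub>M ?C"
    using r by (intro measurable_Pair id_history_measurable X_measurable) auto
  have d: "?d \<in> borel_measurable (?R \<Otimes>\<^sub>M ?C)"
    using density_pair_measurable[OF r] unfolding measurable_cong_sets[OF sR refl] .
  have int: "(\<integral>\<^sup>+p. f p * ?d p \<partial>(?R \<Otimes>\<^sub>M ?C)) =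
      (\<integral>\<^sup>+\<omega>. \<integral>\<^sup>+y. f (\<omega>, y) * ennreal (gue_density r (X r \<omega>) y) \<partial>?C \<partial>M)"
    if f: "f \<in> borel_measurable (?F \<Otimes>\<^sub>M ?C)" for f
  proof -
    have fR: "f \<in> borel_measurable (?R \<Otimes>\<^sub>M ?C)" using f unfolding measurable_cong_sets[OF sR refl] .
    have fd: "(\<lambda>p. f p * ?d p) \<in> borel_measurable (?F \<Otimes>\<^sub>M ?C)"
      by (intro borel_measurable_times_ennreal f density_pair_measurable r)
    have "(\<integral>\<^sup>+p. f p * ?d p \<partial>(?R \<Otimes>\<^sub>M ?C)) = (\<integral>\<^sup>+\<omega>. \<integral>\<^sup>+y. f (\<omega>, y) * ?d (\<omega>, y) \<partial>?C \<partial>?R)"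
      by (rule C.nn_integral_fst[symmetric]) (intro borel_measurable_times_ennreal fR d)
    also have "\<dots> = (\<integral>\<^sup>+\<omega>. \<integral>\<^sup>+y. f (\<omega>, y) * ?d (\<omega>, y) \<partial>?C \<partial>M)"
      using C.borel_measurable_nn_integral_fst[OF fd] by (intro nn_integral_subalgebra2 subalgebra_history)
    finally show ?thesis by simp
  qed
  have "distr M (?F \<Otimes>\<^sub>M ?C) (\<lambda>\<omega>. (\<omega>, X (r + 1) \<omega>)) = density (?R \<Otimes>\<^sub>M ?C) ?d" (is "?N1 = ?N2")
  proof (rule measure_eqI_generator_eq)
    show "Int_stable {a \<times> b | a b. a \<in> sets ?F \<and> b \<in> sets ?C}" by (rule Int_stable_pair_measure_generator)
    show "{a \<times> b | a b. a \<in> sets ?F \<and> b \<in> sets ?C} \<subseteq> Pow (space ?F \<times> space ?C)"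
      by (rule pair_measure_closed)
    show "sets ?N1 = sigma_sets (space ?F \<times> space ?C) {a \<times> b | a b. a \<in> sets ?F \<and> b \<in> sets ?C}"
      by (simp add: sets_pair_measure)
    show "sets ?N2 = sigma_sets (space ?F \<times> space ?C) {a \<times> b | a b. a \<in> sets ?F \<and> b \<in> sets ?C}"
      unfolding sets_density sR by (simp add: sets_pair_measure)
    show "range (\<lambda>_::nat. space ?F \<times> space ?C) \<subseteq> {a \<times> b | a b. a \<in> sets ?F \<and> b \<in> sets ?C}"
      using sets.top[of ?F] sets.top[of ?C] by blast
    show "(\<Union>i::nat. space ?F \<times> space ?C) = space ?F \<times> space ?C" by simp
    interpret N1: prob_space ?N1 by (rule prob_space_distr[OF T])
    show "emeasure ?N1 (space ?F \<times> space ?C) \<noteq> \<infinity>"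
      using N1.emeasure_finite by simp
    fix P assume "P \<in> {a \<times> b | a b. a \<in> sets ?F \<and> b \<in> sets ?C}"
    then obtain B A where P: "P = B \<times> A" and B: "B \<in> sets ?F" and A: "A \<in> sets ?C" by blast
    have P': "P \<in> sets (?F \<Otimes>\<^sub>M ?C)" using A B P by simp
    have Bm: "(indicator B :: 'w \<Rightarrow> ennreal) \<in> borel_measurable ?F" using B by simp
    have Am: "(\<lambda>\<omega>. indicator A (X (r + 1) \<omega>) :: ennreal) \<in> borel_measurable M"
      using r A by (intro measurable_compose[OF X_measurable borel_measurable_indicator]) auto
    have "emeasure ?N1 P = (\<integral>\<^sup>+p. indicator P p \<partial>?N1)" using P' by simp
    also have "\<dots> = (\<integral>\<^sup>+\<omega>. indicator P (\<omega>, X (r + 1) \<omega>) \<partial>M)"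
      using P' by (intro nn_integral_distr T) simp
    also have "\<dots> = (\<integral>\<^sup>+\<omega>. indicator B \<omega> * indicator A (X (r + 1) \<omega>) \<partial>M)"
      by (simp add: P indicator_times)
    also have "\<dots> = (\<integral>\<^sup>+\<omega>. indicator B \<omega> * nn_cond_exp M ?F (\<lambda>\<omega>'. indicator A (X (r + 1) \<omega>')) \<omega> \<partial>M)"
      by (rule H.nn_cond_exp_intg[symmetric, OF Bm Am])
    also have "\<dots> = (\<integral>\<^sup>+\<omega>. indicator B \<omega> * (\<integral>\<^sup>+y\<in>A. ennreal (gue_density r (X r \<omega>) y) \<partial>?C) \<partial>M)"
      using cond_exp_density[OF r A] by (intro nn_integral_cong_AE) (auto elim!: eventually_mono)
    also have "\<dots> = (\<integral>\<^sup>+\<omega>. \<integral>\<^sup>+y. indicator P (\<omega>, y) * ennreal (gue_density r (X r \<omega>) y) \<partial>?C \<partial>M)"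
    proof (intro nn_integral_cong)
      fix \<omega>
      show "indicator B \<omega> * (\<integral>\<^sup>+y\<in>A. ennreal (gue_density r (X r \<omega>) y) \<partial>?C) =
        (\<integral>\<^sup>+y. indicator P (\<omega>, y) * ennreal (gue_density r (X r \<omega>) y) \<partial>?C)"
        by (cases "\<omega> \<in> B") (auto simp: P indicator_times mult.commute)
    qed
    also have "\<dots> = (\<integral>\<^sup>+p. indicator P p * ?d p \<partial>(?R \<Otimes>\<^sub>M ?C))"
      using P' by (intro int[symmetric]) simp
    also have "\<dots> = emeasure ?N2 P"
      using P' sR by (subst emeasure_density[OF d]) (auto simp: mult.commute)
    finally show "emeasure ?N1 P = emeasure ?N2 P" .
  qed
  then have "(\<integral>\<^sup>+p. H p \<partial>?N1) = (\<integral>\<^sup>+p. H p \<partial>?N2)" by simp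
  also have "(\<integral>\<^sup>+p. H p \<partial>?N1) = (\<integral>\<^sup>+\<omega>. H (\<omega>, X (r + 1) \<omega>) \<partial>M)"
    by (rule nn_integral_distr[OF T]) (use H in simp)
  also have "(\<integral>\<^sup>+p. H p \<partial>?N2) = (\<integral>\<^sup>+p. ?d p * H p \<partial>(?R \<Otimes>\<^sub>M ?C))"
    by (intro nn_integral_density d) (use H in \<open>unfold measurable_cong_sets[OF sR refl]\<close>)
  also have "\<dots> = (\<integral>\<^sup>+\<omega>. \<integral>\<^sup>+y. H (\<omega>, y) * ennreal (gue_density r (X r \<omega>) y) \<partial>?C \<partial>M)"
    using int[OF H] by (simp add: mult.commute)
  finally show ?thesis .
qed

end


subsection \<open>Factorial moments for given levels\<close>

definition level_choices :: "'i set \<Rightarrow> ('i \<Rightarrow> nat) \<Rightarrow> ('i \<Rightarrow> nat) set" where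
  "level_choices I lev =
     {\<sigma> \<in> (\<Pi>\<^sub>E i\<in>I. {1..lev i}). \<forall>i\<in>I. \<forall>j\<in>I. lev i = lev j \<longrightarrow> \<sigma> i = \<sigma> j \<longrightarrow> i = j}"

lemma finite_level_choices: "finite I \<Longrightarrow> finite (level_choices I lev)"
  unfolding level_choices_def by (rule finite_subset[of _ "\<Pi>\<^sub>E i\<in>I. {1..lev i}"]) (auto intro: finite_PiE)

lemma sum_level_choices_split:
  assumes "J \<inter> B = {}" "\<And>j. j \<in> J \<Longrightarrow> lev j = n" "\<And>i. i \<in> B \<Longrightarrow> lev i \<noteq> n"
  shows "(\<Sum>\<sigma>\<in>level_choices (J \<union> B) lev. f \<sigma>) =
    (\<Sum>\<sigma>\<in>inj_choices J n. \<Sum>\<tau>\<in>level_choices B lev. f (merge J B (\<sigma>, \<tau>)))"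
  unfolding sum.cartesian_product
proof (rule sum.reindex_bij_witness[where j = "\<lambda>\<rho>. (restrict \<rho> J, restrict \<rho> B)" and i = "\<lambda>p. merge J B p"], goal_cases)
  case (1 \<rho>)
  then show ?case unfolding level_choices_def
    by (intro ext) (auto simp: merge_def PiE_def extensional_def)
next
  case (2 \<rho>)
  then show ?case using assms
    by (auto simp: level_choices_def inj_choices_def inj_on_def PiE_def Pi_def)
next
  case (3 p)
  then show ?case using assms(1)
    by (cases p) (auto simp: level_choices_def inj_choices_def PiE_def extensional_def merge_def fun_eq_iff)
next
  case (4 p)
  then show ?case using assms
    by (cases p) (auto simp: level_choices_def inj_choices_def inj_on_def PiE_def Pi_def extensional_def merge_def)
next
  case (5 \<rho>)
  then have "merge J B (restrict \<rho> J, restrict \<rho> B) = \<rho>" unfolding level_choices_def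
    by (intro ext) (auto simp: merge_def PiE_def extensional_def)
  then show ?case by simp
qed

context rising_gue
begin

text \<open>Going down one level conditions on one configuration less: the Markov property replaces the
  points of level \<open>t + 1\<close> by an integral against \<open>gue_density\<close>, which \<open>level_step\<close> evaluates.\<close>
lemma factorial_moment_history:
  fixes I :: "nat set"
  assumes "t \<ge> m" "finite I" "\<And>i. i \<in> I \<Longrightarrow> t < lev i \<and> lev i \<le> N" 
    and "f \<in> borel_measurable (history t \<Otimes>\<^sub>M PiM I (\<lambda>_. lborel))"
  shows "(\<integral>\<^sup>+\<omega>. (\<Sum>\<sigma>\<in>level_choices I lev. f (\<omega>, \<lambda>i\<in>I. X (lev i) \<omega> (\<sigma> i))) \<partial>M) =
    (\<integral>\<^sup>+\<omega>. \<integral>\<^sup>+s. f (\<omega>, s) * ennreal (level_det t (X t \<omega>) I lev s) \<partial>PiM I (\<lambda>_. lborel) \<partial>M)"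
  using assms
proof (induction "N - t" arbitrary: t I f)
  case 0
  have "False" if "i \<in> I" for i using "0.prems"(3)[OF that] "0.hyps" by simp
  then have I: "I = {}" by blast
  have "(\<integral>\<^sup>+s. f (\<omega>, s) \<partial>PiM {} (\<lambda>_. lborel)) = f (\<omega>, \<lambda>_. undefined)" for \<omega>
    using lborel_product.nn_integral_empty[of "\<lambda>s. f (\<omega>, s)"] by simp
  then show ?case unfolding I by (simp add: level_choices_def level_det_def restrict_def)
next
  case (Suc n)
  note t = Suc.prems(1) and fin = Suc.prems(2) and lev = Suc.prems(3) and f = Suc.prems(4)
  define J B where "J = {i\<in>I. lev i = t + 1}" and "B = I - J"
  have JB: "finite J" "finite B" "J \<inter> B = {}" "B \<inter> J = {}" "J \<union> B = I" "B \<union> J = I" using fin by (auto simp: J_def B_def)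
  have levJ: "lev j = t + 1" if "j \<in> J" for j using that by (simp add: J_def)
  have levB: "lev i > t + 1" "lev i \<noteq> t + 1" "lev i \<le> N" if "i \<in> B" for i 
    using lev[of i] that by (auto simp: J_def B_def)
  let ?C = "conf_lborel (t + 1)" and ?B = "PiM B (\<lambda>_. lborel) :: (nat \<Rightarrow> real) measure"
    and ?J = "PiM J (\<lambda>_. lborel) :: (nat \<Rightarrow> real) measure"
  interpret C: sigma_finite_measure ?C by (rule sigma_finite_conf_lborel)
  interpret B: sigma_finite_measure ?B by (rule lborel_product.sigma_finite[OF JB(2)])
  interpret J: sigma_finite_measure ?J by (rule lborel_product.sigma_finite[OF JB(1)])
  interpret CB: pair_sigma_finite ?C ?B ..
  define f1 where "f1 = (\<lambda>\<omega> z s. f (\<omega>, merge B J (s, z)))"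
  have f1_meas: "(\<lambda>p. f1 (a p) (z p) (s p)) \<in> borel_measurable Q"
    if "a \<in> Q \<rightarrow>\<^sub>M history t" "z \<in> Q \<rightarrow>\<^sub>M ?J" "s \<in> Q \<rightarrow>\<^sub>M ?B"
    for Q :: "'q measure" and a z s
  proof -
    have "(\<lambda>p. merge B J (s p, z p)) \<in> Q \<rightarrow>\<^sub>M PiM (B \<union> J) (\<lambda>_. lborel)"
      by (rule measurable_compose[OF measurable_Pair[OF that(3,2)] measurable_merge])
    then show ?thesis unfolding f1_def JB(6) using that(1)
      by (intro measurable_compose[OF _ f] measurable_Pair)
  qed
  define g where "g = (\<lambda>\<sigma> (y :: nat \<Rightarrow> real). (\<lambda>j\<in>J. y (\<sigma> j)))"
  have g_meas: "(\<lambda>p. g \<sigma> (y p)) \<in> Q \<rightarrow>\<^sub>M ?J" if "y \<in> Q \<rightarrow>\<^sub>M ?C" "\<sigma> \<in> inj_choices J (t + 1)"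
    for Q :: "'q measure" and y \<sigma>
    unfolding g_def
  proof (rule measurable_restrict)
    fix j assume "j \<in> J"
    then have "\<sigma> j \<in> {1..t+1}" using that(2) by (auto simp: inj_choices_def)
    from measurable_compose[OF that(1) conf_component_measurable[OF this]]
    show "(\<lambda>p. y p (\<sigma> j)) \<in> Q \<rightarrow>\<^sub>M lborel" by simp
  qed
  define H where "H = (\<lambda>\<sigma> p. \<integral>\<^sup>+s. f1 (fst p) (g \<sigma> (snd p)) s * ennreal (level_det (t + 1) (snd p) B lev s) \<partial>?B)"
  have H_meas1: "(\<lambda>q. f1 (fst (fst q)) (g \<sigma> (snd (fst q))) (snd q) * ennreal (level_det (t + 1) (snd (fst q)) B lev (snd q)))
     \<in> borel_measurable ((history t \<Otimes>\<^sub>M ?C) \<Otimes>\<^sub>M ?B)" if \<sigma>: "\<sigma> \<in> inj_choices J (t + 1)" for \<sigma>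
  proof (intro borel_measurable_times_ennreal f1_meas g_meas \<sigma> measurable_compose[OF _ measurable_ennreal] level_det_measurable)
    show "(\<lambda>q. snd q i) \<in> borel_measurable ((history t \<Otimes>\<^sub>M ?C) \<Otimes>\<^sub>M ?B)" if "i \<in> B" for i
      by (rule measurable_compose[OF measurable_snd component_lborel_measurable[OF that]])
    show "(\<lambda>q. snd (fst q) r) \<in> borel_measurable ((history t \<Otimes>\<^sub>M ?C) \<Otimes>\<^sub>M ?B)" if "r \<in> {1..t+1}" for r
      by (rule measurable_compose[OF measurable_fst measurable_compose[OF measurable_snd conf_component_measurable[OF that]]])
  qed measurable
  have H_meas: "H \<sigma> \<in> borel_measurable (history t \<Otimes>\<^sub>M ?C)" if \<sigma>: "\<sigma> \<in> inj_choices J (t + 1)" for \<sigma>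
    unfolding H_def by (rule B.borel_measurable_nn_integral) (use H_meas1[OF \<sigma>] in \<open>simp add: case_prod_beta\<close>)
  have Hd_meas: "(\<lambda>\<omega>. \<integral>\<^sup>+y. H \<sigma> (\<omega>, y) * ennreal (gue_density t (X t \<omega>) y) \<partial>?C) \<in> borel_measurable M"
    if \<sigma>: "\<sigma> \<in> inj_choices J (t + 1)" for \<sigma>
  proof (rule measurable_from_history[of _ t], rule C.borel_measurable_nn_integral)
    show "(\<lambda>(\<omega>, y). H \<sigma> (\<omega>, y) * ennreal (gue_density t (X t \<omega>) y)) \<in> borel_measurable (history t \<Otimes>\<^sub>M ?C)"
      using borel_measurable_times_ennreal[OF H_meas[OF \<sigma>] density_pair_measurable[OF t]]
      by (simp add: case_prod_beta')
  qed
  have X1: "X (t + 1) \<in> history (t + 1) \<rightarrow>\<^sub>M ?C" using t by (intro X_history_measurable) auto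
  have hist: "(\<lambda>\<omega>. \<omega>) \<in> history (t + 1) \<rightarrow>\<^sub>M history t"
    using history_mono[of t "t + 1"] by (intro measurableI) auto
  \<comment> \<open>\<open>F \<sigma>\<close> sees the sample point also through
    \<open>X (t + 1)\<close>, which is measurable for \<open>history (t + 1)\<close>. To apply the
    induction hypothesis to it, the claim has to cover functions of the history as well as of the
    positions.\<close>
  define F where "F = (\<lambda>\<sigma> p. f1 (fst p) (g \<sigma> (X (t + 1) (fst p))) (snd p))"
  have F_meas: "F \<sigma> \<in> borel_measurable (history (t + 1) \<Otimes>\<^sub>M ?B)" if \<sigma>: "\<sigma> \<in> inj_choices J (t + 1)" for \<sigma>
    unfolding F_def
    by (intro f1_meas g_meas \<sigma> measurable_compose[OF measurable_fst hist] measurable_compose[OF measurable_fst X1] measurable_snd)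
  have XB: "(\<lambda>\<omega>. \<lambda>i\<in>B. X (lev i) \<omega> (\<tau> i)) \<in> M \<rightarrow>\<^sub>M ?B" if \<tau>: "\<tau> \<in> level_choices B lev" for \<tau>
  proof (rule measurable_restrict)
    fix i assume i: "i \<in> B"
    then have "\<tau> i \<in> {1..lev i}" "m \<le> lev i" using \<tau> levB(1)[OF i] t by (auto simp: level_choices_def)
    from measurable_compose[OF X_measurable[OF this(2)] conf_component_measurable[OF this(1)]]
    show "(\<lambda>\<omega>. X (lev i) \<omega> (\<tau> i)) \<in> M \<rightarrow>\<^sub>M lborel" by simp
  qed
  have "(\<integral>\<^sup>+\<omega>. (\<Sum>\<sigma>\<in>level_choices I lev. f (\<omega>, \<lambda>i\<in>I. X (lev i) \<omega> (\<sigma> i))) \<partial>M) =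
    (\<integral>\<^sup>+\<omega>. (\<Sum>\<sigma>\<in>inj_choices J (t + 1). \<Sum>\<tau>\<in>level_choices B lev. F \<sigma> (\<omega>, \<lambda>i\<in>B. X (lev i) \<omega> (\<tau> i))) \<partial>M)"
  proof (intro nn_integral_cong)
    fix \<omega>
    have "(\<Sum>\<sigma>\<in>level_choices I lev. f (\<omega>, \<lambda>i\<in>I. X (lev i) \<omega> (\<sigma> i))) =
      (\<Sum>\<sigma>\<in>inj_choices J (t + 1). \<Sum>\<tau>\<in>level_choices B lev. f (\<omega>, \<lambda>i\<in>I. X (lev i) \<omega> (merge J B (\<sigma>, \<tau>) i)))"
      using sum_level_choices_split[OF JB(3) levJ levB(2)] unfolding JB(5) .
    also have "\<dots> = (\<Sum>\<sigma>\<in>inj_choices J (t + 1). \<Sum>\<tau>\<in>level_choices B lev. F \<sigma> (\<omega>, \<lambda>i\<in>B. X (lev i) \<omega> (\<tau> i)))"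
    proof (intro sum.cong refl)
      fix \<sigma> \<tau> :: "nat \<Rightarrow> nat"
      have "(\<lambda>i\<in>I. X (lev i) \<omega> (merge J B (\<sigma>, \<tau>) i)) = merge B J (\<lambda>i\<in>B. X (lev i) \<omega> (\<tau> i), g \<sigma> (X (t + 1) \<omega>))"
        using JB(3) levJ unfolding JB(5)[symmetric] by (auto simp: merge_def g_def fun_eq_iff)
      then show "f (\<omega>, \<lambda>i\<in>I. X (lev i) \<omega> (merge J B (\<sigma>, \<tau>) i)) = F \<sigma> (\<omega>, \<lambda>i\<in>B. X (lev i) \<omega> (\<tau> i))"
        by (simp add: F_def f1_def)
    qed
    finally show "(\<Sum>\<sigma>\<in>level_choices I lev. f (\<omega>, \<lambda>i\<in>I. X (lev i) \<omega> (\<sigma> i))) = 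
      (\<Sum>\<sigma>\<in>inj_choices J (t + 1). \<Sum>\<tau>\<in>level_choices B lev. F \<sigma> (\<omega>, \<lambda>i\<in>B. X (lev i) \<omega> (\<tau> i)))" .
  qed
  also have "\<dots> = (\<Sum>\<sigma>\<in>inj_choices J (t + 1). \<integral>\<^sup>+\<omega>. (\<Sum>\<tau>\<in>level_choices B lev. F \<sigma> (\<omega>, \<lambda>i\<in>B. X (lev i) \<omega> (\<tau> i))) \<partial>M)"
    by (intro nn_integral_sum borel_measurable_sum measurable_compose[OF measurable_Pair[OF id_history_measurable XB] F_meas])
  also have "\<dots> = (\<Sum>\<sigma>\<in>inj_choices J (t + 1). \<integral>\<^sup>+\<omega>. H \<sigma> (\<omega>, X (t + 1) \<omega>) \<partial>M)"
  proof (intro sum.cong refl)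
    fix \<sigma> assume \<sigma>: "\<sigma> \<in> inj_choices J (t + 1)"
    have "(\<integral>\<^sup>+\<omega>. (\<Sum>\<tau>\<in>level_choices B lev. F \<sigma> (\<omega>, \<lambda>i\<in>B. X (lev i) \<omega> (\<tau> i))) \<partial>M) =
      (\<integral>\<^sup>+\<omega>. \<integral>\<^sup>+s. F \<sigma> (\<omega>, s) * ennreal (level_det (t + 1) (X (t + 1) \<omega>) B lev s) \<partial>?B \<partial>M)"
      using Suc.hyps(2) t JB(2) levB F_meas[OF \<sigma>] by (intro Suc.hyps(1)) auto
    then show "(\<integral>\<^sup>+\<omega>. (\<Sum>\<tau>\<in>level_choices B lev. F \<sigma> (\<omega>, \<lambda>i\<in>B. X (lev i) \<omega> (\<tau> i))) \<partial>M) = (\<integral>\<^sup>+\<omega>. H \<sigma> (\<omega>, X (t + 1) \<omega>) \<partial>M)"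
      by (simp add: F_def H_def)
  qed
  also have "\<dots> = (\<Sum>\<sigma>\<in>inj_choices J (t + 1). \<integral>\<^sup>+\<omega>. \<integral>\<^sup>+y. H \<sigma> (\<omega>, y) * ennreal (gue_density t (X t \<omega>) y) \<partial>?C \<partial>M)"
    by (intro sum.cong refl Markov_property t H_meas)
  also have "\<dots> = (\<integral>\<^sup>+\<omega>. (\<Sum>\<sigma>\<in>inj_choices J (t + 1). \<integral>\<^sup>+y. H \<sigma> (\<omega>, y) * ennreal (gue_density t (X t \<omega>) y) \<partial>?C) \<partial>M)"
    by (intro nn_integral_sum[symmetric] Hd_meas)
  also have "\<dots> = (\<integral>\<^sup>+\<omega>. \<integral>\<^sup>+s. f (\<omega>, s) * ennreal (level_det t (X t \<omega>) I lev s) \<partial>PiM I (\<lambda>_. lborel) \<partial>M)"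
  proof (rule nn_integral_cong_AE)
    \<comment> \<open>\<open>level_step\<close> requires total mass one of the density that starts
      in \<open>X t \<omega>\<close>, which is known almost surely.\<close>
    show "AE \<omega> in M. (\<Sum>\<sigma>\<in>inj_choices J (t + 1). \<integral>\<^sup>+y. H \<sigma> (\<omega>, y) * ennreal (gue_density t (X t \<omega>) y) \<partial>?C) =
      (\<integral>\<^sup>+s. f (\<omega>, s) * ennreal (level_det t (X t \<omega>) I lev s) \<partial>PiM I (\<lambda>_. lborel))"
      using AE_normalized[OF t] AE_space
    proof eventually_elim
      case (elim \<omega>)
      have x: "X t \<omega> \<in> Conf0 t" by (rule X_Conf0[OF t elim(2)])
      let ?D = "\<lambda>y s. ennreal (level_det (t + 1) y B lev s)" and ?p = "\<lambda>y. ennreal (gue_density t (X t \<omega>) y)"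
      have p_meas: "?p \<in> borel_measurable ?C"
        by (intro measurable_compose[OF _ measurable_ennreal] gue_density_measurable) (auto intro: conf_component_measurable)
      have const: "(\<lambda>p. \<omega>) \<in> Q \<rightarrow>\<^sub>M history t" for Q :: "'q measure" using elim(2) by simp
      have G_meas: "(\<lambda>q. f1 \<omega> (g \<sigma> (fst q)) (snd q) * ?D (fst q) (snd q)) \<in> borel_measurable (?C \<Otimes>\<^sub>M ?B)"
        if \<sigma>: "\<sigma> \<in> inj_choices J (t + 1)" for \<sigma>
      proof (intro borel_measurable_times_ennreal f1_meas g_meas \<sigma> const measurable_compose[OF _ measurable_ennreal] level_det_measurable)
        show "(\<lambda>q. snd q i) \<in> borel_measurable (?C \<Otimes>\<^sub>M ?B)" if "i \<in> B" for i
          by (rule measurable_compose[OF measurable_snd component_lborel_measurable[OF that]])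
        show "(\<lambda>q. fst q r) \<in> borel_measurable (?C \<Otimes>\<^sub>M ?B)" if "r \<in> {1..t+1}" for r
          by (rule measurable_compose[OF measurable_fst conf_component_measurable[OF that]])
      qed measurable
      have Gp_meas: "(\<lambda>q. f1 \<omega> (g \<sigma> (fst q)) (snd q) * ?D (fst q) (snd q) * ?p (fst q)) \<in> borel_measurable (?C \<Otimes>\<^sub>M ?B)"
        if \<sigma>: "\<sigma> \<in> inj_choices J (t + 1)" for \<sigma>
        by (rule borel_measurable_times_ennreal[OF G_meas[OF \<sigma>] measurable_compose[OF measurable_fst p_meas]])
      have "(\<Sum>\<sigma>\<in>inj_choices J (t + 1). \<integral>\<^sup>+y. H \<sigma> (\<omega>, y) * ?p y \<partial>?C) =
        (\<Sum>\<sigma>\<in>inj_choices J (t + 1). \<integral>\<^sup>+s. \<integral>\<^sup>+y. f1 \<omega> (g \<sigma> y) s * ?D y s * ?p y \<partial>?C \<partial>?B)"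
      proof (intro sum.cong refl)
        fix \<sigma> assume \<sigma>: "\<sigma> \<in> inj_choices J (t + 1)"
        have "(\<integral>\<^sup>+y. H \<sigma> (\<omega>, y) * ?p y \<partial>?C) = (\<integral>\<^sup>+y. \<integral>\<^sup>+s. f1 \<omega> (g \<sigma> y) s * ?D y s * ?p y \<partial>?B \<partial>?C)"
        proof (intro nn_integral_cong)
          fix y assume y: "y \<in> space ?C"
          have "(\<lambda>s. f1 \<omega> (g \<sigma> y) s * ?D y s) \<in> borel_measurable ?B"
            using measurable_compose[OF measurable_Pair1'[OF y, of ?B] G_meas[OF \<sigma>]] by simp
          then show "H \<sigma> (\<omega>, y) * ?p y = (\<integral>\<^sup>+s. f1 \<omega> (g \<sigma> y) s * ?D y s * ?p y \<partial>?B)"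
            unfolding H_def by (simp add: nn_integral_multc)
        qed
        \<comment> \<open>The positions \<open>s\<close> of the higher levels go outside, because
          \<open>level_step\<close> keeps them fixed.\<close>
        also have "\<dots> = (\<integral>\<^sup>+s. \<integral>\<^sup>+y. f1 \<omega> (g \<sigma> y) s * ?D y s * ?p y \<partial>?C \<partial>?B)"
          by (rule CB.Fubini'[symmetric]) (use Gp_meas[OF \<sigma>] in \<open>simp add: case_prod_beta\<close>)
        finally show "(\<integral>\<^sup>+y. H \<sigma> (\<omega>, y) * ?p y \<partial>?C) = (\<integral>\<^sup>+s. \<integral>\<^sup>+y. f1 \<omega> (g \<sigma> y) s * ?D y s * ?p y \<partial>?C \<partial>?B)" .
      qed
      also have "\<dots> = (\<integral>\<^sup>+s. (\<Sum>\<sigma>\<in>inj_choices J (t + 1). \<integral>\<^sup>+y. f1 \<omega> (g \<sigma> y) s * ?D y s * ?p y \<partial>?C) \<partial>?B)"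
      proof (rule nn_integral_sum[symmetric], rule C.borel_measurable_nn_integral)
        fix \<sigma> assume \<sigma>: "\<sigma> \<in> inj_choices J (t + 1)"
        show "(\<lambda>(s, y). f1 \<omega> (g \<sigma> y) s * ?D y s * ?p y) \<in> borel_measurable (?B \<Otimes>\<^sub>M ?C)"
          using measurable_compose[OF measurable_pair_swap' Gp_meas[OF \<sigma>]] by (simp add: case_prod_beta)
      qed
      also have "\<dots> = (\<integral>\<^sup>+s. \<integral>\<^sup>+z. f1 \<omega> z s * ennreal (level_det t (X t \<omega>) (J \<union> B) lev (override_on s z J)) \<partial>?J \<partial>?B)"
      proof (intro nn_integral_cong)
        fix s assume s: "s \<in> space ?B"
        show "(\<Sum>\<sigma>\<in>inj_choices J (t + 1). \<integral>\<^sup>+y. f1 \<omega> (g \<sigma> y) s * ?D y s * ?p y \<partial>?C) =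
          (\<integral>\<^sup>+z. f1 \<omega> z s * ennreal (level_det t (X t \<omega>) (J \<union> B) lev (override_on s z J)) \<partial>?J)"
          unfolding g_def
          by (rule level_step[OF x elim(1) JB(1-3) levJ levB(1)], assumption+)
             (intro f1_meas const measurable_ident_sets refl measurable_const s)
      qed
      also have "\<dots> = (\<integral>\<^sup>+s. \<integral>\<^sup>+z. f (\<omega>, merge B J (s, z)) * ennreal (level_det t (X t \<omega>) I lev (merge B J (s, z))) \<partial>?J \<partial>?B)"
      proof (intro nn_integral_cong arg_cong2[where f="(*)"] arg_cong[where f=ennreal])
        show "level_det t (X t \<omega>) (J \<union> B) lev (override_on s z J) = level_det t (X t \<omega>) I lev (merge B J (s, z))" for s z
          unfolding JB(5) using JB(3) JB(5) by (intro level_det_cong) (auto simp: override_on_def merge_def)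
      qed (simp add: f1_def)
      also have "\<dots> = (\<integral>\<^sup>+s. f (\<omega>, s) * ennreal (level_det t (X t \<omega>) I lev s) \<partial>PiM (B \<union> J) (\<lambda>_. lborel))"
      proof (rule lborel_product.product_nn_integral_fold[OF JB(4,2,1), symmetric])
        have "(\<lambda>s. f (\<omega>, s)) \<in> borel_measurable (PiM I (\<lambda>_. lborel))"
          by (rule measurable_compose[OF measurable_Pair1' f]) (use elim(2) in simp)
        moreover have "(\<lambda>s. level_det t (X t \<omega>) I lev s) \<in> borel_measurable (PiM I (\<lambda>_. lborel))"
          by (intro level_det_measurable component_lborel_measurable) auto
        ultimately show "(\<lambda>s. f (\<omega>, s) * ennreal (level_det t (X t \<omega>) I lev s)) \<in> borel_measurable (PiM (B \<union> J) (\<lambda>_. lborel))"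
          unfolding JB(6) by measurable
      qed
      finally show ?case unfolding JB(6) .
    qed
  qed
  finally show ?case .
qed

text \<open>At level \<open>m\<close> the configuration is deterministic, so the outer expectation
  disappears.\<close>

lemma factorial_moment:
  fixes I :: "nat set"
  assumes "finite I" "\<And>i. i \<in> I \<Longrightarrow> m < lev i" "f \<in> borel_measurable (PiM I (\<lambda>_. lborel))"
  shows "(\<integral>\<^sup>+\<omega>. (\<Sum>\<sigma>\<in>level_choices I lev. f (\<lambda>i\<in>I. X (lev i) \<omega> (\<sigma> i))) \<partial>M) =
    (\<integral>\<^sup>+s. f s * ennreal (level_det m x I lev s) \<partial>PiM I (\<lambda>_. lborel))"
proof -
  obtain N where N: "\<And>i. i \<in> I \<Longrightarrow> lev i \<le> N"
    using assms(1) by (metis finite_imageI finite_nat_set_iff_bounded_le imageI)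
  have "(\<integral>\<^sup>+\<omega>. (\<Sum>\<sigma>\<in>level_choices I lev. f (\<lambda>i\<in>I. X (lev i) \<omega> (\<sigma> i))) \<partial>M) =
    (\<integral>\<^sup>+\<omega>. \<integral>\<^sup>+s. f s * ennreal (level_det m (X m \<omega>) I lev s) \<partial>PiM I (\<lambda>_. lborel) \<partial>M)"
    using factorial_moment_history[of m I lev N "\<lambda>p. f (snd p)"] assms N
      measurable_compose[OF measurable_snd assms(3), of "history m"] by simp
  also have "\<dots> = (\<integral>\<^sup>+\<omega>. \<integral>\<^sup>+s. f s * ennreal (level_det m x I lev s) \<partial>PiM I (\<lambda>_. lborel) \<partial>M)"
    by (intro nn_integral_cong) (simp add: X_start)
  also have "\<dots> = (\<integral>\<^sup>+s. f s * ennreal (level_det m x I lev s) \<partial>PiM I (\<lambda>_. lborel))"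
    by (simp add: emeasure_space_1)
  finally show ?thesis .
qed

end


subsection \<open>The point process\<close>

lemma emeasure_count_space_image:
  assumes "finite S" "inj_on f S"
  shows "emeasure (count_space UNIV) (f ` {i\<in>S. f i \<in> A}) = (\<Sum>i\<in>S. indicator A (f i))"
proof -
  have "inj_on f {i\<in>S. f i \<in> A}" using assms(2) by (rule inj_on_subset) auto
  then have "emeasure (count_space UNIV) (f ` {i\<in>S. f i \<in> A}) = of_nat (card {i\<in>S. f i \<in> A})"
    using assms(1) by (simp add: card_image)
  also have "\<dots> = (\<Sum>i\<in>S. indicator A (f i))"
    using assms(1) by (simp add: indicator_def sum.If_cases Int_def)
  finally show ?thesis .
qed

section \<open>The product measure in terms of levels and positions\<close>

lemma sigma_finite_level_measure: "sigma_finite_measure (level_measure m)"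
  unfolding level_measure_def
  by (intro sigma_finite_pair_measure sigma_finite_measure_count_space lborel.sigma_finite_measure_axioms)

lemma space_level_measure: "space (level_measure m) = {m<..} \<times> UNIV"
  by (simp add: level_measure_def space_pair_measure)

text \<open>Splits a tuple of points into a vector of levels and a vector of positions. On boxes,
  the equality says that a product of sums over levels is the sum of the products over all level
  vectors.\<close>

lemma PiM_level_measure:
  fixes I :: "nat set" and m :: nat
  assumes I: "finite I"
  defines "L \<equiv> I \<rightarrow>\<^sub>E {m<..}"
  defines "T \<equiv> (\<lambda>(lev, s). \<lambda>i\<in>I. (lev i, s i))"
  shows "T \<in> count_space L \<Otimes>\<^sub>M PiM I (\<lambda>_. lborel) \<rightarrow>\<^sub>M PiM I (\<lambda>_. level_measure m)"
    and "distr (count_space L \<Otimes>\<^sub>M PiM I (\<lambda>_. lborel)) (PiM I (\<lambda>_. level_measure m)) T = PiM I (\<lambda>_. level_measure m)"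
proof -
  have L: "count_space L = PiM I (\<lambda>_. count_space {m<..})"
    unfolding L_def using I by (intro count_space_PiM_finite[symmetric]) auto
  show T: "T \<in> count_space L \<Otimes>\<^sub>M PiM I (\<lambda>_. lborel) \<rightarrow>\<^sub>M PiM I (\<lambda>_. level_measure m)"
    unfolding T_def case_prod_beta L level_measure_def
  proof (intro measurable_restrict measurable_Pair)
    fix i assume i: "i \<in> I"
    show "(\<lambda>p. fst p i) \<in> PiM I (\<lambda>_. count_space {m<..}) \<Otimes>\<^sub>M PiM I (\<lambda>_. lborel) \<rightarrow>\<^sub>M count_space {m<..}"
      by (rule measurable_compose[OF measurable_fst measurable_component_singleton[OF i]])
    show "(\<lambda>p. snd p i) \<in> PiM I (\<lambda>_. count_space {m<..}) \<Otimes>\<^sub>M PiM I (\<lambda>_. lborel) \<rightarrow>\<^sub>M lborel"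
      by (rule measurable_compose[OF measurable_snd measurable_component_singleton[OF i]])
  qed
  interpret lev: product_sigma_finite "\<lambda>_::nat. level_measure m"
    by (rule product_sigma_finite.intro) (rule sigma_finite_level_measure)
  interpret cs: product_sigma_finite "\<lambda>_::nat. count_space {m<..}"
    by (rule product_sigma_finite.intro) (rule sigma_finite_measure_count_space)
  interpret lb: sigma_finite_measure "PiM I (\<lambda>_. lborel :: real measure)"
    by (rule lborel_product.sigma_finite[OF I])
  show "distr (count_space L \<Otimes>\<^sub>M PiM I (\<lambda>_. lborel)) (PiM I (\<lambda>_. level_measure m)) T = PiM I (\<lambda>_. level_measure m)"
  proof (rule lev.PiM_eqI[OF I])
    fix A :: "nat \<Rightarrow> (nat \<times> real) set" assume A: "\<And>i. i \<in> I \<Longrightarrow> A i \<in> sets (level_measure m)"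
    let ?S = "T -` PiE I A \<inter> space (count_space L \<Otimes>\<^sub>M PiM I (\<lambda>_. lborel))"
    have box: "PiE I A \<in> sets (PiM I (\<lambda>_. level_measure m))"
      using A I by (intro sets_PiM_I_finite) auto
    have sec: "Pair n -` A i \<in> sets lborel" if "i \<in> I" for i n
      using A[OF that] unfolding level_measure_def by (rule sets_Pair1)
    have "emeasure (distr (count_space L \<Otimes>\<^sub>M PiM I (\<lambda>_. lborel)) (PiM I (\<lambda>_. level_measure m)) T) (PiE I A) =
      emeasure (count_space L \<Otimes>\<^sub>M PiM I (\<lambda>_. lborel)) ?S"
      by (rule emeasure_distr[OF T box])
    also have "\<dots> = (\<integral>\<^sup>+lev. emeasure (PiM I (\<lambda>_. lborel)) (Pair lev -` ?S) \<partial>count_space L)"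
      by (rule lb.emeasure_pair_measure_alt) (rule measurable_sets[OF T box])
    also have "\<dots> = (\<integral>\<^sup>+lev. (\<Prod>i\<in>I. emeasure lborel (Pair (lev i) -` A i)) \<partial>count_space L)"
    proof (intro nn_integral_cong)
      fix lev assume lev: "lev \<in> space (count_space L)"
      have "Pair lev -` ?S = PiE I (\<lambda>i. Pair (lev i) -` A i)"
        using lev by (auto simp: T_def space_pair_measure space_PiM PiE_def Pi_def)
      then show "emeasure (PiM I (\<lambda>_. lborel)) (Pair lev -` ?S) = (\<Prod>i\<in>I. emeasure lborel (Pair (lev i) -` A i))"
        using lborel_product.emeasure_PiM[OF I sec] by simp
    qed
    also have "\<dots> = (\<Prod>i\<in>I. \<integral>\<^sup>+n. emeasure lborel (Pair n -` A i) \<partial>count_space {m<..})"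
      unfolding L by (rule cs.product_nn_integral_prod[OF I]) simp
    also have "\<dots> = (\<Prod>i\<in>I. emeasure (level_measure m) (A i))"
      using A unfolding level_measure_def by (intro prod.cong refl lborel.emeasure_pair_measure_alt[symmetric]) auto
    finally show "emeasure (distr (count_space L \<Otimes>\<^sub>M PiM I (\<lambda>_. lborel)) (PiM I (\<lambda>_. level_measure m)) T) (PiE I A) =
      (\<Prod>i\<in>I. emeasure (level_measure m) (A i))" .
  qed simp
qed

lemma nn_integral_PiM_level_measure:
  fixes I :: "nat set"
  assumes I: "finite I" and h: "h \<in> borel_measurable (PiM I (\<lambda>_. level_measure m))"
  shows "(\<integral>\<^sup>+p. h p \<partial>PiM I (\<lambda>_. level_measure m)) =
    (\<integral>\<^sup>+lev. \<integral>\<^sup>+s. h (\<lambda>i\<in>I. (lev i, s i)) \<partial>PiM I (\<lambda>_. lborel) \<partial>count_space (I \<rightarrow>\<^sub>E {m<..}))"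
proof -
  interpret lb: sigma_finite_measure "PiM I (\<lambda>_. lborel :: real measure)"
    by (rule lborel_product.sigma_finite[OF I])
  let ?T = "\<lambda>(lev, s). \<lambda>i\<in>I. (lev i, s i)" and ?N = "count_space (I \<rightarrow>\<^sub>E {m<..}) \<Otimes>\<^sub>M PiM I (\<lambda>_. lborel)"
  note T = PiM_level_measure[OF I, of m]
  have "(\<integral>\<^sup>+p. h p \<partial>PiM I (\<lambda>_. level_measure m)) = (\<integral>\<^sup>+q. h (?T q) \<partial>?N)"
    by (subst T(2)[symmetric], rule nn_integral_distr[OF T(1)]) (use h in simp)
  also have "\<dots> = (\<integral>\<^sup>+lev. \<integral>\<^sup>+s. h (?T (lev, s)) \<partial>PiM I (\<lambda>_. lborel) \<partial>count_space (I \<rightarrow>\<^sub>E {m<..}))"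
    by (rule lb.nn_integral_fst[symmetric]) (rule measurable_compose[OF T(1) h])
  finally show ?thesis by simp
qed

lemma level_tuple_measurable:
  assumes "lev \<in> I \<rightarrow>\<^sub>E {m<..}"
  shows "(\<lambda>s. \<lambda>i\<in>I. (lev i, s i)) \<in> PiM I (\<lambda>_. lborel) \<rightarrow>\<^sub>M PiM I (\<lambda>_. level_measure m)"
  unfolding level_measure_def using assms
  by (intro measurable_restrict measurable_Pair measurable_const measurable_component_singleton) auto

definition level_correlation :: "nat \<Rightarrow> (nat \<Rightarrow> real) \<Rightarrow> nat \<Rightarrow> (nat \<Rightarrow> nat \<times> real) \<Rightarrow> real" where
  "level_correlation m x n p = level_det m x {..<n} (fst \<circ> p) (snd \<circ> p)"

text \<open>The levels range over a countable set, so it is enough to fix them and to have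
  measurability in the positions.\<close>

lemma level_kernel_measurable:
  "(\<lambda>(p, q). level_kernel m x p q) \<in> borel_measurable (level_measure m \<Otimes>\<^sub>M level_measure m)"
proof -
  let ?K = "\<lambda>a b. \<lambda>r::(nat \<times> real) \<times> (nat \<times> real). rising_kernel m x (a - m) (b - m - 1) (snd (fst r)) (snd (snd r))"
  let ?N = "level_measure m \<Otimes>\<^sub>M level_measure m"
  have f1: "(\<lambda>r. fst (fst r)) \<in> ?N \<rightarrow>\<^sub>M count_space UNIV" and f2: "(\<lambda>r. fst (snd r)) \<in> ?N \<rightarrow>\<^sub>M count_space UNIV"
  proof -
    have "fst \<in> level_measure m \<rightarrow>\<^sub>M count_space {m<..}" unfolding level_measure_def by (rule measurable_fst)
    then have "fst \<in> level_measure m \<rightarrow>\<^sub>M count_space UNIV" by (rule measurable_compose[of fst, OF _ measurable_count_space])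
    then show "(\<lambda>r. fst (fst r)) \<in> ?N \<rightarrow>\<^sub>M count_space UNIV" "(\<lambda>r. fst (snd r)) \<in> ?N \<rightarrow>\<^sub>M count_space UNIV"
      by (auto intro: measurable_compose[OF measurable_fst] measurable_compose[OF measurable_snd])
  qed
  have "snd \<in> level_measure m \<rightarrow>\<^sub>M borel" unfolding level_measure_def
    using measurable_snd[of "count_space {m<..}" "lborel :: real measure"] by simp
  then have s: "(\<lambda>r. snd (fst r)) \<in> ?N \<rightarrow>\<^sub>M borel" "(\<lambda>r. snd (snd r)) \<in> ?N \<rightarrow>\<^sub>M borel"
    by (auto intro: measurable_compose[OF measurable_fst] measurable_compose[OF measurable_snd])
  have "(\<lambda>r. ?K (fst (fst r)) (fst (snd r)) r) \<in> borel_measurable ?N"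
    by (rule measurable_compose_countable[OF measurable_compose_countable[OF rising_kernel_measurable f2] f1])
       (use s in auto)
  then show ?thesis by (simp add: level_kernel_def case_prod_beta)
qed

lemma level_correlation_measurable:
  "level_correlation m x n \<in> borel_measurable (PiM {..<n} (\<lambda>_. level_measure m))"
  unfolding level_correlation_def level_det_def det_on_def
proof (intro borel_measurable_sum borel_measurable_times borel_measurable_prod borel_measurable_const)
  fix \<pi> i assume "\<pi> \<in> {\<pi>. \<pi> permutes {..<n}}" and i: "i \<in> {..<n}"
  then have "\<pi> i \<in> {..<n}" by (simp only: permutes_in_image mem_Collect_eq)
  with i have "(\<lambda>p. (p i, p (\<pi> i))) \<in> PiM {..<n} (\<lambda>_. level_measure m) \<rightarrow>\<^sub>M level_measure m \<Otimes>\<^sub>M level_measure m"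
    by (intro measurable_Pair measurable_component_singleton)
  from measurable_compose[OF this level_kernel_measurable]
  show "(\<lambda>p. level_kernel m x ((fst \<circ> p) i, (snd \<circ> p) i) ((fst \<circ> p) (\<pi> i), (snd \<circ> p) (\<pi> i)))
    \<in> borel_measurable (PiM {..<n} (\<lambda>_. level_measure m))" by simp
qed

section \<open>Counting tuples of points of the process\<close>

context rising_gue
begin

lemma X_inj:
  assumes "r \<ge> m" "\<omega> \<in> space M" shows "inj_on (X r \<omega>) {1..r}"
  by (rule Conf0_inj_on[OF X_Conf0[OF assms]])

text \<open>A tuple of distinct points is a vector of levels with an index into each configuration,
  no level and index being used twice. The entries of a configuration are distinct, so different
  indices give different points.\<close>

lemma level_points_tuples:
  assumes \<omega>: "\<omega> \<in> space M" and A: "A \<subseteq> extensional I"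
  shows "{p \<in> A. inj_on p I \<and> p ` I \<subseteq> level_points m X \<omega>} =
    (\<Union>lev\<in>I \<rightarrow>\<^sub>E {m<..}. (\<lambda>\<sigma>. \<lambda>i\<in>I. (lev i, X (lev i) \<omega> (\<sigma> i))) `
      {\<sigma>\<in>level_choices I lev. (\<lambda>i\<in>I. (lev i, X (lev i) \<omega> (\<sigma> i))) \<in> A})" (is "?L = ?R")
proof (intro equalityI subsetI)
  fix p assume p: "p \<in> ?L"
  have "\<forall>i\<in>I. \<exists>c. fst (p i) > m \<and> c \<in> {1..fst (p i)} \<and> snd (p i) = X (fst (p i)) \<omega> c"
  proof
    fix i assume "i \<in> I"
    then have "p i \<in> level_points m X \<omega>" using p by auto
    then show "\<exists>c. fst (p i) > m \<and> c \<in> {1..fst (p i)} \<and> snd (p i) = X (fst (p i)) \<omega> c"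
      unfolding level_points_def by auto
  qed
  then obtain c where c: "\<And>i. i \<in> I \<Longrightarrow> fst (p i) > m \<and> c i \<in> {1..fst (p i)} \<and> snd (p i) = X (fst (p i)) \<omega> (c i)"
    by metis
  define lev \<sigma> where "lev = (\<lambda>i\<in>I. fst (p i))" and "\<sigma> = restrict c I"
  have eq: "(\<lambda>i\<in>I. (lev i, X (lev i) \<omega> (\<sigma> i))) = p"
  proof (rule extensionalityI[where A = I])
    show "p \<in> extensional I" using p A by auto
    fix i assume "i \<in> I"
    then show "(\<lambda>i\<in>I. (lev i, X (lev i) \<omega> (\<sigma> i))) i = p i"
      using c[of i] by (simp add: lev_def \<sigma>_def prod_eq_iff)
  qed simp
  have "lev \<in> I \<rightarrow>\<^sub>E {m<..}" using c by (auto simp: lev_def)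
  moreover have "\<sigma> \<in> level_choices I lev"
  proof -
    have "i = j" if "i \<in> I" "j \<in> I" "lev i = lev j" "\<sigma> i = \<sigma> j" for i j
    proof -
      have "p i = p j" using fun_cong[OF eq, of i] fun_cong[OF eq, of j] that by simp
      then show ?thesis using p that by (auto dest: inj_onD)
    qed
    moreover have "\<sigma> \<in> (\<Pi>\<^sub>E i\<in>I. {1..lev i})" using c by (auto simp: \<sigma>_def lev_def)
    ultimately show ?thesis unfolding level_choices_def by blast
  qed
  ultimately show "p \<in> ?R" using eq p by (intro UN_I[of lev] image_eqI[of _ _ \<sigma>]) auto
next
  fix p assume "p \<in> ?R"
  then obtain lev \<sigma> where lev: "lev \<in> I \<rightarrow>\<^sub>E {m<..}" and \<sigma>: "\<sigma> \<in> level_choices I lev"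
    and p: "p = (\<lambda>i\<in>I. (lev i, X (lev i) \<omega> (\<sigma> i)))" "p \<in> A" by auto
  have \<sigma>': "lev i > m" "\<sigma> i \<in> {1..lev i}" if "i \<in> I" for i using \<sigma> lev that by (auto simp: level_choices_def)
  have "inj_on p I"
  proof (rule inj_onI)
    fix i j assume ij: "i \<in> I" "j \<in> I" "p i = p j"
    then have l: "lev i = lev j" and "X (lev i) \<omega> (\<sigma> i) = X (lev i) \<omega> (\<sigma> j)" by (auto simp: p)
    then have "\<sigma> i = \<sigma> j" using inj_on_eq_iff[OF X_inj[of "lev i" \<omega>]] \<omega> \<sigma>'[OF ij(1)] \<sigma>'[OF ij(2)] by simp
    then show "i = j" using \<sigma> ij l unfolding level_choices_def by blast
  qed
  moreover have "p i \<in> level_points m X \<omega>" if "i \<in> I" for i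
    using \<sigma>'[OF that] that unfolding p level_points_def by auto
  ultimately show "p \<in> ?L" using p(2) by auto
qed

lemma count_tuples:
  fixes I :: "nat set"
  assumes \<omega>: "\<omega> \<in> space M" and A: "A \<subseteq> extensional I" and I: "finite I"
  shows "emeasure (count_space UNIV) {p \<in> A. inj_on p I \<and> p ` I \<subseteq> level_points m X \<omega>} =
    (\<integral>\<^sup>+lev. (\<Sum>\<sigma>\<in>level_choices I lev. indicator A (\<lambda>i\<in>I. (lev i, X (lev i) \<omega> (\<sigma> i)))) \<partial>count_space (I \<rightarrow>\<^sub>E {m<..}))"
  unfolding level_points_tuples[OF \<omega> A]
proof (subst emeasure_UN_countable)
  show "countable (I \<rightarrow>\<^sub>E {m<..})" using I by (intro countable_PiE) auto
  let ?f = "\<lambda>lev \<sigma>. \<lambda>i\<in>I. (lev i, X (lev i) \<omega> (\<sigma> i))"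
  show "disjoint_family_on (\<lambda>lev. ?f lev ` {\<sigma>\<in>level_choices I lev. ?f lev \<sigma> \<in> A}) (I \<rightarrow>\<^sub>E {m<..})"
    unfolding disjoint_family_on_def
  proof (intro ballI impI)
    fix lev lev' assume l: "lev \<in> I \<rightarrow>\<^sub>E {m<..}" "lev' \<in> I \<rightarrow>\<^sub>E {m<..}" "lev \<noteq> lev'"
    then obtain i where "i \<in> I" "lev i \<noteq> lev' i" by (metis PiE_ext)
    then have "?f lev \<sigma> \<noteq> ?f lev' \<tau>" for \<sigma> \<tau> by (auto dest: fun_cong[of _ _ i])
    then show "?f lev ` {\<sigma>\<in>level_choices I lev. ?f lev \<sigma> \<in> A} \<inter> ?f lev' ` {\<sigma>\<in>level_choices I lev'. ?f lev' \<sigma> \<in> A} = {}"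
      by blast
  qed
  show "(\<integral>\<^sup>+lev. emeasure (count_space UNIV) (?f lev ` {\<sigma>\<in>level_choices I lev. ?f lev \<sigma> \<in> A}) \<partial>count_space (I \<rightarrow>\<^sub>E {m<..})) =
    (\<integral>\<^sup>+lev. (\<Sum>\<sigma>\<in>level_choices I lev. indicator A (?f lev \<sigma>)) \<partial>count_space (I \<rightarrow>\<^sub>E {m<..}))"
  proof (intro nn_integral_cong emeasure_count_space_image finite_level_choices I inj_onI)
    fix lev \<sigma> \<tau> assume lev: "lev \<in> space (count_space (I \<rightarrow>\<^sub>E {m<..}))"
      and \<sigma>\<tau>: "\<sigma> \<in> level_choices I lev" "\<tau> \<in> level_choices I lev" and eq: "?f lev \<sigma> = ?f lev \<tau>"
    show "\<sigma> = \<tau>"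
    proof (rule PiE_ext)
      show "\<sigma> \<in> (\<Pi>\<^sub>E i\<in>I. {1..lev i})" "\<tau> \<in> (\<Pi>\<^sub>E i\<in>I. {1..lev i})" using \<sigma>\<tau> by (auto simp: level_choices_def)
      fix i assume i: "i \<in> I"
      then have "lev i > m" "\<sigma> i \<in> {1..lev i}" "\<tau> i \<in> {1..lev i}" using \<sigma>\<tau> lev by (auto simp: level_choices_def)
      moreover have "X (lev i) \<omega> (\<sigma> i) = X (lev i) \<omega> (\<tau> i)" using fun_cong[OF eq, of i] i by simp
      ultimately show "\<sigma> i = \<tau> i" using inj_on_eq_iff[OF X_inj[of "lev i" \<omega>]] \<omega> by simp
    qed
  qed
qed simp

lemma choice_measurable:
  assumes "lev \<in> I \<rightarrow>\<^sub>E {m<..}" "\<sigma> \<in> level_choices I lev"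
  shows "(\<lambda>\<omega>. \<lambda>i\<in>I. X (lev i) \<omega> (\<sigma> i)) \<in> M \<rightarrow>\<^sub>M PiM I (\<lambda>_. lborel)"
proof (rule measurable_restrict)
  fix i assume i: "i \<in> I"
  then have "\<sigma> i \<in> {1..lev i}" "m \<le> lev i" using assms by (auto simp: level_choices_def intro: less_imp_le)
  from measurable_compose[OF X_measurable[OF this(2)] conf_component_measurable[OF this(1)]]
  show "(\<lambda>\<omega>. X (lev i) \<omega> (\<sigma> i)) \<in> M \<rightarrow>\<^sub>M lborel" by simp
qed

lemma choice_indicator_measurable:
  assumes A: "A \<in> sets (PiM I (\<lambda>_. level_measure m))" and lev: "lev \<in> I \<rightarrow>\<^sub>E {m<..}" "\<sigma> \<in> level_choices I lev"
  shows "(\<lambda>\<omega>. indicator A (\<lambda>i\<in>I. (lev i, X (lev i) \<omega> (\<sigma> i))) :: ennreal) \<in> borel_measurable M"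
proof -
  have "(\<lambda>s. indicator A (\<lambda>i\<in>I. (lev i, s i)) :: ennreal) \<in> borel_measurable (PiM I (\<lambda>_. lborel))"
    using A by (intro measurable_compose[OF level_tuple_measurable[OF lev(1)] borel_measurable_indicator])
  from measurable_compose[OF choice_measurable[OF lev] this] show ?thesis
    by (rule measurable_cong[THEN iffD1, rotated]) (auto intro!: arg_cong[where f = "indicator A"])
qed

lemma correlation_function_level_correlation:
  "correlation_function M (level_measure m) (level_points m X) n (level_correlation m x n)"
  unfolding correlation_function_def
proof (intro conjI ballI)
  show "level_correlation m x n \<in> borel_measurable (PiM {..<n} (\<lambda>_. level_measure m))"
    by (rule level_correlation_measurable)
  show "0 \<le> level_correlation m x n p" if "p \<in> space (PiM {..<n} (\<lambda>_. level_measure m))" for p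
  proof -
    have "fst (p i) > m" if "i < n" for i
    proof -
      have "p i \<in> {m<..} \<times> UNIV"
        using \<open>p \<in> space _\<close> that unfolding space_PiM space_level_measure by (auto simp: PiE_def Pi_def)
      then show ?thesis by auto
    qed
    then show ?thesis unfolding level_correlation_def by (intro level_det_nonneg start) auto
  qed
  fix A assume A: "A \<in> sets (PiM {..<n} (\<lambda>_. level_measure m))"
  have ext: "A \<subseteq> extensional {..<n}"
    using sets.sets_into_space[OF A] by (auto simp: space_PiM PiE_def)
  let ?L = "{..<n} \<rightarrow>\<^sub>E {m<..}"
  have cnt: "countable ?L" by (intro countable_PiE) auto
  have "(\<integral>\<^sup>+\<omega>. emeasure (count_space UNIV) {p\<in>A. inj_on p {..<n} \<and> p ` {..<n} \<subseteq> level_points m X \<omega>} \<partial>M) =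
    (\<integral>\<^sup>+\<omega>. \<integral>\<^sup>+lev. (\<Sum>\<sigma>\<in>level_choices {..<n} lev. indicator A (\<lambda>i\<in>{..<n}. (lev i, X (lev i) \<omega> (\<sigma> i)))) \<partial>count_space ?L \<partial>M)"
    by (intro nn_integral_cong count_tuples ext) auto
  \<comment> \<open>There are countably many level vectors, so the sum over them may be taken
    outside the expectation.\<close>
  also have "\<dots> = (\<integral>\<^sup>+lev. \<integral>\<^sup>+\<omega>. (\<Sum>\<sigma>\<in>level_choices {..<n} lev. indicator A (\<lambda>i\<in>{..<n}. (lev i, X (lev i) \<omega> (\<sigma> i)))) \<partial>M \<partial>count_space ?L)"
    by (intro nn_integral_count_space_nn_integral cnt borel_measurable_sum choice_indicator_measurable A)
  also have "\<dots> = (\<integral>\<^sup>+lev. \<integral>\<^sup>+s. indicator A (\<lambda>i\<in>{..<n}. (lev i, s i)) * ennreal (level_det m x {..<n} lev s) \<partial>PiM {..<n} (\<lambda>_. lborel) \<partial>count_space ?L)"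
  proof (intro nn_integral_cong)
    fix lev assume "lev \<in> space (count_space ?L)"
    then have lev: "lev \<in> ?L" by simp
    let ?f = "\<lambda>s. indicator A (\<lambda>i\<in>{..<n}. (lev i, s i)) :: ennreal"
    have "?f \<in> borel_measurable (PiM {..<n} (\<lambda>_. lborel))"
      using A by (intro measurable_compose[OF level_tuple_measurable[OF lev] borel_measurable_indicator])
    moreover have "m < lev i" if "i \<in> {..<n}" for i using lev that by auto
    ultimately have "(\<integral>\<^sup>+\<omega>. (\<Sum>\<sigma>\<in>level_choices {..<n} lev. ?f (\<lambda>i\<in>{..<n}. X (lev i) \<omega> (\<sigma> i))) \<partial>M) =
      (\<integral>\<^sup>+s. ?f s * ennreal (level_det m x {..<n} lev s) \<partial>PiM {..<n} (\<lambda>_. lborel))"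
      by (intro factorial_moment) auto
    moreover have "(\<lambda>i\<in>{..<n}. (lev i, (\<lambda>i\<in>{..<n}. X (lev i) \<omega> (\<sigma> i)) i)) = (\<lambda>i\<in>{..<n}. (lev i, X (lev i) \<omega> (\<sigma> i)))" for \<omega> \<sigma>
      by auto
    ultimately show "(\<integral>\<^sup>+\<omega>. (\<Sum>\<sigma>\<in>level_choices {..<n} lev. indicator A (\<lambda>i\<in>{..<n}. (lev i, X (lev i) \<omega> (\<sigma> i)))) \<partial>M) =
      (\<integral>\<^sup>+s. ?f s * ennreal (level_det m x {..<n} lev s) \<partial>PiM {..<n} (\<lambda>_. lborel))"
      by (simp only:)
  qed
  also have "\<dots> = (\<integral>\<^sup>+lev. \<integral>\<^sup>+s. (\<lambda>p. ennreal (level_correlation m x n p) * indicator A p) (\<lambda>i\<in>{..<n}. (lev i, s i)) \<partial>PiM {..<n} (\<lambda>_. lborel) \<partial>count_space ?L)"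
  proof (intro nn_integral_cong)
    fix lev and s :: "nat \<Rightarrow> real"
    have "level_correlation m x n (\<lambda>i\<in>{..<n}. (lev i, s i)) = level_det m x {..<n} lev s"
      unfolding level_correlation_def by (intro level_det_cong) auto
    then show "indicator A (\<lambda>i\<in>{..<n}. (lev i, s i)) * ennreal (level_det m x {..<n} lev s) =
      (\<lambda>p. ennreal (level_correlation m x n p) * indicator A p) (\<lambda>i\<in>{..<n}. (lev i, s i))"
      by (simp add: mult.commute)
  qed
  also have "\<dots> = (\<integral>\<^sup>+p\<in>A. ennreal (level_correlation m x n p) \<partial>PiM {..<n} (\<lambda>_. level_measure m))"
  proof (rule nn_integral_PiM_level_measure[symmetric])
    show "(\<lambda>p. ennreal (level_correlation m x n p) * indicator A p) \<in> borel_measurable (PiM {..<n} (\<lambda>_. level_measure m))"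
      using A by (intro borel_measurable_times_ennreal measurable_compose[OF level_correlation_measurable measurable_ennreal] borel_measurable_indicator)
  qed simp
  finally show "(\<integral>\<^sup>+\<omega>. emeasure (count_space UNIV) {p\<in>A. inj_on p {..<n} \<and> p ` {..<n} \<subseteq> level_points m X \<omega>} \<partial>M) =
    (\<integral>\<^sup>+p\<in>A. ennreal (level_correlation m x n p) \<partial>PiM {..<n} (\<lambda>_. level_measure m))" .
qed

text \<open>The levels form a discrete space, so a compact set meets only finitely many of them, and
  each has finitely many points.\<close>

lemma level_points_locally_finite:
  assumes "compact C"
  shows "finite (level_points m X \<omega> \<inter> C)"
proof -
  have "compact (fst ` C)" by (intro compact_continuous_image continuous_on_fst continuous_on_id assms)
  moreover have "open {n}" if "n \<in> fst ` C" for n :: nat by (rule discrete_topology_class.open_discrete)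
  moreover have "fst ` C \<subseteq> (\<Union>n\<in>fst ` C. {n})" by blast
  ultimately obtain D where D: "finite D" "fst ` C \<subseteq> (\<Union>n\<in>D. {n})"
    by (rule compactE_image)
  have "level_points m X \<omega> \<inter> C \<subseteq> (\<Union>n\<in>D. (\<lambda>i. (n, X n \<omega> i)) ` {1..n})"
    using D(2) unfolding level_points_def by force
  then show ?thesis by (rule finite_subset) (use D(1) in auto)
qed

lemma level_points_count_measurable:
  assumes A: "A \<in> sets (level_measure m)"
  shows "(\<lambda>\<omega>. emeasure (count_space UNIV) (level_points m X \<omega> \<inter> A)) \<in> borel_measurable M"
proof -
  have eq: "emeasure (count_space UNIV) (level_points m X \<omega> \<inter> A) =
    (\<integral>\<^sup>+n. (\<Sum>i\<in>{1..n}. indicator A (n, X n \<omega> i)) \<partial>count_space {m<..})" if \<omega>: "\<omega> \<in> space M" for \<omega>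
  proof -
    have "level_points m X \<omega> \<inter> A = (\<Union>n\<in>{m<..}. (\<lambda>i. (n, X n \<omega> i)) ` {i\<in>{1..n}. (n, X n \<omega> i) \<in> A})"
      unfolding level_points_def by auto
    also have "emeasure (count_space UNIV) \<dots> =
      (\<integral>\<^sup>+n. emeasure (count_space UNIV) ((\<lambda>i. (n, X n \<omega> i)) ` {i\<in>{1..n}. (n, X n \<omega> i) \<in> A}) \<partial>count_space {m<..})"
      by (rule emeasure_UN_countable) (auto simp: disjoint_family_on_def)
    also have "\<dots> = (\<integral>\<^sup>+n. (\<Sum>i\<in>{1..n}. indicator A (n, X n \<omega> i)) \<partial>count_space {m<..})"
    proof (intro nn_integral_cong emeasure_count_space_image inj_onI)
      fix n i j assume "n \<in> space (count_space {m<..})" "i \<in> {1..n}" "j \<in> {1..n}" "(n, X n \<omega> i) = (n, X n \<omega> j)"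
      then show "i = j" using inj_on_eq_iff[OF X_inj[OF _ \<omega>, of n]] by simp
    qed simp
    finally show ?thesis .
  qed
  interpret cs: sigma_finite_measure "count_space {m<..}" by (rule sigma_finite_measure_count_space)
  have "(\<lambda>\<omega>. \<integral>\<^sup>+n. (\<Sum>i\<in>{1..n}. indicator A (n, X n \<omega> i)) \<partial>count_space {m<..}) \<in> borel_measurable M"
  proof (rule cs.borel_measurable_nn_integral)
    have "(\<lambda>(n, \<omega>). \<Sum>i\<in>{1..n}. indicator A (n, X n \<omega> i) :: ennreal) \<in> borel_measurable (count_space {m<..} \<Otimes>\<^sub>M M)"
    proof (rule measurable_pair_measure_countable1)
      fix n assume n: "n \<in> {m<..}"
      have "(\<lambda>\<omega>. (n, X n \<omega> i)) \<in> M \<rightarrow>\<^sub>M level_measure m" if "i \<in> {1..n}" for i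
        unfolding level_measure_def
        using measurable_compose[OF X_measurable[of n] conf_component_measurable[OF that]] n by (intro measurable_Pair) auto
      then show "(\<lambda>\<omega>. (\<lambda>(n, \<omega>). \<Sum>i\<in>{1..n}. indicator A (n, X n \<omega> i) :: ennreal) (n, \<omega>)) \<in> borel_measurable M"
        using A by (auto intro!: borel_measurable_sum measurable_compose[OF _ borel_measurable_indicator])
    qed simp
    from measurable_compose[OF measurable_pair_swap' this]
    show "(\<lambda>(\<omega>, n). \<Sum>i\<in>{1..n}. indicator A (n, X n \<omega> i) :: ennreal) \<in> borel_measurable (M \<Otimes>\<^sub>M count_space {m<..})"
      by (simp add: case_prod_beta)
  qed
  then show ?thesis by (rule measurable_cong[THEN iffD1, rotated]) (simp add: eq)
qed

lemma level_points_determinantal: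
  "determinantal M (level_measure m) (level_points m X) (\<lambda>p q. complex_of_real (level_kernel m x p q))"
  unfolding determinantal_def
proof (intro conjI allI impI)
  show "simple_point_process M (level_measure m) (level_points m X)"
    unfolding simple_point_process_def space_level_measure
    using prob_space_axioms level_points_locally_finite level_points_count_measurable
    by (auto simp: level_points_def)
  fix n :: nat
  have "complex_of_real (level_correlation m x n p) =
    Determinant.det (Matrix.mat n n (\<lambda>(i, j). complex_of_real (level_kernel m x (p i) (p j))))" for p
    unfolding level_correlation_def level_det_def det_on_eq_det[symmetric] det_on_def by simp
  then show "\<exists>\<rho>. correlation_function M (level_measure m) (level_points m X) n \<rho> \<and>
    (AE p in PiM {..<n} (\<lambda>_. level_measure m). complex_of_real (\<rho> p) =
       Determinant.det (Matrix.mat n n (\<lambda>(i, j). complex_of_real (level_kernel m x (p i) (p j)))))"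
    using correlation_function_level_correlation by auto
qed

end


subsection \<open>Integrals over vertical lines\<close>

lemma rapid_decay_mono:
  assumes "rapid_decay g" "\<And>w. \<bar>f w\<bar> \<le> \<bar>g w\<bar>"
  shows "rapid_decay f"
  unfolding rapid_decay_def
proof
  fix n
  obtain C where "\<And>w. \<bar>w\<bar> ^ n * \<bar>g w\<bar> \<le> C" using assms(1) unfolding rapid_decay_def by meson
  moreover have "\<bar>w\<bar> ^ n * \<bar>f w\<bar> \<le> \<bar>w\<bar> ^ n * \<bar>g w\<bar>" for w using assms(2) by (intro mult_left_mono) auto
  ultimately show "\<exists>C. \<forall>w. \<bar>w\<bar> ^ n * \<bar>f w\<bar> \<le> C" by (meson order_trans)
qed

text \<open>Continuity gives measurability and the decay gives integrability, so every integral over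
  the line that is split below converges absolutely.\<close>

definition line_decay :: "real \<Rightarrow> (complex \<Rightarrow> complex) \<Rightarrow> bool" where
  "line_decay b h \<longleftrightarrow> continuous_on UNIV (\<lambda>t. h (Complex b t)) \<and> rapid_decay (\<lambda>t. norm (h (Complex b t)))"

lemma line_decay_exp: "line_decay b (\<lambda>z. exp (z\<^sup>2 / 2))"
  unfolding line_decay_def
proof
  show "continuous_on UNIV (\<lambda>t. exp ((Complex b t)\<^sup>2 / 2))"
    by (intro continuous_intros) auto
  have "norm (exp ((Complex b t)\<^sup>2 / 2)) = exp (b\<^sup>2 / 2) * gauss t" for t
    by (simp add: norm_exp_eq_Re power2_eq_square gauss_def diff_divide_distrib flip: exp_add)
  then show "rapid_decay (\<lambda>t. norm (exp ((Complex b t)\<^sup>2 / 2)))"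
    using rapid_decay_cmult[OF rapid_decay_gauss] by simp
qed

lemma line_decay_add: "line_decay b f \<Longrightarrow> line_decay b h \<Longrightarrow> line_decay b (\<lambda>z. f z + h z)"
  unfolding line_decay_def
  using rapid_decay_mono[OF rapid_decay_add, of "\<lambda>t. norm (f (Complex b t))" "\<lambda>t. norm (h (Complex b t))"
      "\<lambda>t. norm (f (Complex b t) + h (Complex b t))"]
  by (auto intro: continuous_on_add order_trans[OF norm_triangle_ineq])

lemma line_decay_cmult: "line_decay b f \<Longrightarrow> line_decay b (\<lambda>z. c * f z)"
  unfolding line_decay_def
  using rapid_decay_cmult[of "\<lambda>t. norm (f (Complex b t))" "norm c"]
  by (auto simp: norm_mult intro: continuous_on_mult)

lemma line_decay_zero: "line_decay b (\<lambda>z. 0)"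
  by (simp add: line_decay_def rapid_decay_zero)

lemma line_decay_diff: "line_decay b f \<Longrightarrow> line_decay b h \<Longrightarrow> line_decay b (\<lambda>z. f z - h z)"
  using line_decay_add[of b f "\<lambda>z. (-1) * h z"] line_decay_cmult[of b h "-1"] by simp

lemma line_decay_sum: "(\<And>i. i \<in> I \<Longrightarrow> line_decay b (f i)) \<Longrightarrow> line_decay b (\<lambda>z. \<Sum>i\<in>I. f i z)"
  by (induction I rule: infinite_finite_induct) (auto intro: line_decay_add line_decay_zero)

lemma line_decay_ident_mult:
  assumes "line_decay b f" shows "line_decay b (\<lambda>z. z * f z)"
  unfolding line_decay_def
proof
  show "continuous_on UNIV (\<lambda>t. Complex b t * f (Complex b t))"
    using assms unfolding line_decay_def by (intro continuous_intros) auto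
  let ?n = "\<lambda>t. norm (f (Complex b t))"
  have "rapid_decay (\<lambda>t. b * ?n t)" "rapid_decay (\<lambda>t. t * ?n t)"
    using assms unfolding line_decay_def by (auto intro: rapid_decay_cmult rapid_decay_ident_mult)
  then have "rapid_decay (\<lambda>t. \<bar>b * ?n t\<bar> + \<bar>t * ?n t\<bar>)"
    by (intro rapid_decay_add) (auto simp: rapid_decay_def)
  then show "rapid_decay (\<lambda>t. norm (Complex b t * f (Complex b t)))"
  proof (rule rapid_decay_mono)
    fix t
    have "norm (Complex b t) \<le> \<bar>b\<bar> + \<bar>t\<bar>" using cmod_le[of "Complex b t"] by simp
    then have "norm (Complex b t) * ?n t \<le> (\<bar>b\<bar> + \<bar>t\<bar>) * ?n t" by (rule mult_right_mono) simp
    then show "\<bar>norm (Complex b t * f (Complex b t))\<bar> \<le> \<bar>\<bar>b * ?n t\<bar> + \<bar>t * ?n t\<bar>\<bar>"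
      by (simp add: norm_mult abs_mult distrib_right)
  qed
qed

text \<open>On the line the modulus of the denominator is at least
  \<open>\<bar>Re u - b\<bar>\<close>.\<close>

lemma line_decay_divide:
  assumes "line_decay b f" "Re u \<noteq> b" shows "line_decay b (\<lambda>z. f z / (u - z))"
  unfolding line_decay_def
proof
  have ne: "u - Complex b t \<noteq> 0" for t using assms(2) by (auto simp: complex_eq_iff)
  show "continuous_on UNIV (\<lambda>t. f (Complex b t) / (u - Complex b t))"
    using assms(1) ne unfolding line_decay_def by (intro continuous_intros) auto
  have "rapid_decay (\<lambda>t. 1 / \<bar>Re u - b\<bar> * norm (f (Complex b t)))"
    using assms(1) unfolding line_decay_def by (intro rapid_decay_cmult) auto
  then show "rapid_decay (\<lambda>t. norm (f (Complex b t) / (u - Complex b t)))"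
  proof (rule rapid_decay_mono)
    fix t
    have "\<bar>Re u - b\<bar> \<le> norm (u - Complex b t)" using abs_Re_le_cmod[of "u - Complex b t"] by simp
    then show "\<bar>norm (f (Complex b t) / (u - Complex b t))\<bar> \<le> \<bar>1 / \<bar>Re u - b\<bar> * norm (f (Complex b t))\<bar>"
      using assms(2) by (auto simp: norm_divide intro!: frac_le)
  qed
qed

lemma line_decay_power_mult:
  assumes "line_decay b f" shows "line_decay b (\<lambda>z. (z - v) ^ l * f z)"
proof (induction l)
  case (Suc l)
  have "line_decay b (\<lambda>z. z * ((z - v) ^ l * f z) - v * ((z - v) ^ l * f z))"
    by (intro line_decay_diff line_decay_ident_mult line_decay_cmult Suc)
  then show ?case by (simp add: algebra_simps)
qed (use assms in simp)

lemma line_decay_integrable: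
  assumes "line_decay b f" shows "integrable lborel (\<lambda>t. f (Complex b t))"
proof -
  have [measurable]: "(\<lambda>t. f (Complex b t)) \<in> borel_measurable borel"
    using assms unfolding line_decay_def by (intro borel_measurable_continuous_onI) auto
  have "integrable lborel (\<lambda>t. norm (f (Complex b t)))"
    using assms unfolding line_decay_def by (intro rapid_decay_integrable) auto
  then show ?thesis by (subst integrable_norm_iff[symmetric]) auto
qed

section \<open>Linearity and integration by parts on vertical lines\<close>

lemma vertical_line_integral_add:
  "line_decay b f \<Longrightarrow> line_decay b h \<Longrightarrow>
    vertical_line_integral b (\<lambda>z. f z + h z) = vertical_line_integral b f + vertical_line_integral b h"
  by (simp add: vertical_line_integral_def distrib_right line_decay_integrable)

lemma vertical_line_integral_cmult:
  "vertical_line_integral b (\<lambda>z. c * f z) = c * vertical_line_integral b f"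
  by (simp add: vertical_line_integral_def)

lemma vertical_line_integral_diff:
  "line_decay b f \<Longrightarrow> line_decay b h \<Longrightarrow>
    vertical_line_integral b (\<lambda>z. f z - h z) = vertical_line_integral b f - vertical_line_integral b h"
  by (simp add: vertical_line_integral_def left_diff_distrib line_decay_integrable)

lemma vertical_line_integral_sum:
  "(\<And>i. i \<in> I \<Longrightarrow> line_decay b (f i)) \<Longrightarrow>
    vertical_line_integral b (\<lambda>z. \<Sum>i\<in>I. f i z) = (\<Sum>i\<in>I. vertical_line_integral b (f i))"
  by (induction I rule: infinite_finite_induct)
     (simp_all add: vertical_line_integral_add line_decay_sum, simp_all add: vertical_line_integral_def)

text \<open>The boundary terms at both ends of the line vanish. All integrations by parts below are
  instances for a suitable \<open>H\<close>.\<close>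

lemma vertical_line_integral_deriv:
  assumes H: "line_decay b H" and h: "line_decay b h"
    and deriv: "\<And>z. Re z = b \<Longrightarrow> (H has_field_derivative h z) (at z)"
  shows "vertical_line_integral b h = 0"
proof -
  have tend: "((\<lambda>t. H (Complex b t)) \<longlongrightarrow> 0) at_top" "((\<lambda>t. H (Complex b t)) \<longlongrightarrow> 0) at_bot"
    using H rapid_decay_tendsto[of "\<lambda>t. norm (H (Complex b t))"]
    by (auto simp: line_decay_def tendsto_norm_zero_iff)
  have cont: "continuous_on UNIV (\<lambda>t. h (Complex b t) * \<i>)"
    using h unfolding line_decay_def by (intro continuous_intros) auto
  have "(LBINT t=-\<infinity>..\<infinity>. h (Complex b t) * \<i>) = 0 - 0"
  proof (rule interval_integral_FTC_integrable)
    fix t :: real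
    have "((\<lambda>t. Complex b t) has_vector_derivative \<i>) (at t)"
      unfolding Complex_eq has_vector_derivative_def
      by (auto intro!: derivative_eq_intros simp: scaleR_conv_of_real mult.commute)
    from field_vector_diff_chain_at[OF this deriv[of "Complex b t"]]
    show "((\<lambda>t. H (Complex b t)) has_vector_derivative h (Complex b t) * \<i>) (at t)"
      by (simp add: o_def mult.commute)
    show "isCont (\<lambda>t. h (Complex b t) * \<i>) t" using cont by (simp add: continuous_on_eq_continuous_at)
  next
    show "set_integrable lborel (einterval (- \<infinity>) \<infinity>) (\<lambda>t. h (Complex b t) * \<i>)"
      using line_decay_integrable[OF h] by (simp add: set_integrable_def einterval_def)
  qed (use tend in \<open>auto simp: ereal_tendsto_simps1\<close>)
  then show ?thesis
    by (simp add: vertical_line_integral_def interval_lebesgue_integral_def set_lebesgue_integral_def einterval_def)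
qed

text \<open>Up to \<open>exp (b^2 / 2)\<close> and normalization, this is the characteristic
  function of the standard normal distribution at \<open>b\<close>, which is
  \<open>exp (- b^2 / 2)\<close>; so the value does not depend on \<open>b\<close>.\<close>

lemma vertical_gauss_integral:
  "vertical_line_integral b (\<lambda>z. exp (z\<^sup>2 / 2)) = 2 * pi * \<i> * hermite_coeff 0 v"
proof -
  have "char std_normal_distribution b = (\<integral>t. std_normal_density t *\<^sub>R iexp (b * t) \<partial>lborel)"
    unfolding char_def by (subst integral_density) auto
  then have c: "(\<integral>t. std_normal_density t *\<^sub>R iexp (b * t) \<partial>lborel) = exp (- (b\<^sup>2 / 2))"
    unfolding char_std_normal_distribution by (simp flip: exp_of_real)
  have e: "exp ((Complex b t)\<^sup>2 / 2) = (sqrt (2 * pi) * exp (b\<^sup>2 / 2)) * (std_normal_density t *\<^sub>R iexp (b * t))" for t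
  proof -
    have "(Complex b t)\<^sup>2 / 2 = complex_of_real (b\<^sup>2 / 2) + (complex_of_real (- t\<^sup>2 / 2) + \<i> * complex_of_real (b * t))"
      by (simp add: complex_eq_iff power2_eq_square)
    then have "exp ((Complex b t)\<^sup>2 / 2) = exp (complex_of_real (b\<^sup>2 / 2)) *
        (exp (complex_of_real (- t\<^sup>2 / 2)) * exp (\<i> * complex_of_real (b * t)))"
      by (simp only: exp_add)
    then show ?thesis
      by (simp add: std_normal_density_def scaleR_conv_of_real flip: exp_of_real)
  qed
  have "vertical_line_integral b (\<lambda>z. exp (z\<^sup>2 / 2)) = (sqrt (2 * pi) * exp (b\<^sup>2 / 2)) * (\<integral>t. std_normal_density t *\<^sub>R iexp (b * t) \<partial>lborel) * \<i>"
    unfolding vertical_line_integral_def e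
    by (simp only: mult.assoc integral_mult_right_zero integral_mult_left_zero)
  also have "\<dots> = sqrt (2 * pi) * \<i>"
    unfolding c by (simp flip: exp_of_real exp_add)
  also have "\<dots> = 2 * pi * \<i> * hermite_coeff 0 v"
  proof -
    have "sqrt (2 * pi) = 2 * pi * hermite_coeff 0 v" by (simp add: real_div_sqrt)
    then have "complex_of_real (sqrt (2 * pi)) = complex_of_real (2 * pi * hermite_coeff 0 v)" by (rule arg_cong)
    then show ?thesis by (simp add: mult_ac del: hermite_coeff.simps)
  qed
  finally show ?thesis .
qed

text \<open>The integral of the derivative of \<open>(z - v)^l * exp (z^2 / 2)\<close> is zero. With
  \<open>z = (z - v) + v\<close> this becomes the three-term recursion of
  \<open>hermite_coeff\<close>, with factorials.\<close>

lemma vertical_moment: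
  "vertical_line_integral b (\<lambda>z. (z - of_real v) ^ l * exp (z\<^sup>2 / 2)) = 2 * pi * \<i> * fact l * hermite_coeff l v"
proof -
  let ?M = "\<lambda>l. vertical_line_integral b (\<lambda>z. (z - of_real v) ^ l * exp (z\<^sup>2 / 2))"
  have dec: "line_decay b (\<lambda>z. (z - of_real v) ^ l * exp (z\<^sup>2 / 2))" for l
    by (intro line_decay_power_mult line_decay_exp)
  have rec0: "?M (Suc 0) = - v * ?M 0"
  proof -
    have "vertical_line_integral b (\<lambda>z. (z - of_real v) ^ Suc 0 * exp (z\<^sup>2 / 2) + v * ((z - of_real v) ^ 0 * exp (z\<^sup>2 / 2))) = 0"
      by (rule vertical_line_integral_deriv[OF line_decay_exp])
         (intro line_decay_add line_decay_cmult dec, auto intro!: derivative_eq_intros simp: algebra_simps)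
    then show ?thesis
      by (subst (asm) vertical_line_integral_add)
         (auto intro!: line_decay_cmult dec[of 0, simplified] dec[of 1, simplified] simp: vertical_line_integral_cmult eq_neg_iff_add_eq_0)
  qed
  have rec: "?M (Suc (Suc l)) = - (v * ?M (Suc l) + of_nat (Suc l) * ?M l)" for l
  proof -
    have "vertical_line_integral b (\<lambda>z. (z - of_real v) ^ Suc (Suc l) * exp (z\<^sup>2 / 2) + (v * ((z - of_real v) ^ Suc l * exp (z\<^sup>2 / 2))
       + of_nat (Suc l) * ((z - of_real v) ^ l * exp (z\<^sup>2 / 2)))) = 0"
    proof (rule vertical_line_integral_deriv[OF dec[of "Suc l"]])
      show "line_decay b (\<lambda>z. (z - of_real v) ^ Suc (Suc l) * exp (z\<^sup>2 / 2) + (v * ((z - of_real v) ^ Suc l * exp (z\<^sup>2 / 2))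
       + of_nat (Suc l) * ((z - of_real v) ^ l * exp (z\<^sup>2 / 2))))"
        by (intro line_decay_add line_decay_cmult dec)
      fix z :: complex
      show "((\<lambda>z. (z - of_real v) ^ Suc l * exp (z\<^sup>2 / 2)) has_field_derivative
        ((z - of_real v) ^ Suc (Suc l) * exp (z\<^sup>2 / 2) + (v * ((z - of_real v) ^ Suc l * exp (z\<^sup>2 / 2))
       + of_nat (Suc l) * ((z - of_real v) ^ l * exp (z\<^sup>2 / 2))))) (at z)"
        by (rule derivative_eq_intros refl | simp add: algebra_simps)+
    qed
    then have "?M (Suc (Suc l)) + (v * ?M (Suc l) + of_nat (Suc l) * ?M l) = 0"
      using dec by (simp only: vertical_line_integral_add vertical_line_integral_cmult line_decay_add line_decay_cmult)
    then show ?thesis unfolding eq_neg_iff_add_eq_0 .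
  qed
  have "?M l = 2 * pi * \<i> * fact l * hermite_coeff l v \<and> ?M (Suc l) = 2 * pi * \<i> * fact (Suc l) * hermite_coeff (Suc l) v"
  proof (induction l)
    case 0
    have "?M 0 = 2 * pi * \<i> * fact 0 * hermite_coeff 0 v" using vertical_gauss_integral[of b v] by simp
    then show ?case using rec0 by simp
  next
    case (Suc l)
    have h: "complex_of_real (hermite_coeff l v) = - (of_nat (Suc (Suc l)) * hermite_coeff (Suc (Suc l)) v + v * hermite_coeff (Suc l) v)"
    proof -
      have "hermite_coeff l v = - (real (Suc (Suc l)) * hermite_coeff (Suc (Suc l)) v + v * hermite_coeff (Suc l) v)"
        unfolding hermite_coeff_Suc_Suc' by simp
      then show ?thesis by (metis of_real_add of_real_minus of_real_mult of_real_of_nat_eq)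
    qed
    have "?M (Suc (Suc l)) = 2 * pi * \<i> * fact (Suc (Suc l)) * hermite_coeff (Suc (Suc l)) v"
      unfolding rec conjunct1[OF Suc] conjunct2[OF Suc] h
      by (simp add: algebra_simps del: hermite_coeff.simps)
    then show ?case using Suc by blast
  qed
  then show ?thesis by blast
qed

lemma normal_shift_integral:
  assumes "c = 1 \<or> c = -1"
  shows "(LINT s:{0<..}|lborel. std_normal_density (u - c * s)) = (if c = 1 then normal_cdf u else 1 - normal_cdf u)"
proof -
  have "(LINT s:{0<..}|lborel. std_normal_density (u - c * s)) = (\<integral>s. indicator {y. c * y < c * u} (u + (- c) * s) *\<^sub>R std_normal_density (u + (- c) * s) \<partial>lborel)"
    unfolding set_lebesgue_integral_def using assms by (intro Bochner_Integration.integral_cong) (auto simp: indicator_def)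
  also have "\<dots> = (LINT y:{y. c * y < c * u}|lborel. std_normal_density y)"
    unfolding set_lebesgue_integral_def using assms
    by (subst lborel_integral_real_affine[of "- c" _ u]) auto
  also have "\<dots> = (if c = 1 then normal_cdf u else 1 - normal_cdf u)"
  proof (cases "c = 1")
    case True
    have "(LINT y:{y. c * y < c * u}|lborel. std_normal_density y) = (LINT y:{..u}|lborel. std_normal_density y)"
      unfolding set_lebesgue_integral_def using AE_lborel_singleton[of u] True
      by (intro integral_cong_AE) (auto simp: indicator_def elim!: eventually_mono)
    then show ?thesis using True by (simp add: normal_cdf_def)
  next
    case False
    then have "{y. c * y < c * u} = {u<..}" using assms by auto
    then show ?thesis using False by (simp add: normal_cdf_compl)
  qed
  finally show ?thesis .
qed

text \<open>Written with \<open>1 / (z - u) = \<integral> exp (- (z - u) * s) ds\<close>, the integral is a Gaussian tail.\<close>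
lemma vertical_Cauchy_gauss:
  assumes c: "c = 1 \<or> c = (-1::real)" and cb: "c * (b - u) > 0"
  shows "vertical_line_integral b (\<lambda>z. exp (z\<^sup>2 / 2) / (of_real u - z)) =
    - 2 * pi * \<i> * of_real (exp (u\<^sup>2 / 2)) * of_real (c * (if c = 1 then normal_cdf u else 1 - normal_cdf u))"
proof -
  define f where "f = (\<lambda>t s. indicator {0<..} s *\<^sub>R (exp ((Complex b t)\<^sup>2 / 2) * exp (- of_real (c * s) * (Complex b t - of_real u))))"
  \<comment> \<open>\<open>c\<close> tells on which side of \<open>u\<close> the line lies;
    \<open>d\<close> is the real part of \<open>c * (z - u)\<close> on it and hence the rate of
    decay in \<open>s\<close>.\<close>
  define d where "d = c * (b - u)"
  have c2: "c * c = 1" using c by auto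
  have norm_f: "norm (f t s) = exp (b\<^sup>2 / 2) * gauss t * (indicator {0<..} s * exp (- d * s))" for t s
  proof (cases "0 < s")
    case True
    have "f t s = exp ((Complex b t)\<^sup>2 / 2 + - of_real (c * s) * (Complex b t - of_real u))"
      using True by (simp only: f_def exp_add) simp
    then have "norm (f t s) = exp (Re ((Complex b t)\<^sup>2 / 2 + - of_real (c * s) * (Complex b t - of_real u)))"
      by (simp only: norm_exp_eq_Re)
    also have "Re ((Complex b t)\<^sup>2 / 2 + - of_real (c * s) * (Complex b t - of_real u)) = b\<^sup>2 / 2 + (- t\<^sup>2 / 2 + - d * s)"
      by (simp add: d_def power2_eq_square algebra_simps diff_divide_distrib)
    finally show ?thesis using True by (simp only: exp_add gauss_def) simp
  qed (simp add: f_def)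
  have d: "d > 0" using cb by (simp add: d_def)
  have int_s: "integrable lborel (\<lambda>s. indicator {0<..} s * exp (- d * s) :: real)"
    using integrable_I0i_exp_mscale[OF d] by (simp add: set_integrable_def mult.commute greaterThan_def)
  have f_meas: "case_prod f \<in> borel_measurable (lborel \<Otimes>\<^sub>M lborel)"
  proof -
    have "(\<lambda>p. exp ((Complex b (fst p))\<^sup>2 / 2) * exp (- of_real (c * snd p) * (Complex b (fst p) - of_real u))) \<in> borel_measurable borel"
      by (intro borel_measurable_continuous_onI continuous_intros) auto
    moreover have "(\<lambda>p::real \<times> real. indicator {0<..} (snd p) :: real) \<in> borel_measurable borel"
    proof -
      have [measurable]: "(snd :: real \<times> real \<Rightarrow> real) \<in> borel_measurable borel"
        by (intro borel_measurable_continuous_onI continuous_intros)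
      show ?thesis by measurable
    qed
    ultimately have "(\<lambda>p. f (fst p) (snd p)) \<in> borel_measurable borel"
      unfolding f_def by (intro borel_measurable_scaleR)
    then show ?thesis by (simp add: lborel_prod case_prod_beta')
  qed
  have int_ft: "integrable lborel (f t)" for t
  proof -
    have "(\<lambda>s. f t s) \<in> borel_measurable lborel"
      using measurable_compose[OF measurable_Pair1' f_meas, of t] by simp
    moreover have "integrable lborel (\<lambda>s. norm (f t s))"
      unfolding norm_f by (intro integrable_mult_right int_s)
    ultimately show ?thesis by (simp add: integrable_norm_iff)
  qed
  have int_f: "integrable (lborel \<Otimes>\<^sub>M lborel) (case_prod f)"
  proof (rule lborel_pair.Fubini_integrable[OF f_meas])
    have "integrable lborel (\<lambda>t. (LBINT s. indicator {0<..} s * exp (- d * s)) * (exp (b\<^sup>2 / 2) * gauss t))"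
      by (intro integrable_mult_right rapid_decay_integrable rapid_decay_gauss) simp
    then show "integrable lborel (\<lambda>t. LBINT s. norm (case_prod f (t, s)))"
      by (simp add: norm_f mult.commute)
  qed (use int_ft in simp)
  have inner_s: "(\<integral>s. f t s \<partial>lborel) = exp ((Complex b t)\<^sup>2 / 2) * (c / (Complex b t - of_real u))" for t
  proof -
    define \<zeta> where "\<zeta> = of_real c * (Complex b t - of_real u)"
    have Re: "Re \<zeta> = d" by (simp add: \<zeta>_def d_def)
    then have "\<zeta> \<noteq> 0" using d by auto
    have f: "f t s = indicator {0<..} s *\<^sub>R (exp ((Complex b t)\<^sup>2 / 2) * exp (- \<zeta> * of_real s))" for s
      by (simp add: f_def \<zeta>_def mult_ac)
    have F1: "(LBINT s=0..\<infinity>. exp ((Complex b t)\<^sup>2 / 2) * exp (- \<zeta> * of_real s)) = 0 - (- exp ((Complex b t)\<^sup>2 / 2) / \<zeta>)"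
    proof (rule interval_integral_FTC_integrable[where F = "\<lambda>s. - exp ((Complex b t)\<^sup>2 / 2) / \<zeta> * exp (- \<zeta> * of_real s)"])
      fix s :: real
      show "((\<lambda>s. - exp ((Complex b t)\<^sup>2 / 2) / \<zeta> * exp (- \<zeta> * of_real s)) has_vector_derivative
        exp ((Complex b t)\<^sup>2 / 2) * exp (- \<zeta> * of_real s)) (at s)"
        by (rule has_vector_derivative_real_field) (use \<open>\<zeta> \<noteq> 0\<close> in \<open>auto intro!: derivative_eq_intros\<close>)
      show "isCont (\<lambda>s. exp ((Complex b t)\<^sup>2 / 2) * exp (- \<zeta> * of_real s)) s"
        by (intro continuous_intros)
    next
      show "set_integrable lborel (einterval 0 \<infinity>) (\<lambda>s. exp ((Complex b t)\<^sup>2 / 2) * exp (- \<zeta> * of_real s))"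
        using int_ft[of t] unfolding ext[of "f t", OF f] by (simp add: set_integrable_def einterval_def greaterThan_def)
      have "((\<lambda>s. - exp ((Complex b t)\<^sup>2 / 2) / \<zeta> * exp (- \<zeta> * of_real s)) \<longlongrightarrow> - exp ((Complex b t)\<^sup>2 / 2) / \<zeta> * exp (- \<zeta> * of_real 0)) (at_right 0)"
        by (intro tendsto_intros)
      then show "(((\<lambda>s. - exp ((Complex b t)\<^sup>2 / 2) / \<zeta> * exp (- \<zeta> * of_real s)) \<circ> real_of_ereal) \<longlongrightarrow> - exp ((Complex b t)\<^sup>2 / 2) / \<zeta>) (at_right 0)"
        unfolding zero_ereal_def ereal_tendsto_simps1 by simp
      have "((\<lambda>s. exp (- d * s)) \<longlongrightarrow> 0) at_top" using d by real_asymp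
      then have "((\<lambda>s. exp (- \<zeta> * of_real s)) \<longlongrightarrow> 0) at_top"
        by (subst tendsto_norm_zero_iff[symmetric]) (simp add: Re)
      from tendsto_mult_right_zero[OF this]
      show "(((\<lambda>s. - exp ((Complex b t)\<^sup>2 / 2) / \<zeta> * exp (- \<zeta> * of_real s)) \<circ> real_of_ereal) \<longlongrightarrow> 0) (at_left \<infinity>)"
        unfolding ereal_tendsto_simps1 .
    qed simp
    have F2: "(\<integral>s. f t s \<partial>lborel) = (LBINT s=0..\<infinity>. exp ((Complex b t)\<^sup>2 / 2) * exp (- \<zeta> * of_real s))"
    proof -
      have "einterval 0 \<infinity> = {0<..}" by (auto simp: einterval_def)
      then show ?thesis unfolding interval_lebesgue_integral_def set_lebesgue_integral_def f by simp
    qed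
    have F3: "1 / \<zeta> = c / (Complex b t - of_real u)"
    proof -
      have "complex_of_real c * of_real c = 1" "c \<noteq> 0" using c by auto
      then have "Complex b t - of_real u = of_real c * \<zeta>" by (simp add: \<zeta>_def flip: mult.assoc)
      then show ?thesis using \<open>c \<noteq> 0\<close> by simp
    qed
    show ?thesis unfolding F2 F1 F3[symmetric] by simp
  qed
  have inner_t: "(\<integral>t. f t s \<partial>lborel) = indicator {0<..} s *\<^sub>R (2 * pi * exp (u\<^sup>2 / 2) * std_normal_density (u - c * s))" for s
  proof (cases "0 < s")
    case True
    have "f t s = exp (of_real (c * s * u - s\<^sup>2 / 2)) * exp ((Complex (b - c * s) t)\<^sup>2 / 2)" for t
    proof -
      \<comment> \<open>Completing the square, with \<open>c * c = 1\<close>, moves the line to real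
        part \<open>b - c * s\<close>, where the Gaussian integral has the same value.\<close>
      have "(Complex b t)\<^sup>2 / 2 + - of_real (c * s) * (Complex b t - of_real u) = of_real (c * s * u - s\<^sup>2 / 2) + (Complex (b - c * s) t)\<^sup>2 / 2"
        using c by (auto simp: complex_eq_iff power2_eq_square algebra_simps diff_divide_distrib add_divide_distrib)
      then have "exp ((Complex b t)\<^sup>2 / 2) * exp (- of_real (c * s) * (Complex b t - of_real u)) =
        exp (of_real (c * s * u - s\<^sup>2 / 2)) * exp ((Complex (b - c * s) t)\<^sup>2 / 2)"
        by (simp only: exp_add[symmetric])
      then show ?thesis using True by (simp add: f_def)
    qed
    then have "(\<integral>t. f t s \<partial>lborel) = exp (of_real (c * s * u - s\<^sup>2 / 2)) * (\<integral>t. exp ((Complex (b - c * s) t)\<^sup>2 / 2) \<partial>lborel)"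
      by simp
    also have "(\<integral>t. exp ((Complex (b - c * s) t)\<^sup>2 / 2) \<partial>lborel) = complex_of_real (2 * pi * hermite_coeff 0 0)"
    proof -
      have "(\<integral>t. exp ((Complex (b - c * s) t)\<^sup>2 / 2) \<partial>lborel) * \<i> = complex_of_real (2 * pi * hermite_coeff 0 0) * \<i>"
        using vertical_gauss_integral[of "b - c * s" 0] by (simp add: vertical_line_integral_def mult_ac del: hermite_coeff.simps)
      then show ?thesis by (simp only: mult_right_cancel[OF complex_i_not_zero])
    qed
    also have "exp (of_real (c * s * u - s\<^sup>2 / 2)) * complex_of_real (2 * pi * hermite_coeff 0 0) =
      complex_of_real (exp (c * s * u - s\<^sup>2 / 2) * (2 * pi * hermite_coeff 0 0))"
      by (simp only: exp_of_real of_real_mult)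
    also have "exp (c * s * u - s\<^sup>2 / 2) * (2 * pi * hermite_coeff 0 0) = 2 * pi * exp (u\<^sup>2 / 2) * std_normal_density (u - c * s)"
    proof -
      have "exp (c * s * u - s\<^sup>2 / 2) = exp (u\<^sup>2 / 2) * exp (- (u - c * s)\<^sup>2 / 2)"
      proof -
        have "c * s * u - s\<^sup>2 / 2 = u\<^sup>2 / 2 + - (u - c * s)\<^sup>2 / 2"
          using c by (elim disjE) (simp_all add: power2_eq_square algebra_simps diff_divide_distrib add_divide_distrib)
        then show ?thesis by (simp only: exp_add)
      qed
      then show ?thesis by (simp add: std_normal_density_def)
    qed
    finally show ?thesis using True by simp
  qed (simp add: f_def)
  have "vertical_line_integral b (\<lambda>z. exp (z\<^sup>2 / 2) / (of_real u - z)) = (\<integral>t. (- c * \<i>) * (exp ((Complex b t)\<^sup>2 / 2) * (c / (Complex b t - of_real u))) \<partial>lborel)"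
    unfolding vertical_line_integral_def
  proof (intro Bochner_Integration.integral_cong refl)
    fix t
    have "complex_of_real c * of_real c = 1" using c by auto
    moreover have "of_real u - Complex b t = - (Complex b t - of_real u)" by simp
    ultimately show "exp ((Complex b t)\<^sup>2 / 2) / (of_real u - Complex b t) * \<i> = (- c * \<i>) * (exp ((Complex b t)\<^sup>2 / 2) * (c / (Complex b t - of_real u)))"
      by (simp only: minus_divide_right[symmetric]) (simp add: mult_ac)
  qed
  also have "\<dots> = - c * \<i> * (\<integral>t. \<integral>s. f t s \<partial>lborel \<partial>lborel)"
    unfolding inner_s by (rule integral_mult_right_zero)
  also have "(\<integral>t. \<integral>s. f t s \<partial>lborel \<partial>lborel) = (\<integral>s. \<integral>t. f t s \<partial>lborel \<partial>lborel)"
    by (rule lborel_pair.Fubini_integral[OF int_f, symmetric])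
  also have "\<dots> = complex_of_real (2 * pi * exp (u\<^sup>2 / 2) * (LINT s:{0<..}|lborel. std_normal_density (u - c * s)))"
    unfolding inner_t set_lebesgue_integral_def
    by (simp add: mult.assoc mult.left_commute flip: integral_complex_of_real integral_mult_right_zero)
  finally show ?thesis unfolding normal_shift_integral[OF c] by (simp add: algebra_simps)
qed


lemma vertical_line_integral_cong:
  "(\<And>z. Re z = b \<Longrightarrow> f z = h z) \<Longrightarrow> vertical_line_integral b f = vertical_line_integral b h"
  by (simp add: vertical_line_integral_def)

text \<open>Writing \<open>z - v = (u - v) - (u - z)\<close>, the first part repeats the integral
  for \<open>l\<close> and the second cancels the denominator and leaves a moment. The hypotheses
  put the line to the left of \<open>u\<close> exactly if \<open>v < u\<close>; this is the origin
  of the jump in \<open>gauss_prim 0\<close>.\<close>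

lemma vertical_Cauchy_moment:
  assumes v: "v < b" and u: "v < u \<Longrightarrow> b < u"
  shows "vertical_line_integral b (\<lambda>z. (z - of_real v) ^ l * exp (z\<^sup>2 / 2) / (of_real u - z)) =
    - 2 * pi * \<i> * fact l * of_real (exp (u\<^sup>2 / 2) * gauss_prim l u v)"
proof (induction l)
  case 0
  show ?case
  proof (cases "v < u")
    case True
    then show ?thesis using vertical_Cauchy_gauss[of "-1" b u] u by simp
  next
    case False
    then show ?thesis using vertical_Cauchy_gauss[of 1 b u] v by simp
  qed
next
  case (Suc l)
  have ne: "u \<noteq> b" using u v by (cases "v < u") auto
  let ?J = "\<lambda>z. (z - of_real v) ^ l * exp (z\<^sup>2 / 2) / (of_real u - z)" and ?M = "\<lambda>z. (z - of_real v) ^ l * exp (z\<^sup>2 / 2)"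
  have M: "line_decay b ?M" by (intro line_decay_power_mult line_decay_exp)
  then have J: "line_decay b ?J" using ne by (intro line_decay_divide) auto
  have "vertical_line_integral b (\<lambda>z. (z - of_real v) ^ Suc l * exp (z\<^sup>2 / 2) / (of_real u - z)) =
    vertical_line_integral b (\<lambda>z. of_real (u - v) * ?J z - ?M z)"
  proof (rule vertical_line_integral_cong)
    fix z :: complex assume "Re z = b"
    then have "of_real u - z \<noteq> 0" using ne by (auto simp: complex_eq_iff)
    moreover define d where "d = of_real u - z"
    moreover have "(a - d) / d = a / d - 1" if "d \<noteq> 0" for a d :: complex using that by (simp add: diff_divide_distrib)
    moreover have zv: "z - of_real v = of_real (u - v) - d" by (simp add: d_def)
    ultimately have "(z - of_real v) / d = of_real (u - v) / d - 1" unfolding zv by blast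
    then have "?M z * ((z - of_real v) / d) = ?M z * (of_real (u - v) / d - 1)" by (simp only:)
    also have "\<dots> = of_real (u - v) * (?M z / d) - ?M z"
    proof -
      have "a * (c / e - 1) = c * (a / e) - a" for a c e :: complex by (simp add: right_diff_distrib)
      then show ?thesis by blast
    qed
    finally show "(z - of_real v) ^ Suc l * exp (z\<^sup>2 / 2) / (of_real u - z) = of_real (u - v) * ?J z - ?M z"
      unfolding d_def[symmetric] by (simp add: mult_ac)
  qed
  also have "\<dots> = of_real (u - v) * vertical_line_integral b ?J - vertical_line_integral b ?M"
    by (subst vertical_line_integral_diff[OF line_decay_cmult[OF J] M]) (simp only: vertical_line_integral_cmult)
  also have "\<dots> = - 2 * pi * \<i> * fact l * of_real ((u - v) * (exp (u\<^sup>2 / 2) * gauss_prim l u v) + hermite_coeff l v)"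
    unfolding Suc vertical_moment by (simp only: of_real_add of_real_mult) (simp add: algebra_simps)
  also have "(u - v) * (exp (u\<^sup>2 / 2) * gauss_prim l u v) + hermite_coeff l v = real (Suc l) * (exp (u\<^sup>2 / 2) * gauss_prim (Suc l) u v)"
  proof -
    have "real (Suc l) * gauss_prim (Suc l) u v = (u - v) * gauss_prim l u v + gauss u * hermite_coeff l v"
      by (simp del: of_nat_Suc)
    then have "exp (u\<^sup>2 / 2) * (real (Suc l) * gauss_prim (Suc l) u v) =
      (u - v) * (exp (u\<^sup>2 / 2) * gauss_prim l u v) + (exp (u\<^sup>2 / 2) * gauss u) * hermite_coeff l v"
      by (simp only: distrib_left mult_ac)
    then show ?thesis unfolding gauss_exp by (simp only: mult_1 mult.left_commute)
  qed
  finally show ?case by (simp only: of_real_mult of_real_of_nat_eq fact_Suc of_nat_mult mult_ac)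
qed

subsection \<open>Derivatives of the integrand\<close>

text \<open>The complex extension of \<open>gauss_poly\<close>, needed because the residue at
  \<open>u\<close> takes derivatives in a complex variable.\<close>

definition cgauss_poly :: "nat \<Rightarrow> real poly \<Rightarrow> complex \<Rightarrow> complex" where
  "cgauss_poly k P w = exp (- w\<^sup>2 / 2) * poly (map_poly of_real ((gauss_step ^^ k) P)) w"

lemma poly_map_of_real: "poly (map_poly complex_of_real P) (of_real u) = of_real (poly P u)"
  by (induction P) (simp_all add: map_poly_pCons)

lemma cgauss_poly_of_real: "cgauss_poly k P (of_real u) = of_real (gauss_poly k P u)"
  unfolding cgauss_poly_def gauss_poly_def gauss_def
  by (simp add: poly_map_of_real flip: exp_of_real)

lemma poly_map_of_real_deriv:
  "(poly (map_poly complex_of_real P) has_field_derivative poly (map_poly of_real (pderiv P)) w) (at w)"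
proof -
  have "pderiv (map_poly complex_of_real P) = map_poly of_real (pderiv P)"
    by (rule poly_eqI) (simp add: coeff_map_poly coeff_pderiv)
  then show ?thesis using poly_DERIV[of "map_poly complex_of_real P" w] by simp
qed

lemma cgauss_poly_deriv: "(cgauss_poly k P has_field_derivative cgauss_poly (Suc k) P w) (at w)"
proof -
  let ?Q = "(gauss_step ^^ k) P"
  have e: "((\<lambda>w. exp (- w\<^sup>2 / 2)) has_field_derivative - w * exp (- w\<^sup>2 / 2)) (at w)"
    by (rule derivative_eq_intros refl | simp)+
  have "map_poly complex_of_real (gauss_step ?Q) = map_poly of_real (pderiv ?Q) - pCons 0 (map_poly of_real ?Q)"
    by (rule poly_eqI) (simp add: gauss_step_def coeff_map_poly coeff_pCons split: nat.split)
  then have "poly (map_poly complex_of_real (gauss_step ?Q)) w = poly (map_poly of_real (pderiv ?Q)) w - w * poly (map_poly of_real ?Q) w"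
    by (simp only: poly_diff poly_pCons) simp
  then have "cgauss_poly (Suc k) P w = - w * exp (- w\<^sup>2 / 2) * poly (map_poly of_real ?Q) w +
      poly (map_poly of_real (pderiv ?Q)) w * exp (- w\<^sup>2 / 2)"
    unfolding cgauss_poly_def funpow.simps o_apply by (simp only:) (simp add: algebra_simps)
  then show ?thesis unfolding cgauss_poly_def[abs_def]
    using DERIV_mult[OF e poly_map_of_real_deriv[of ?Q w]] by (simp add: cgauss_poly_def)
qed

text \<open>Up to the sign \<open>(- 1) ^ k\<close> these are the Hermite polynomials. Their
  three-term recursion follows by applying \<open>gauss_step\<close> to the previous
  instance.\<close>

lemma gauss_step_Hermite:
  "(gauss_step ^^ Suc (Suc k)) 1 = - pCons 0 ((gauss_step ^^ Suc k) 1) - Polynomial.smult (real (Suc k)) ((gauss_step ^^ k) 1)"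
proof (induction k)
  case 0
  show ?case by (simp add: gauss_step_def one_pCons pderiv_pCons)
next
  case (Suc k)
  have X: "gauss_step (- pCons 0 P) = - pCons 0 (gauss_step P) - P" for P
    by (simp add: gauss_step_def pderiv_pCons pderiv_minus)
  have "(gauss_step ^^ Suc (Suc (Suc k))) 1 = gauss_step (- pCons 0 ((gauss_step ^^ Suc k) 1) - Polynomial.smult (real (Suc k)) ((gauss_step ^^ k) 1))"
    by (subst funpow.simps(2), subst o_apply, subst Suc) (rule refl)
  also have "\<dots> = - pCons 0 (gauss_step ((gauss_step ^^ Suc k) 1)) - (gauss_step ^^ Suc k) 1 - Polynomial.smult (real (Suc k)) (gauss_step ((gauss_step ^^ k) 1))"
    by (simp only: gauss_step_linear X)
  also have "\<dots> = - pCons 0 ((gauss_step ^^ Suc (Suc k)) 1) - Polynomial.smult (real (Suc (Suc k))) ((gauss_step ^^ Suc k) 1)"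
  proof -
    have S: "Polynomial.smult (real (Suc (Suc k))) P = P + Polynomial.smult (real (Suc k)) P" for P :: "real poly"
      unfolding of_nat_Suc[of "Suc k"] smult_add_left smult_1_left ..
    show ?thesis by (simp only: S funpow.simps o_apply diff_diff_eq)
  qed
  finally show ?case .
qed

lemma cgauss_poly_Hermite:
  "cgauss_poly (Suc k) 1 w + w * cgauss_poly k 1 w + of_nat k * cgauss_poly (k - 1) 1 w = 0"
proof (cases k)
  case 0
  have "map_poly complex_of_real (gauss_step 1) = [:0, -1:]"
    by (simp add: gauss_step_def one_pCons map_poly_pCons)
  then show ?thesis using 0 by (simp add: cgauss_poly_def)
next
  case (Suc j)
  have "map_poly complex_of_real ((gauss_step ^^ Suc (Suc j)) 1) =
    - pCons 0 (map_poly of_real ((gauss_step ^^ Suc j) 1)) - Polynomial.smult (of_nat (Suc j)) (map_poly of_real ((gauss_step ^^ j) 1))"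
    unfolding gauss_step_Hermite
    by (rule poly_eqI) (simp add: coeff_map_poly coeff_pCons split: nat.split)
  then have "poly (map_poly complex_of_real ((gauss_step ^^ Suc (Suc j)) 1)) w =
    - (w * poly (map_poly of_real ((gauss_step ^^ Suc j) 1)) w) - of_nat (Suc j) * poly (map_poly of_real ((gauss_step ^^ j) 1)) w"
    by (simp only: poly_diff poly_minus poly_pCons poly_smult) simp
  then show ?thesis unfolding Suc cgauss_poly_def diff_Suc_1 by (simp only:) (simp add: algebra_simps del: funpow.simps)
qed

text \<open>The \<open>k\<close>-th derivative in \<open>w\<close> of \<open>exp (- w\<^sup>2 / 2) / (w - z)\<close>; the recursion is the Leibniz rule for
  the product with \<open>w - z\<close>.\<close>
fun cauchy_gauss :: "nat \<Rightarrow> complex \<Rightarrow> complex \<Rightarrow> complex" where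
  "cauchy_gauss 0 w z = cgauss_poly 0 1 w / (w - z)"
| "cauchy_gauss (Suc k) w z = (cgauss_poly (Suc k) 1 w - of_nat (Suc k) * cauchy_gauss k w z) / (w - z)"

lemma cauchy_gauss_mult:
  assumes "w \<noteq> z"
  shows "cauchy_gauss (Suc k) w z * (w - z) = cgauss_poly (Suc k) 1 w - of_nat (Suc k) * cauchy_gauss k w z"
    and "cauchy_gauss 0 w z * (w - z) = cgauss_poly 0 1 w"
  using assms by auto

lemma cauchy_gauss_deriv_w:
  assumes "w \<noteq> z"
  shows "((\<lambda>w. cauchy_gauss k w z) has_field_derivative cauchy_gauss (Suc k) w z) (at w)"
proof (induction k)
  case 0
  have "((\<lambda>w. cgauss_poly 0 1 w / (w - z)) has_field_derivative
    (cgauss_poly (Suc 0) 1 w * (w - z) - cgauss_poly 0 1 w * 1) / ((w - z) * (w - z))) (at w)"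
    using assms by (intro DERIV_divide cgauss_poly_deriv) (auto intro!: derivative_eq_intros)
  also have "(cgauss_poly (Suc 0) 1 w * (w - z) - cgauss_poly 0 1 w * 1) / ((w - z) * (w - z)) = cauchy_gauss (Suc 0) w z"
    using assms by (simp add: field_simps)
  finally show ?case by simp
next
  case (Suc k)
  let ?N = "\<lambda>w. cgauss_poly (Suc k) 1 w - of_nat (Suc k) * cauchy_gauss k w z"
  let ?N' = "cgauss_poly (Suc (Suc k)) 1 w - of_nat (Suc k) * cauchy_gauss (Suc k) w z"
  have "((\<lambda>w. ?N w / (w - z)) has_field_derivative (?N' * (w - z) - ?N w * 1) / ((w - z) * (w - z))) (at w)"
    using assms by (intro DERIV_divide DERIV_diff DERIV_cmult cgauss_poly_deriv Suc) (auto intro!: derivative_eq_intros)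
  also have "(?N' * (w - z) - ?N w * 1) / ((w - z) * (w - z)) = cauchy_gauss (Suc (Suc k)) w z"
  proof -
    have "?N' * (w - z) - ?N w * 1 = (cgauss_poly (Suc (Suc k)) 1 w - of_nat (Suc (Suc k)) * cauchy_gauss (Suc k) w z) * (w - z)"
      using cauchy_gauss_mult(1)[OF assms, of k] by (simp add: algebra_simps del: cauchy_gauss.simps)
    then show ?thesis using assms by simp
  qed
  finally show ?case by simp
qed

text \<open>The sum of the derivatives in \<open>w\<close> and \<open>z\<close> does not see
  \<open>1 / (w - z)\<close>: on \<open>exp (- w^2 / 2) / (w - z)\<close> it gives
  \<open>- w\<close> times this function, which is \<open>- exp (- w^2 / 2)\<close> minus
  \<open>z\<close> times the function. Taking \<open>k\<close> derivatives in \<open>w\<close>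
  yields the formula.\<close>

lemma cauchy_gauss_deriv_z:
  assumes "w \<noteq> z"
  shows "((\<lambda>z. cauchy_gauss k w z) has_field_derivative
    - cauchy_gauss (Suc k) w z - cgauss_poly k 1 w - z * cauchy_gauss k w z) (at z)"
proof (induction k)
  case 0
  have "((\<lambda>z. cgauss_poly 0 1 w / (w - z)) has_field_derivative (0 * (w - z) - cgauss_poly 0 1 w * (0 - 1)) / ((w - z) * (w - z))) (at z)"
    using assms by (intro DERIV_divide) (auto intro!: derivative_eq_intros)
  also have "(0 * (w - z) - cgauss_poly 0 1 w * (0 - 1)) / ((w - z) * (w - z)) =
    - cauchy_gauss (Suc 0) w z - cgauss_poly 0 1 w - z * cauchy_gauss 0 w z"
  proof -
    have "(- cauchy_gauss (Suc 0) w z - cgauss_poly 0 1 w - z * cauchy_gauss 0 w z) * (w - z) =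
      - (cgauss_poly (Suc 0) 1 w - cauchy_gauss 0 w z) - cgauss_poly 0 1 w * (w - z) - z * cgauss_poly 0 1 w"
      using cauchy_gauss_mult(1)[OF assms, of 0] cauchy_gauss_mult(2)[OF assms]
      by (simp add: algebra_simps del: cauchy_gauss.simps)
    also have "\<dots> = cauchy_gauss 0 w z"
      using cgauss_poly_Hermite[of 0 w] by (simp add: algebra_simps add_eq_0_iff del: cauchy_gauss.simps)
    finally have "- cauchy_gauss (Suc 0) w z - cgauss_poly 0 1 w - z * cauchy_gauss 0 w z = cauchy_gauss 0 w z / (w - z)"
      using assms by (simp only: eq_divide_eq right_minus_eq) simp
    then show ?thesis by simp
  qed
  finally show ?case by simp
next
  case (Suc k)
  let ?C = "\<lambda>k. cauchy_gauss k w z" and ?g = "\<lambda>k. cgauss_poly k 1 w"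
  let ?D = "- ?C (Suc k) - ?g k - z * ?C k"
  have "((\<lambda>z. (?g (Suc k) - of_nat (Suc k) * cauchy_gauss k w z) / (w - z)) has_field_derivative
     ((0 - of_nat (Suc k) * ?D) * (w - z) - (?g (Suc k) - of_nat (Suc k) * ?C k) * (0 - 1)) / ((w - z) * (w - z))) (at z)"
    using assms by (intro DERIV_divide DERIV_diff DERIV_cmult Suc) (auto intro!: derivative_eq_intros)
  also have "((0 - of_nat (Suc k) * ?D) * (w - z) - (?g (Suc k) - of_nat (Suc k) * ?C k) * (0 - 1)) / ((w - z) * (w - z)) =
    - ?C (Suc (Suc k)) - ?g (Suc k) - z * ?C (Suc k)" (is "?L / _ = ?R")
  proof -
    have H: "?g (Suc (Suc k)) = - (w * ?g (Suc k)) - of_nat (Suc k) * ?g k"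
    proof -
      have "a = - c - e" if "a + c + e = 0" for a c e :: complex
        using that by (simp add: eq_diff_eq eq_neg_iff_add_eq_0 add_ac)
      then show ?thesis using cgauss_poly_Hermite[of "Suc k" w] unfolding diff_Suc_1 by blast
    qed
    have "?R * (w - z) = - (?g (Suc (Suc k)) - of_nat (Suc (Suc k)) * ?C (Suc k)) - ?g (Suc k) * (w - z) - z * (?g (Suc k) - of_nat (Suc k) * ?C k)"
      using cauchy_gauss_mult(1)[OF assms, of k] cauchy_gauss_mult(1)[OF assms, of "Suc k"]
      by (simp add: left_diff_distrib mult.assoc del: cauchy_gauss.simps of_nat_Suc)
    also have "\<dots> = of_nat (Suc k) * (?C (Suc k) + ?g k + z * ?C k) + ?C (Suc k)"
      unfolding H by (simp add: algebra_simps del: cauchy_gauss.simps)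
    finally have R: "?R * (w - z) = of_nat (Suc k) * (?C (Suc k) + ?g k + z * ?C k) + ?C (Suc k)" .
    have "?L = (of_nat (Suc k) * (?C (Suc k) + ?g k + z * ?C k) + ?C (Suc k)) * (w - z)"
      using cauchy_gauss_mult(1)[OF assms, of k] by (simp add: algebra_simps del: cauchy_gauss.simps of_nat_Suc)
    then have "?L = ?R * (w - z) * (w - z)" unfolding R .
    then have "?L = ?R * ((w - z) * (w - z))" by (simp only: mult.assoc)
    then show ?thesis using assms by simp
  qed
  finally show ?case by simp
qed

lemma line_decay_cauchy_gauss:
  assumes "line_decay b f" "Re w \<noteq> b"
  shows "line_decay b (\<lambda>z. f z * cauchy_gauss k w z)"
proof (induction k)
  case 0
  have "line_decay b (\<lambda>z. (cgauss_poly 0 1 w * f z) / (w - z))"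
    by (intro line_decay_divide line_decay_cmult assms)
  then show ?case by (simp add: mult.commute)
next
  case (Suc k)
  have "line_decay b (\<lambda>z. (cgauss_poly (Suc k) 1 w * f z - of_nat (Suc k) * (f z * cauchy_gauss k w z)) / (w - z))"
    by (intro line_decay_divide line_decay_diff line_decay_cmult assms Suc)
  then show ?case by (simp add: algebra_simps)
qed

text \<open>Integration by parts in \<open>z\<close> trades one derivative in \<open>w\<close> for a
  lower power of \<open>z - v\<close> and a moment, which is the recursion of
  \<open>gauss_prim_deriv\<close>.\<close>

lemma vertical_cauchy_gauss:
  assumes v: "v < b" and u: "v < u \<Longrightarrow> b < u"
  shows "vertical_line_integral b (\<lambda>z. (z - of_real v) ^ l * exp (z\<^sup>2 / 2) * cauchy_gauss k (of_real u) z) =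
    - 2 * pi * \<i> * fact l * of_real (gauss_prim_deriv k l u v)"
proof (induction k arbitrary: l)
  case 0
  have "vertical_line_integral b (\<lambda>z. (z - of_real v) ^ l * exp (z\<^sup>2 / 2) * cauchy_gauss 0 (of_real u) z) =
    vertical_line_integral b (\<lambda>z. of_real (gauss u) * ((z - of_real v) ^ l * exp (z\<^sup>2 / 2) / (of_real u - z)))"
    by (intro vertical_line_integral_cong) (simp add: cgauss_poly_of_real gauss_poly_0)
  also have "\<dots> = - 2 * pi * \<i> * fact l * of_real ((exp (u\<^sup>2 / 2) * gauss u) * gauss_prim l u v)"
  proof -
    have "vertical_line_integral b (\<lambda>z. (z - of_real v) ^ l * exp (z\<^sup>2 / 2) / (of_real u - z)) =
      - 2 * pi * \<i> * fact l * of_real (exp (u\<^sup>2 / 2) * gauss_prim l u v)"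
      by (rule vertical_Cauchy_moment[OF v]) (rule u)
    then show ?thesis unfolding vertical_line_integral_cmult by (simp only: of_real_mult mult_ac)
  qed
  finally show ?case by (simp add: gauss_exp)
next
  case (Suc k)
  have ne: "u \<noteq> b" using u v by (cases "v < u") auto
  let ?e = "\<lambda>l z. (z - of_real v) ^ l * exp (z\<^sup>2 / 2)"
  let ?H = "\<lambda>z. ?e l z * cauchy_gauss k (of_real u) z"
  \<comment> \<open>The derivative of \<open>?H\<close>: the factor \<open>z\<close> produced by
    \<open>exp (z^2 / 2)\<close> cancels against the last term of
    \<open>cauchy_gauss_deriv_z\<close>. For \<open>l = 0\<close> the truncated \<open>l - 1\<close>
    is multiplied by 0.\<close>
  let ?h = "\<lambda>z. of_nat l * (?e (l - 1) z * cauchy_gauss k (of_real u) z) - (?e l z * cauchy_gauss (Suc k) (of_real u) z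
      + cgauss_poly k 1 (of_real u) * ?e l z)"
  have e: "line_decay b (?e l)" for l by (intro line_decay_power_mult line_decay_exp)
  have dec: "line_decay b (\<lambda>z. ?e l z * cauchy_gauss k (of_real u) z)" for l k
    by (rule line_decay_cauchy_gauss[OF e]) (use ne in simp)
  have dec2: "line_decay b (\<lambda>z. ?e l z * cauchy_gauss (Suc k) (of_real u) z + cgauss_poly k 1 (of_real u) * ?e l z)"
    by (intro line_decay_add line_decay_cmult dec e)
  have "vertical_line_integral b ?h = 0"
  proof (rule vertical_line_integral_deriv)
    show "line_decay b ?H" by (rule dec)
    show "line_decay b ?h" by (intro line_decay_diff line_decay_cmult dec dec2)
    fix z :: complex assume "Re z = b"
    then have z: "of_real u \<noteq> z" using ne by auto
    have p: "(?e l has_field_derivative (of_nat l * ?e (l - 1) z + z * ?e l z)) (at z)"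
      by (rule derivative_eq_intros refl | simp add: algebra_simps)+
    from DERIV_mult[OF p cauchy_gauss_deriv_z[OF z, of k]]
    show "(?H has_field_derivative ?h z) (at z)"
      by (simp add: algebra_simps del: cauchy_gauss.simps)
  qed
  then have *: "of_nat l * vertical_line_integral b (\<lambda>z. ?e (l - 1) z * cauchy_gauss k (of_real u) z) -
      (vertical_line_integral b (\<lambda>z. ?e l z * cauchy_gauss (Suc k) (of_real u) z) + cgauss_poly k 1 (of_real u) * vertical_line_integral b (?e l)) = 0"
    using dec dec2 e by (simp only: vertical_line_integral_diff vertical_line_integral_add vertical_line_integral_cmult line_decay_cmult)
  have "vertical_line_integral b (\<lambda>z. ?e l z * cauchy_gauss (Suc k) (of_real u) z) =
    of_nat l * vertical_line_integral b (\<lambda>z. ?e (l - 1) z * cauchy_gauss k (of_real u) z) - cgauss_poly k 1 (of_real u) * vertical_line_integral b (?e l)"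
  proof -
    have "y = a - c" if "a - (y + c) = 0" for a y c :: complex using that by (simp add: algebra_simps)
    then show ?thesis using * by blast
  qed
  also have "\<dots> = of_nat l * (- 2 * pi * \<i> * fact (l - 1) * of_real (gauss_prim_deriv k (l - 1) u v))
     - of_real (gauss_poly k 1 u) * (2 * pi * \<i> * fact l * hermite_coeff l v)"
    unfolding Suc vertical_moment cgauss_poly_of_real ..
  also have "\<dots> = - 2 * pi * \<i> * fact l * of_real (gauss_prim_deriv (Suc k) l u v)"
    by (cases l) (simp_all add: algebra_simps del: hermite_coeff.simps)
  finally show ?case .
qed


subsection \<open>The contour integral\<close>

text \<open>Both sides are polynomials in \<open>w\<close> of degree at most \<open>m\<close> that
  agree at the \<open>m + 1\<close> points \<open>z, x 1, ..., x m\<close>. After division by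
  \<open>w - z\<close> only the summand 1 keeps a pole at \<open>z\<close>.\<close>

lemma lagrange_partial_fractions:
  assumes inj: "inj_on x {1..m}" and z: "\<And>r. r \<in> {1..m} \<Longrightarrow> z \<noteq> complex_of_real (x r)"
  shows "(\<Prod>r=1..m. (w - of_real (x r)) / (z - of_real (x r))) =
    1 - (\<Sum>r=1..m. poly (map_poly of_real (lagrange_basis m x r)) w * ((w - z) / (of_real (x r) - z)))"
proof -
  define L where "L = (\<lambda>r. map_poly complex_of_real (lagrange_basis m x r))"
  define P where "P = (\<Prod>r=1..m. Polynomial.smult (1 / (z - of_real (x r))) [:- of_real (x r), 1:])"
  define S where "S = (\<Sum>r=1..m. Polynomial.smult (1 / (of_real (x r) - z)) (L r * [:- z, 1:]))"
  define Q where "Q = 1 - S - P"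
  have polyP: "poly P w = (\<Prod>r=1..m. (w - of_real (x r)) / (z - of_real (x r)))" for w
    unfolding P_def poly_prod by (intro prod.cong refl) (simp add: diff_divide_distrib)
  have polyS: "poly S w = (\<Sum>r=1..m. poly (L r) w * ((w - z) / (of_real (x r) - z)))" for w
    unfolding S_def poly_sum by (intro sum.cong refl) (simp add: diff_divide_distrib right_diff_distrib mult_ac)
  have degP: "degree P \<le> m"
  proof -
    have "degree P \<le> (\<Sum>r\<in>{1..m}. (degree \<circ> (\<lambda>r. Polynomial.smult (1 / (z - of_real (x r))) [:- of_real (x r), 1:])) r)"
      unfolding P_def by (rule degree_prod_sum_le) simp
    also have "\<dots> \<le> (\<Sum>r\<in>{1..m}. 1)" by (intro sum_mono) (auto intro!: order_trans[OF degree_smult_le])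
    finally show ?thesis by simp
  qed
  have degS: "degree S \<le> m" unfolding S_def
  proof (rule degree_sum_le)
    fix r assume r: "r \<in> {1..m}"
    have "degree (L r * [:- z, 1:]) \<le> degree (L r) + degree [:- z, 1:]" by (rule degree_mult_le)
    also have "\<dots> \<le> m"
      using degree_lagrange_basis[OF r, of x] map_poly_degree_leq[of complex_of_real "lagrange_basis m x r"] by (simp add: L_def)
    finally show "degree (Polynomial.smult (1 / (of_real (x r) - z)) (L r * [:- z, 1:])) \<le> m"
      by (rule order_trans[OF degree_smult_le])
  qed simp
  have "degree Q \<le> m" unfolding Q_def by (intro degree_diff_le degP degS) simp
  have "poly Q (of_real (x s)) = 0" if s: "s \<in> {1..m}" for s
  proof -
    have "poly P (of_real (x s)) = 0" unfolding polyP using s by (intro prod_zero) auto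
    moreover have "poly S (of_real (x s)) = (\<Sum>r=1..m. if r = s then 1 else 0)"
      unfolding polyS L_def poly_map_of_real
    proof (intro sum.cong refl)
      fix r assume "r \<in> {1..m}"
      then show "complex_of_real (poly (lagrange_basis m x r) (x s)) * ((of_real (x s) - z) / (of_real (x r) - z)) = (if r = s then 1 else 0)"
        using poly_lagrange_basis[OF inj _ s, of r] z[OF s] by (cases "r = s") simp_all
    qed
    ultimately show ?thesis using s by (simp add: Q_def)
  qed
  moreover have "poly Q z = 0"
  proof -
    have "poly P z = 1" unfolding polyP using z by (intro prod.neutral) auto
    then show ?thesis by (simp add: Q_def polyS)
  qed
  ultimately have roots: "insert z ((\<lambda>s. of_real (x s)) ` {1..m}) \<subseteq> {w. poly Q w = 0}" by auto
  have "Q = 0"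
  proof (rule ccontr)
    assume ne: "Q \<noteq> 0"
    have "inj_on (\<lambda>s. complex_of_real (x s)) {1..m}"
      by (rule inj_onI, rule inj_onD[OF inj]) simp_all
    then have "card ((\<lambda>s. complex_of_real (x s)) ` {1..m}) = m" by (simp add: card_image)
    moreover have "z \<notin> (\<lambda>s. complex_of_real (x s)) ` {1..m}" using z by blast
    ultimately have "Suc m = card (insert z ((\<lambda>s. complex_of_real (x s)) ` {1..m}))" by simp
    also have "\<dots> \<le> card {w. poly Q w = 0}" by (rule card_mono[OF poly_roots_finite[OF ne] roots])
    also have "\<dots> \<le> degree Q" by (rule card_poly_roots_bound[OF ne])
    finally show False using \<open>degree Q \<le> m\<close> by simp
  qed
  then have "poly (1 - S - P) w = 0" unfolding Q_def by simp
  then show ?thesis by (simp add: polyP polyS L_def)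
qed

lemma higher_deriv_eq:
  fixes A :: "nat \<Rightarrow> complex \<Rightarrow> complex"
  assumes "open S" "\<And>k w. w \<in> S \<Longrightarrow> (A k has_field_derivative A (Suc k) w) (at w)" "w \<in> S"
  shows "(deriv ^^ k) (A 0) w = A k w"
  using assms(3)
proof (induction k arbitrary: w)
  case (Suc k)
  have "((deriv ^^ k) (A 0) has_field_derivative A (Suc k) w) (at w)"
    by (rule has_field_derivative_transform_within_open[OF assms(2)[OF Suc.prems] assms(1) Suc.prems])
       (simp add: Suc.IH)
  then show ?case by (simp add: DERIV_imp_deriv)
qed simp

text \<open>The line is an unbounded connected set that avoids \<open>S\<close>.\<close>

lemma vertical_line_outside:
  assumes "bounded S" "S \<inter> {z. Re z = b} = {}" "Re z = b"
  shows "z \<in> outside S"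
proof -
  let ?L = "{z. Re z = b}"
  have "convex ?L" using convex_halfspace_Re_le[of b] convex_halfspace_Re_ge[of b]
    by (simp add: set_eq_iff convex_alt) (auto simp: convex_alt algebra_simps simp flip: distrib_right)
  then have "?L \<subseteq> connected_component_set (- S) z"
    using assms by (intro connected_component_maximal convex_connected) auto
  moreover have "\<not> bounded ?L"
  proof
    assume "bounded ?L"
    then obtain B where B: "\<And>z. z \<in> ?L \<Longrightarrow> norm z \<le> B" unfolding bounded_iff by blast
    have "\<bar>B\<bar> + 1 \<le> norm (Complex b (\<bar>B\<bar> + 1))" using abs_Im_le_cmod[of "Complex b (\<bar>B\<bar> + 1)"] by simp
    then show False using B[of "Complex b (\<bar>B\<bar> + 1)"] by simp
  qed
  moreover have "z \<notin> S" using assms by auto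
  ultimately show ?thesis unfolding outside_def using bounded_subset by blast
qed

text \<open>By the partial fractions, the integrand is \<open>A 0 w / (w - u)^(k + 1)\<close> with
  \<open>A 0\<close> holomorphic away from \<open>z\<close>. Since \<open>z\<close> lies outside the
  loop, only the residue at \<open>u\<close> counts, and it is \<open>A k u / k!\<close>.\<close>

lemma contour_integral_kernel:
  assumes x: "x \<in> Conf0 m" and line: "admissible_line m x u v b" and loop: "admissible_loop m x u b \<gamma>"
    and z: "Re z = b"
  shows "contour_integral \<gamma> (\<lambda>w. (z - of_real v) ^ l / (w - of_real u) ^ (k + 1) *
       (exp (z\<^sup>2 / 2 - w\<^sup>2 / 2) / (w - z)) * (\<Prod>r=1..m. (w - of_real (x r)) / (z - of_real (x r)))) =
    2 * pi * \<i> / fact k * ((z - of_real v) ^ l * exp (z\<^sup>2 / 2) *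
      (cauchy_gauss k (of_real u) z - (\<Sum>r=1..m. cgauss_poly k (lagrange_basis m x r) (of_real u) / (of_real (x r) - z))))"
proof -
  define A where "A = (\<lambda>k w. (z - of_real v) ^ l * exp (z\<^sup>2 / 2) *
    (cauchy_gauss k w z - (\<Sum>r=1..m. cgauss_poly k (lagrange_basis m x r) w / (of_real (x r) - z))))"
  have xb: "x r \<noteq> b" if "r \<in> {1..m}" for r using line that unfolding admissible_line_def by force
  then have zx: "z \<noteq> of_real (x r)" if "r \<in> {1..m}" for r using z xb[OF that] by auto
  have ub: "u \<noteq> b" using line unfolding admissible_line_def by force
  then have uz: "of_real u \<noteq> z" using z by auto
  have A_deriv: "(A k has_field_derivative A (Suc k) w) (at w)" if "w \<in> - {z}" for k w
  proof -
    have "w \<noteq> z" using that by simp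
    then show ?thesis unfolding A_def
      by (intro DERIV_cmult DERIV_diff DERIV_sum DERIV_cdivide cauchy_gauss_deriv_w cgauss_poly_deriv)
  qed
  then have A_holo: "A 0 holomorphic_on - {z}"
    by (intro holomorphic_onI) (auto simp: field_differentiable_def intro: has_field_derivative_at_within)
  have integrand: "(z - of_real v) ^ l / (w - of_real u) ^ (k + 1) * (exp (z\<^sup>2 / 2 - w\<^sup>2 / 2) / (w - z)) *
     (\<Prod>r=1..m. (w - of_real (x r)) / (z - of_real (x r))) = A 0 w / (w - of_real u) ^ Suc k" if "w \<noteq> z" for w
  proof -
    let ?S = "\<Sum>r=1..m. poly (map_poly of_real (lagrange_basis m x r)) w * ((w - z) / (of_real (x r) - z))"
    have "exp (z\<^sup>2 / 2 - w\<^sup>2 / 2) / (w - z) * (1 - ?S) = exp (z\<^sup>2 / 2) * (exp (- w\<^sup>2 / 2) / (w - z) - exp (- w\<^sup>2 / 2) * (?S / (w - z)))"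
    proof -
      have "a * e / d * (1 - S) = a * (e / d - e * (S / d))" for a e d S :: complex
        by (simp add: right_diff_distrib diff_divide_distrib mult_ac)
      moreover have "exp (z\<^sup>2 / 2 - w\<^sup>2 / 2) = exp (z\<^sup>2 / 2) * exp (- w\<^sup>2 / 2)"
        unfolding exp_add[symmetric] by (rule arg_cong[where f = exp]) simp
      ultimately show ?thesis by (simp only:)
    qed
    also have "?S / (w - z) = (\<Sum>r=1..m. poly (map_poly of_real (lagrange_basis m x r)) w / (of_real (x r) - z))"
      using that by (simp add: sum_divide_distrib)
    finally have E: "exp (z\<^sup>2 / 2 - w\<^sup>2 / 2) / (w - z) * (1 - ?S) =
      exp (z\<^sup>2 / 2) * (cauchy_gauss 0 w z - (\<Sum>r=1..m. cgauss_poly 0 (lagrange_basis m x r) w / (of_real (x r) - z)))"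
      by (simp add: cgauss_poly_def sum_distrib_left)
    have PF: "(\<Prod>r=1..m. (w - of_real (x r)) / (z - of_real (x r))) = 1 - ?S"
      by (rule lagrange_partial_fractions[OF Conf0_inj_on[OF x]]) (rule zx)
    show ?thesis unfolding PF mult.assoc E A_def by simp
  qed
  have \<gamma>: "valid_path \<gamma>" "pathfinish \<gamma> = pathstart \<gamma>" "of_real u \<in> inside (path_image \<gamma>)" "winding_number \<gamma> (of_real u) = 1"
    and disj: "path_image \<gamma> \<inter> {z. Re z = b} = {}" using loop unfolding admissible_loop_def by auto
  have zout: "z \<in> outside (path_image \<gamma>)"
    using \<gamma>(1) disj z by (intro vertical_line_outside[of _ b] bounded_path_image valid_path_imp_path)
  have zpath: "z \<notin> path_image \<gamma>" using disj z by auto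
  have upath: "of_real u \<notin> path_image \<gamma>" using \<gamma>(3) inside_no_overlap by blast
  have "contour_integral \<gamma> (\<lambda>w. (z - of_real v) ^ l / (w - of_real u) ^ (k + 1) *
       (exp (z\<^sup>2 / 2 - w\<^sup>2 / 2) / (w - z)) * (\<Prod>r=1..m. (w - of_real (x r)) / (z - of_real (x r)))) =
    contour_integral \<gamma> (\<lambda>w. A 0 w / (w - of_real u) ^ Suc k)"
    by (rule contour_integral_cong[OF refl], rule integrand) (use zpath in auto)
  also have "\<dots> = 2 * pi * \<i> * (\<Sum>p\<in>{of_real u}. winding_number \<gamma> p * residue (\<lambda>w. A 0 w / (w - of_real u) ^ Suc k) p)"
  proof (rule Residue_theorem[where S = "- {z}"])
    show "connected (- {z})" by (rule connected_punctured_universe) simp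
    show "(\<lambda>w. A 0 w / (w - of_real u) ^ Suc k) holomorphic_on - {z} - {of_real u}"
      by (intro holomorphic_intros holomorphic_on_subset[OF A_holo]) auto
    show "path_image \<gamma> \<subseteq> - {z} - {of_real u}" using zpath upath by auto
    show "\<forall>w. w \<notin> - {z} \<longrightarrow> winding_number \<gamma> w = 0"
      using winding_number_zero_in_outside[OF valid_path_imp_path[OF \<gamma>(1)] \<gamma>(2) zout] by simp
  qed (use \<gamma> in auto)
  also have "\<dots> = 2 * pi * \<i> * ((deriv ^^ k) (A 0) (of_real u) / fact k)"
  proof -
    have "residue (\<lambda>w. A 0 w / (w - of_real u) ^ Suc k) (of_real u) = (deriv ^^ k) (A 0) (of_real u) / fact k"
      using uz by (intro residue_holomorphic_over_power[OF _ _ A_holo]) auto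
    then show ?thesis using \<gamma>(4) by (simp del: power_Suc)
  qed
  also have "(deriv ^^ k) (A 0) (of_real u) = A k (of_real u)"
    by (rule higher_deriv_eq[of "- {z}"]) (use A_deriv uz in auto)
  finally show ?thesis by (simp add: A_def)
qed

text \<open>Admissibility of the line puts \<open>b\<close> to the left of \<open>x r\<close>
  exactly if \<open>v < x r\<close>, and likewise for \<open>u\<close>; this matches the jumps in
  \<open>gauss_prim l (x r) v\<close> and \<open>gauss_prim_deriv k l u v\<close>. The right-hand
  side is free of \<open>b\<close> and \<open>\<gamma>\<close>.\<close>

lemma gue_kernel_eq:
  assumes x: "x \<in> Conf0 m" and n: "m < n1" "m < n2"
    and line: "admissible_line m x u v b" and loop: "admissible_loop m x u b \<gamma>"
  shows "gue_kernel m x b \<gamma> (n1, u) (n2, v) = of_real (level_kernel m x (n1, u) (n2, v))"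
proof -
  define k l where "k = n1 - m" and "l = n2 - m - 1"
  have v: "v < b" and u: "v < u \<Longrightarrow> b < u" and xr: "\<And>r. r \<in> {1..m} \<Longrightarrow> v < x r \<Longrightarrow> b < x r"
    using line unfolding admissible_line_def by auto
  have ub: "u \<noteq> b" and xb: "\<And>r. r \<in> {1..m} \<Longrightarrow> x r \<noteq> b" using v u xr by force+
  let ?e = "\<lambda>z. (z - of_real v) ^ l * exp (z\<^sup>2 / 2)"
  let ?c = "\<lambda>r. cgauss_poly k (lagrange_basis m x r) (of_real u)"
  have e: "line_decay b ?e" by (intro line_decay_power_mult line_decay_exp)
  have dec1: "line_decay b (\<lambda>z. ?e z * cauchy_gauss k (of_real u) z)"
    by (rule line_decay_cauchy_gauss[OF e]) (use ub in simp)
  have dec2: "line_decay b (\<lambda>z. ?c r * (?e z / (of_real (x r) - z)))" if "r \<in> {1..m}" for r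
    by (intro line_decay_cmult line_decay_divide e) (use xb[OF that] in simp)
  have "vertical_line_integral b (\<lambda>z. contour_integral \<gamma> (\<lambda>w. (z - of_real v) ^ l / (w - of_real u) ^ (k + 1) *
       (exp (z\<^sup>2 / 2 - w\<^sup>2 / 2) / (w - z)) * (\<Prod>r=1..m. (w - of_real (x r)) / (z - of_real (x r))))) =
    vertical_line_integral b (\<lambda>z. 2 * pi * \<i> / fact k *
      (?e z * cauchy_gauss k (of_real u) z - (\<Sum>r=1..m. ?c r * (?e z / (of_real (x r) - z)))))"
  proof (rule vertical_line_integral_cong)
    fix z :: complex assume "Re z = b"
    note contour_integral_kernel[OF x line loop this, of l k]
    also have "?e z * (cauchy_gauss k (of_real u) z - (\<Sum>r=1..m. ?c r / (of_real (x r) - z))) =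
      ?e z * cauchy_gauss k (of_real u) z - (\<Sum>r=1..m. ?c r * (?e z / (of_real (x r) - z)))"
      by (simp add: right_diff_distrib sum_distrib_left mult_ac)
    finally show "contour_integral \<gamma> (\<lambda>w. (z - of_real v) ^ l / (w - of_real u) ^ (k + 1) *
       (exp (z\<^sup>2 / 2 - w\<^sup>2 / 2) / (w - z)) * (\<Prod>r=1..m. (w - of_real (x r)) / (z - of_real (x r)))) =
      2 * pi * \<i> / fact k * (?e z * cauchy_gauss k (of_real u) z - (\<Sum>r=1..m. ?c r * (?e z / (of_real (x r) - z))))" .
  qed
  also have "\<dots> = 2 * pi * \<i> / fact k * (vertical_line_integral b (\<lambda>z. ?e z * cauchy_gauss k (of_real u) z) -
      (\<Sum>r=1..m. ?c r * vertical_line_integral b (\<lambda>z. ?e z / (of_real (x r) - z))))"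
  proof -
    have "vertical_line_integral b (\<lambda>z. \<Sum>r=1..m. ?c r * (?e z / (of_real (x r) - z))) =
      (\<Sum>r=1..m. ?c r * vertical_line_integral b (\<lambda>z. ?e z / (of_real (x r) - z)))"
      by (subst vertical_line_integral_sum[OF dec2]) (simp_all only: vertical_line_integral_cmult)
    then show ?thesis
      by (simp only: vertical_line_integral_cmult vertical_line_integral_diff[OF dec1 line_decay_sum[OF dec2]])
  qed
  also have "vertical_line_integral b (\<lambda>z. ?e z * cauchy_gauss k (of_real u) z) = - 2 * pi * \<i> * fact l * of_real (gauss_prim_deriv k l u v)"
    by (rule vertical_cauchy_gauss[OF v]) (rule u)
  also have "(\<Sum>r=1..m. ?c r * vertical_line_integral b (\<lambda>z. ?e z / (of_real (x r) - z))) =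
    (\<Sum>r=1..m. - 2 * pi * \<i> * fact l * of_real (lagrange_coeff m x k u r * gauss_prim l (x r) v))"
  proof (intro sum.cong refl)
    fix r assume r: "r \<in> {1..m}"
    have "vertical_line_integral b (\<lambda>z. ?e z / (of_real (x r) - z)) = - 2 * pi * \<i> * fact l * of_real (exp ((x r)\<^sup>2 / 2) * gauss_prim l (x r) v)"
      by (rule vertical_Cauchy_moment[OF v]) (rule xr[OF r])
    then show "?c r * vertical_line_integral b (\<lambda>z. ?e z / (of_real (x r) - z)) = - 2 * pi * \<i> * fact l * of_real (lagrange_coeff m x k u r * gauss_prim l (x r) v)"
      unfolding cgauss_poly_of_real lagrange_coeff_def by (simp only: of_real_mult mult_ac)
  qed
  also have "- 2 * pi * \<i> * fact l * of_real (gauss_prim_deriv k l u v) -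
      (\<Sum>r=1..m. - 2 * pi * \<i> * fact l * of_real (lagrange_coeff m x k u r * gauss_prim l (x r) v)) =
    - 2 * pi * \<i> * fact l * of_real (rising_kernel m x k l u v)"
    unfolding rising_kernel_def sum_distrib_left[symmetric] right_diff_distrib[symmetric] of_real_diff of_real_sum ..
  finally have V: "vertical_line_integral b (\<lambda>z. contour_integral \<gamma> (\<lambda>w. (z - of_real v) ^ l / (w - of_real u) ^ (k + 1) *
       (exp (z\<^sup>2 / 2 - w\<^sup>2 / 2) / (w - z)) * (\<Prod>r=1..m. (w - of_real (x r)) / (z - of_real (x r))))) =
    2 * pi * \<i> / fact k * (- 2 * pi * \<i> * fact l * of_real (rising_kernel m x k l u v))" .
  have "gue_kernel m x b \<gamma> (n1, u) (n2, v) = fact k / fact l * (- 1 / (2 * complex_of_real pi * \<i>)\<^sup>2) *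
    (2 * pi * \<i> / fact k * (- 2 * pi * \<i> * fact l * of_real (rising_kernel m x k l u v)))"
    unfolding gue_kernel_def prod.case k_def[symmetric] l_def[symmetric] V ..
  \<comment> \<open>The factorials cancel, and the two residue constants multiply to
    \<open>- (2 * pi * \<i>)^2\<close>, the inverse of the prefactor.\<close>
  also have "\<dots> = of_real (rising_kernel m x k l u v)"
    by (simp add: power2_eq_square field_simps)
  finally show ?thesis by (simp add: level_kernel_def k_def l_def)
qed

theorem theorem1p7:
  fixes m :: nat and x :: "nat \<Rightarrow> real"
    and M :: "'w measure" and X :: "nat \<Rightarrow> 'w \<Rightarrow> nat \<Rightarrow> real"
  assumes "x \<in> Conf0 m"
    and "rising_gue_process m x M X"
  shows "\<exists>K. determinantal M (level_measure m) (level_points m X) K \<and>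
    (\<forall>n1>m. \<forall>n2>m. \<forall>x1 x2 b \<gamma>.
       admissible_line m x x1 x2 b \<longrightarrow> admissible_loop m x x1 b \<gamma> \<longrightarrow>
       K (n1, x1) (n2, x2) = gue_kernel m x b \<gamma> (n1, x1) (n2, x2))"
proof -
  interpret rising_gue m x M X by standard (rule assms)+
  show ?thesis
    \<comment> \<open>One \<open>K\<close> serves all admissible \<open>b\<close> and
      \<open>\<gamma>\<close>, so the independence of the contours is part of the
      conclusion.\<close>
    by (intro exI[of _ "\<lambda>p q. complex_of_real (level_kernel m x p q)"] conjI allI impI
        level_points_determinantal gue_kernel_eq[OF assms(1), symmetric])
qed

end
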